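(* Let $k\geq 1$ be a fixed constant. There is an algorithm which, given a matrix $S\in\mathbb R^{m\times n}$, runs in time polynomial in $m,n$, determines whether $S$ is a $k$-product, and in case it is, outputs two matrices $S_1,S_2$ and (if $k\geq 2$) special rows $x_1,\dots,x_{k-1}$ of $S_1$ and $y_1,\dots,y_{k-1}$ of $S_2$ such that $S$ is isomorphic to $(S_1,x_1,\dots,x_{k-1})\otimes_k(S_2,y_1,\dots,y_{k-1})$.
   Context: Two matrices are isomorphic if one is obtained from the other by permuting rows and columns. For $S_1\in\mathbb R^{m_1\times n_1}$, $S_2\in\mathbb R^{m_2\times n_2}$, the 1-product $S_1\otimes S_2\in\mathbb R^{(m_1+m_2)\times n_1n_2}$ is the matrix whose $((a-1)n_2+b)$-th column is the $a$-th column of $S_1$ stacked on top of the $b$-th column of $S_2$ ($a\in[n_1]$, $b\in[n_2]$). A matrix $S$ is a 1-product if it is isomorphic to $S_1\otimes S_2$ for some non-empty matrices $S_1,S_2$. For $k\geq 2$: an ordered tuple $(x_1,\dots,x_{k-1})$ of rows of a matrix $T$ is a tuple of special rows if the columns of $T$ restricted to these rows are all among $\mathbf 0,e_1,\dots,e_{k-1}\in\mathbb R^{k-1}$ and each of these $k$ vectors occurs at least once. Then $T[0]$ denotes the submatrix of $T$ with the special rows deleted, restricted to the columns whose entries in all special rows are $0$, and for $j\in[k-1]$, $T[j]$ denotes the submatrix with the special rows deleted, restricted to the columns whose entry in $x_j$ is $1$. Given $S_1$ with special rows $(x_1,\dots,x_{k-1})$ and $S_2$ with special rows $(y_1,\dots,y_{k-1})$,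 the $k$-product $(S_1,x_1,\dots,x_{k-1})\otimes_k(S_2,y_1,\dots,y_{k-1})$ is the matrix whose columns are: for each $j\in\{0,\dots,k-1\}$, every column of $S_1[j]\otimes S_2[j]$ extended below by $k-1$ additional entries equal to $\mathbf 0$ (if $j=0$) or to $e_j$ (if $j\geq1$). A matrix $S$ is a $k$-product ($k\geq2$) if it is isomorphic to such a $k$-product of two matrices $S_1,S_2$ each having fewer rows and fewer columns than $S$. *)

theory Defs
  imports
    "Jordan_Normal_Form.DL_Submatrix"
    "HOL-Combinatorics.Permutations"
    "HOL-Computational_Algebra.Polynomial"
begin

section \<open>Products of matrices\<close>

text \<open>Rows and columns are numbered from 0 throughout.\<close>

definition isomorphic_mat :: "'a mat \<Rightarrow> 'a mat \<Rightarrow> bool" where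
  "isomorphic_mat A B \<longleftrightarrow> dim_row A = dim_row B \<and> dim_col A = dim_col B \<and>
     (\<exists>p q. p permutes {..<dim_row B} \<and> q permutes {..<dim_col B} \<and>
        A = mat (dim_row B) (dim_col B) (\<lambda>(i, j). B $$ (p i, q j)))"

definition one_product :: "'a mat \<Rightarrow> 'a mat \<Rightarrow> 'a mat" where
  "one_product A B = mat (dim_row A + dim_row B) (dim_col A * dim_col B)
     (\<lambda>(i, c). if i < dim_row A then A $$ (i, c div dim_col B)
               else B $$ (i - dim_row A, c mod dim_col B))"

text \<open>The vectors $\mathbf 0, e_1, \dots, e_{k-1}$, indexed by $j = 0, \dots, k-1$; as
  \<^const>\<open>unit_vec\<close> counts from 0, $e_j$ has index $j - 1$.\<close>

definition marker :: "nat \<Rightarrow> nat \<Rightarrow> 'a::zero_neq_one vec" where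
  "marker k j = (if j = 0 then 0\<^sub>v (k - 1) else unit_vec (k - 1) (j - 1))"

text \<open>A tuple of rows is a list of row indices. The set equation says both that every column of
  the restriction is one of the \<open>k\<close> vectors and that each of them occurs; in particular the
  entries of \<open>xs\<close> are distinct.\<close>

definition special_rows :: "nat \<Rightarrow> 'a::zero_neq_one mat \<Rightarrow> nat list \<Rightarrow> bool" where
  "special_rows k T xs \<longleftrightarrow> length xs = k - 1 \<and> set xs \<subseteq> {..<dim_row T} \<and>
     (\<lambda>c. vec (k - 1) (\<lambda>i. T $$ (xs ! i, c))) ` {..<dim_col T} = marker k ` {..<k}"

text \<open>\<open>slice T xs j\<close> is the matrix $T[j]$.\<close>

definition slice :: "'a::zero_neq_one mat \<Rightarrow> nat list \<Rightarrow> nat \<Rightarrow> 'a mat" where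
  "slice T xs j = submatrix T (- set xs)
     {c. if j = 0 then \<forall>x\<in>set xs. T $$ (x, c) = 0 else T $$ (xs ! (j - 1), c) = 1}"

definition k_product ::
  "nat \<Rightarrow> 'a::zero_neq_one mat \<Rightarrow> nat list \<Rightarrow> 'a mat \<Rightarrow> nat list \<Rightarrow> 'a mat" where
  "k_product k A xs B ys =
     mat_of_cols (dim_row (slice A xs 0) + dim_row (slice B ys 0) + (k - 1))
       (concat (map (\<lambda>j. map (\<lambda>v. v @\<^sub>v marker k j)
                            (cols (one_product (slice A xs j) (slice B ys j))))
                    [0..<k]))"

text \<open>\<open>A\<close>, \<open>xs\<close>, \<open>B\<close>, \<open>ys\<close> witness that \<open>S\<close> is a \<open>k\<close>-product. For \<open>k = 1\<close> there are no special
  rows.\<close>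

definition k_factorisation ::
  "nat \<Rightarrow> 'a::zero_neq_one mat \<Rightarrow> 'a mat \<Rightarrow> nat list \<Rightarrow> 'a mat \<Rightarrow> nat list \<Rightarrow> bool" where
  "k_factorisation k S A xs B ys \<longleftrightarrow>
     (if k = 1 then
        xs = [] \<and> ys = [] \<and>
        0 < dim_row A \<and> 0 < dim_col A \<and> 0 < dim_row B \<and> 0 < dim_col B \<and>
        isomorphic_mat S (one_product A B)
      else
        special_rows k A xs \<and> special_rows k B ys \<and>
        dim_row A < dim_row S \<and> dim_col A < dim_col S \<and>
        dim_row B < dim_row S \<and> dim_col B < dim_col S \<and>
        isomorphic_mat S (k_product k A xs B ys))"

definition is_k_product :: "nat \<Rightarrow> 'a::zero_neq_one mat \<Rightarrow> bool" where
  "is_k_product k S \<longleftrightarrow> (\<exists>A xs B ys. k_factorisation k S A xs B ys)"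


section \<open>Algorithms on real matrices and their running time\<close>

text \<open>
  Algorithms are while programs for a random access machine that keeps integer data and real data
  apart. A state consists of natural number variables, two-dimensional arrays of natural numbers
  (for index computations) and two-dimensional arrays of reals, both with computed addresses.

  Every primitive command and every evaluation of a guard takes one time step. Expressions in a
  fixed program have constant size, so counting their operations as well would only change the
  running time by a constant factor. The number of time steps is polynomially related to time on
  other models because
  \<^item> naturals can only be added and subtracted (with cut-off at 0). Unit-cost
    multiplication is deliberately absent: it would produce numbers of exponential length in
    linear time, whereas here the length of all numbers stays linear in the number of steps;
  \<^item> reals can only be moved and compared, and the constants 0 and 1 are available. No
    arithmetic is performed on reals, so a program is a real RAM program of a restricted kind, and
    the same program runs on any encoding of the entries for which comparison is possible.
\<close>

datatype nexp =
    NConst nat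
  | NVar string
  | NArr string nexp nexp
  | NAdd nexp nexp
  | NSub nexp nexp

datatype rexp =
    RZero
  | ROne
  | RArr string nexp nexp

datatype bexp =
    NLess nexp nexp
  | RLess rexp rexp
  | REq rexp rexp
  | BNot bexp
  | BAnd bexp bexp

datatype com =
    Skip
  | AssignNVar string nexp
  | AssignNArr string nexp nexp nexp
  | AssignRArr string nexp nexp rexp
  | Seq com com
  | Cond bexp com com
  | While bexp com

record state =
  nvar :: "string \<Rightarrow> nat"
  narr :: "string \<Rightarrow> nat \<Rightarrow> nat \<Rightarrow> nat"
  rarr :: "string \<Rightarrow> nat \<Rightarrow> nat \<Rightarrow> real"

fun nval :: "nexp \<Rightarrow> state \<Rightarrow> nat" where
  "nval (NConst n) s = n"
| "nval (NVar x) s = nvar s x"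
| "nval (NArr a e f) s = narr s a (nval e s) (nval f s)"
| "nval (NAdd e f) s = nval e s + nval f s"
| "nval (NSub e f) s = nval e s - nval f s"

fun rval :: "rexp \<Rightarrow> state \<Rightarrow> real" where
  "rval RZero s = 0"
| "rval ROne s = 1"
| "rval (RArr a e f) s = rarr s a (nval e s) (nval f s)"

fun bval :: "bexp \<Rightarrow> state \<Rightarrow> bool" where
  "bval (NLess e f) s \<longleftrightarrow> nval e s < nval f s"
| "bval (RLess e f) s \<longleftrightarrow> rval e s < rval f s"
| "bval (REq e f) s \<longleftrightarrow> rval e s = rval f s"
| "bval (BNot b) s \<longleftrightarrow> \<not> bval b s"
| "bval (BAnd b c) s \<longleftrightarrow> bval b s \<and> bval c s"

definition upd2 ::
  "(string \<Rightarrow> nat \<Rightarrow> nat \<Rightarrow> 'a) \<Rightarrow> string \<Rightarrow> nat \<Rightarrow> nat \<Rightarrow> 'a \<Rightarrow> string \<Rightarrow> nat \<Rightarrow> nat \<Rightarrow> 'a" where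
  "upd2 M a i j v = M(a := (M a)(i := (M a i)(j := v)))"

text \<open>\<open>exec c s t s'\<close>: started in state \<open>s\<close>, the program \<open>c\<close> terminates in state \<open>s'\<close> after
  exactly \<open>t\<close> steps.\<close>

inductive exec :: "com \<Rightarrow> state \<Rightarrow> nat \<Rightarrow> state \<Rightarrow> bool" where
  Skip: "exec Skip s 1 s"
| AssignNVar: "exec (AssignNVar x e) s 1 (s\<lparr>nvar := (nvar s)(x := nval e s)\<rparr>)"
| AssignNArr: "exec (AssignNArr a e f g) s 1
    (s\<lparr>narr := upd2 (narr s) a (nval e s) (nval f s) (nval g s)\<rparr>)"
| AssignRArr: "exec (AssignRArr a e f g) s 1
    (s\<lparr>rarr := upd2 (rarr s) a (nval e s) (nval f s) (rval g s)\<rparr>)"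
| Seq: "exec c s t s' \<Longrightarrow> exec d s' u s'' \<Longrightarrow> exec (Seq c d) s (t + u) s''"
| CondTrue: "bval b s \<Longrightarrow> exec c s t s' \<Longrightarrow> exec (Cond b c d) s (Suc t) s'"
| CondFalse: "\<not> bval b s \<Longrightarrow> exec d s t s' \<Longrightarrow> exec (Cond b c d) s (Suc t) s'"
| WhileFalse: "\<not> bval b s \<Longrightarrow> exec (While b c) s 1 s"
| WhileTrue: "bval b s \<Longrightarrow> exec c s t s' \<Longrightarrow> exec (While b c) s' u s'' \<Longrightarrow>
    exec (While b c) s (Suc (t + u)) s''"

inductive_cases exec_SkipE: "exec Skip s t s'"
  and exec_AssignNVarE: "exec (AssignNVar x e) s t s'"
  and exec_AssignNArrE: "exec (AssignNArr a e f g) s t s'"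
  and exec_AssignRArrE: "exec (AssignRArr a e f g) s t s'"
  and exec_SeqE: "exec (Seq c d) s t s'"
  and exec_CondE: "exec (Cond b c d) s t s'"
  and exec_WhileE: "exec (While b c) s t s'"

lemma exec_deterministic:
  "exec c s t s' \<Longrightarrow> exec c s u s'' \<Longrightarrow> t = u \<and> s' = s''"
proof (induction arbitrary: u s'' rule: exec.induct)
  case (Skip s)
  then show ?case by (rule exec_SkipE) simp
next
  case (AssignNVar x e s)
  then show ?case by (rule exec_AssignNVarE) simp
next
  case (AssignNArr a e f g s)
  then show ?case by (rule exec_AssignNArrE) simp
next
  case (AssignRArr a e f g s)
  then show ?case by (rule exec_AssignRArrE) simp
next
  case (Seq c s t s' d v w)
  from Seq.prems obtain t1 t2 s1 where "exec c s t1 s1" "exec d s1 t2 s''" "u = t1 + t2"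
    by (rule exec_SeqE)
  with Seq.IH(1)[of t1 s1] Seq.IH(2)[of t2 s''] show ?case by simp
next
  case (CondTrue b s c t s' d)
  from CondTrue.prems obtain t1 where "exec c s t1 s''" "u = Suc t1"
    by (rule exec_CondE) (use CondTrue.hyps(1) in blast)+
  with CondTrue.IH[of t1 s''] show ?case by simp
next
  case (CondFalse b s d t s' c)
  from CondFalse.prems obtain t1 where "exec d s t1 s''" "u = Suc t1"
    by (rule exec_CondE) (use CondFalse.hyps(1) in blast)+
  with CondFalse.IH[of t1 s''] show ?case by simp
next
  case (WhileFalse b s c)
  from WhileFalse.prems show ?case
    by (rule exec_WhileE) (use WhileFalse.hyps in auto)
next
  case (WhileTrue b s c t s' v w)
  from WhileTrue.prems obtain t1 t2 s1
    where "exec c s t1 s1" "exec (While b c) s1 t2 s''" "u = Suc (t1 + t2)"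
    by (rule exec_WhileE) (use WhileTrue.hyps(1) in blast)+
  with WhileTrue.IH(1)[of t1 s1] WhileTrue.IH(2)[of t2 s''] show ?case by simp
qed

text \<open>The input matrix is in the real array \<open>S\<close>, its dimensions are in \<open>m\<close> and \<open>n\<close>; all other
  memory is 0.\<close>

definition input_state :: "real mat \<Rightarrow> state" where
  "input_state S =
    \<lparr>nvar = (\<lambda>_. 0)(''m'' := dim_row S, ''n'' := dim_col S),
     narr = (\<lambda>_ _ _. 0),
     rarr = (\<lambda>_ _ _. 0)(''S'' := \<lambda>i j. if i < dim_row S \<and> j < dim_col S then S $$ (i, j) else 0)\<rparr>"

definition read_mat :: "state \<Rightarrow> string \<Rightarrow> string \<Rightarrow> string \<Rightarrow> real mat" where
  "read_mat s r c a = mat (nvar s r) (nvar s c) (\<lambda>(i, j). rarr s a i j)"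

definition read_list :: "state \<Rightarrow> nat \<Rightarrow> string \<Rightarrow> nat list" where
  "read_list s l a = map (\<lambda>i. narr s a i 0) [0..<l]"

end

theory Submission
  imports Defs
begin

text \<open>Fix the special rows Z of S and call a class of columns that agree on Z a slice. Let the
  other rows be split into nonempty sets A and B. Apart from the bound on the numbers of columns, S
  is a product with the rows A in the first factor and B in the second exactly when two things hold
  in every slice. First, patterns on A and patterns on B are independent: the number of columns
  showing both patterns, times the size of the slice, is the product of the numbers of columns
  showing either one. Second, multiplicities can be divided: the size of the slice is v1 * v2, where
  v2 divides the number of columns of each pattern on A and v1 the number of columns of each pattern
  on B. The first factor then takes one in v2 of the columns with a given pattern on A, and the
  second one in v1 of those with a given pattern on B.

  The special rows, the numbers v1 and v2 of the k slices and one row r of A are 3k numbers of size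
  at most m + n, so for fixed k all choices can be tried. A itself has exponentially many candidates
  and is found by a test on pairs of rows, \<open>indep_rows\<close>, which compares two counts of
  pairs of columns. It expresses that the generating polynomial of a slice behaves like a product as
  far as the rows x and y are concerned. In a product every x in A and y in B pass, because
  exchanging the B-parts of two columns of a slice is a bijection (\<open>factored_indep\<close>).
  Conversely, if all pairs across A and B pass, then patterns on A and on B are independent
  (\<open>indep_rows_card\<close>, from \<open>indep_rows_exchange\<close> and
  \<open>separate_set_function\<close>). Hence the set \<open>row_block\<close> of rows reached from
  r through dependent pairs lies inside A and is independent of its complement, so it can take the
  place of A.

  The numbers v1 and v2 have to fit this block, and for k >= 2 each must exceed 1 in some slice,
  since both factors need fewer columns than S. \<open>factored_weights\<close> achieves this by a
  good choice of r: if the rows of one factor are constant on all slices, r is any of them and the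
  slice sizes of the given factors fit; otherwise r is a non-constant row and v2 is a greatest
  common divisor (\<open>gcd_weights\<close>).

  A guess is accepted by \<open>guess_ok\<close> if the counting identities collected in
  \<open>splits\<close> hold for the columns kept. These give a bijection between the columns of S
  and those of the product (\<open>splits_imp_k_factorisation\<close>); that every product has an
  accepted guess is \<open>k_factorisation_imp_guess_ok\<close>.

  For the running time, the test is written with bounded sums and counting loops, for which a
  compiler is proved correct together with a time polynomial read off the syntax
  (\<open>tcomp_correct\<close>, \<open>hcomp_correct\<close>). \<open>cNest\<close> wraps the test
  in 3k nested loops.\<close>

section \<open>Products up to isomorphism: labels for rows and columns\<close>

lemma bij_betw_pick:
  "bij_betw (pick I) {..<card {i. i < N \<and> i \<in> I}} {i. i < N \<and> i \<in> I}"
proof -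
  let ?J = "{i. i < N \<and> i \<in> I}"
  have inj: "inj_on (pick I) {..<card ?J}"
  proof (rule inj_onI)
    fix a b assume a: "a \<in> {..<card ?J}" and b: "b \<in> {..<card ?J}" and eq: "pick I a = pick I b"
    have fin: "infinite I \<or> card ?J \<le> card I"
      by (cases "finite I") (auto intro!: card_mono)
    have mono: "pick I x < pick I y" if "x < y" "y < card ?J" for x y
      using that fin pick_mono[of y I x] by auto
    show "a = b"
      using mono[of a b] mono[of b a] a b eq by (cases a b rule: linorder_cases) auto
  qed
  have "pick I ` {..<card ?J} \<subseteq> ?J"
  proof
    fix x assume "x \<in> pick I ` {..<card ?J}"
    then obtain a where a: "a < card ?J" "x = pick I a" by auto
    have "infinite I \<or> a < card I"
      using a(1) card_mono[of I ?J] by (cases "finite I") (auto intro: less_le_trans)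
    then have "pick I a \<in> I" using pick_in_set by blast
    moreover have "pick I a < N" using a(1) by (rule pick_le)
    ultimately show "x \<in> ?J" using a by simp
  qed
  moreover have "card (pick I ` {..<card ?J}) = card ?J" using inj by (simp add: card_image)
  ultimately have "pick I ` {..<card ?J} = ?J" by (simp add: card_subset_eq)
  with inj show ?thesis by (simp add: bij_betw_def)
qed

lemma map_upt_mult:
  "map f [0..<a * b] = concat (map (\<lambda>i. map (\<lambda>j. f (i * b + j)) [0..<b]) [0..<a])"
proof (induction a)
  case (Suc a)
  have "map f [0..<Suc a * b] = map f ([0..<a * b] @ [a * b..<a * b + b])"
    using upt_add_eq_append[of 0 "a * b" b] by (simp add: add.commute)
  moreover have "map f [a * b..<a * b + b] = map (\<lambda>j. f (a * b + j)) [0..<b]"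
    by (intro nth_equalityI) auto
  ultimately show ?case using Suc by simp
qed simp

lemma cols_one_product:
  "cols (one_product A B) =
     concat (map (\<lambda>a. map (\<lambda>b. col A a @\<^sub>v col B b) [0..<dim_col B]) [0..<dim_col A])"
proof -
  have "col (one_product A B) (a * dim_col B + b) = col A a @\<^sub>v col B b"
    if "a < dim_col A" "b < dim_col B" for a b
  proof -
    have "a * dim_col B + b < dim_col A * dim_col B"
      using that mult_le_mono1[of "Suc a" "dim_col A" "dim_col B"] by simp
    with that show ?thesis by (intro eq_vecI) (auto simp: one_product_def)
  qed
  moreover have "dim_col (one_product A B) = dim_col A * dim_col B" by (simp add: one_product_def)
  ultimately show ?thesis
    unfolding cols_def by (auto simp: map_upt_mult intro!: arg_cong[where f = concat])
qed

lemma marker_eq_iff: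
  fixes v :: "nat \<Rightarrow> 'a::zero_neq_one"
  assumes "j < k"
  shows "vec (k - 1) v = marker k j \<longleftrightarrow> (\<forall>t<k - 1. v t = (if Suc t = j then 1 else 0))"
proof -
  have "marker k j = vec (k - 1) (\<lambda>t. if Suc t = j then 1 else (0::'a))"
    using assms by (auto simp: marker_def unit_vec_def intro!: eq_vecI)
  then show ?thesis by (auto simp: vec_eq_iff)
qed

text \<open>The entrywise form of being \<open>marker k j\<close>, for entries given by a function,
  so that restricted columns need not be built as vectors.\<close>

definition marked :: "nat \<Rightarrow> (nat \<Rightarrow> 'a::zero_neq_one) \<Rightarrow> nat \<Rightarrow> bool" where
  "marked k v j \<longleftrightarrow> (\<forall>t<k - 1. v t = (if Suc t = j then 1 else 0))"

lemma marked_unique: "marked k v i \<Longrightarrow> marked k v j \<Longrightarrow> i < k \<Longrightarrow> j < k \<Longrightarrow> i = j"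
proof (rule ccontr)
  have *: False if "marked k v i" "marked k v j" "i < j" "j < k" for i j
  proof -
    from that(3,4) obtain t where t: "j = Suc t" "t < k - 1" by (cases j) auto
    with that have "v t = 1" "v t = 0" by (auto simp: marked_def)
    then show False by simp
  qed
  assume "marked k v i" "marked k v j" "i < k" "j < k" "i \<noteq> j"
  with * show False by (meson linorder_neqE_nat)
qed

lemma marked_cong: "(\<And>t. t < k - 1 \<Longrightarrow> v t = w t) \<Longrightarrow> marked k v j = marked k w j"
  unfolding marked_def by auto

lemma special_rows_iff:
  "special_rows k T xs \<longleftrightarrow> length xs = k - 1 \<and> set xs \<subseteq> {..<dim_row T} \<and>
     (\<forall>c<dim_col T. \<exists>j<k. marked k (\<lambda>t. T $$ (xs ! t, c)) j) \<and>
     (\<forall>j<k. \<exists>c<dim_col T. marked k (\<lambda>t. T $$ (xs ! t, c)) j)"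
proof -
  let ?v = "\<lambda>c. vec (k - 1) (\<lambda>t. T $$ (xs ! t, c))"
  have *: "?v c = marker k j \<longleftrightarrow> marked k (\<lambda>t. T $$ (xs ! t, c)) j" if "j < k" for c j
    unfolding marked_def using that by (rule marker_eq_iff)
  have "?v ` {..<dim_col T} \<subseteq> marker k ` {..<k} \<longleftrightarrow>
      (\<forall>c<dim_col T. \<exists>j<k. ?v c = marker k j)"
    by (simp add: image_subset_iff image_iff Bex_def Ball_def)
  moreover have "marker k ` {..<k} \<subseteq> ?v ` {..<dim_col T} \<longleftrightarrow>
      (\<forall>j<k. \<exists>c<dim_col T. ?v c = marker k j)"
    by (simp add: image_subset_iff image_iff Bex_def Ball_def eq_commute)
  ultimately have "?v ` {..<dim_col T} = marker k ` {..<k} \<longleftrightarrow>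
      (\<forall>c<dim_col T. \<exists>j<k. ?v c = marker k j) \<and> (\<forall>j<k. \<exists>c<dim_col T. ?v c = marker k j)"
    unfolding set_eq_subset by (rule arg_cong2)
  also have "\<dots> \<longleftrightarrow> (\<forall>c<dim_col T. \<exists>j<k. marked k (\<lambda>t. T $$ (xs ! t, c)) j) \<and>
     (\<forall>j<k. \<exists>c<dim_col T. marked k (\<lambda>t. T $$ (xs ! t, c)) j)"
    by (intro conj_cong all_cong1 imp_cong ex_cong1 refl * | assumption)+
  finally show ?thesis unfolding special_rows_def by simp
qed

abbreviation slice_cols where
  "slice_cols T xs j \<equiv> {c. if j = 0 then \<forall>x\<in>set xs. T $$ (x, c) = 0 else T $$ (xs ! (j - 1), c) = 1}"

text \<open>A slice is defined by one entry, or by zeros in all special rows. As every column of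
  \<open>T\<close> carries some marker, one entry equal to 1 already fixes the whole marker.\<close>

lemma slice_cols_iff:
  assumes "special_rows k T xs" "c < dim_col T" "j < k"
  shows "c \<in> slice_cols T xs j \<longleftrightarrow> marked k (\<lambda>t. T $$ (xs ! t, c)) j"
proof -
  obtain i where i: "i < k" "marked k (\<lambda>t. T $$ (xs ! t, c)) i"
    using assms unfolding special_rows_iff by blast
  have len: "length xs = k - 1" using assms unfolding special_rows_iff by blast
  show ?thesis
  proof (cases j)
    case 0
    then show ?thesis using len by (fastforce simp: marked_def in_set_conv_nth)
  next
    case (Suc t)
    then have t: "t < k - 1" using assms(3) by simp
    show ?thesis
    proof
      assume "c \<in> slice_cols T xs j"
      then have "T $$ (xs ! t, c) = 1" using Suc by simp
      then have "i = j" using i t Suc by (auto simp: marked_def split: if_splits)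
      then show "marked k (\<lambda>t. T $$ (xs ! t, c)) j" using i by simp
    next
      assume "marked k (\<lambda>t. T $$ (xs ! t, c)) j"
      then show "c \<in> slice_cols T xs j" using Suc t by (simp add: marked_def)
    qed
  qed
qed

text \<open>Labels for the rows and columns of a \<open>k\<close>-product that do not depend on the order in which
  the product lists them.\<close>

definition row_labels :: "nat \<Rightarrow> 'a mat \<Rightarrow> nat list \<Rightarrow> 'a mat \<Rightarrow> nat list \<Rightarrow> (nat + nat + nat) set" where
  "row_labels k A xs B ys =
     ({..<dim_row A} - set xs) <+> ({..<dim_row B} - set ys) <+> {..<k - 1}"

definition col_labels :: "nat \<Rightarrow> 'a mat \<Rightarrow> nat list \<Rightarrow> 'a mat \<Rightarrow> nat list \<Rightarrow> (nat \<times> nat) set" where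
  "col_labels k A xs B ys = {(a, b). a < dim_col A \<and> b < dim_col B \<and>
     (\<forall>t<k - 1. A $$ (xs ! t, a) = B $$ (ys ! t, b))}"

fun label_entry :: "'a mat \<Rightarrow> nat list \<Rightarrow> 'a mat \<Rightarrow> nat + nat + nat \<Rightarrow> nat \<times> nat \<Rightarrow> 'a" where
  "label_entry A xs B (Inl i) (a, b) = A $$ (i, a)"
| "label_entry A xs B (Inr (Inl i)) (a, b) = B $$ (i, b)"
| "label_entry A xs B (Inr (Inr t)) (a, b) = A $$ (xs ! t, a)"

lemma distinct_concat_map_Pair:
  "distinct xs \<Longrightarrow> (\<And>x. x \<in> set xs \<Longrightarrow> distinct (f x)) \<Longrightarrow>
     distinct (concat (map (\<lambda>x. map (Pair x) (f x)) xs))"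
  by (induction xs) (auto simp: distinct_map inj_on_def)

text \<open>A column of the product arises from a slice index j and a column of each factor in slice
  j. Since the marker of a column determines j, such triples amount to pairs of columns that agree
  on the special rows, which is \<open>col_labels\<close>.\<close>

lemma k_product_labels:
  fixes A B :: "'a::zero_neq_one mat"
  assumes A: "special_rows k A xs" and B: "special_rows k B ys" and "k \<ge> 1"
  defines "P \<equiv> k_product k A xs B ys"
  obtains \<rho> \<gamma> where "bij_betw \<rho> {..<dim_row P} (row_labels k A xs B ys)"
    "bij_betw \<gamma> {..<dim_col P} (col_labels k A xs B ys)"
    "\<And>i c. i < dim_row P \<Longrightarrow> c < dim_col P \<Longrightarrow> P $$ (i, c) = label_entry A xs B (\<rho> i) (\<gamma> c)"
proof -
  define RA RB where "RA = {i. i < dim_row A \<and> i \<in> - set xs}" and "RB = {i. i < dim_row B \<and> i \<in> - set ys}"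
  define CA CB where "CA j = {c. c < dim_col A \<and> c \<in> slice_cols A xs j}"
    and "CB j = {c. c < dim_col B \<and> c \<in> slice_cols B ys j}" for j
  let ?rA = "card RA" and ?rB = "card RB"
  define pA pB where "pA j = pick (slice_cols A xs j)" and "pB j = pick (slice_cols B ys j)" for j
  define qA qB where "qA = pick (- set xs)" and "qB = pick (- set ys)"
  have dims: "dim_row (slice A xs j) = ?rA" "dim_row (slice B ys j) = ?rB"
    "dim_col (slice A xs j) = card (CA j)" "dim_col (slice B ys j) = card (CB j)" for j
    by (simp_all add: slice_def dim_submatrix RA_def RB_def CA_def CB_def)
  have entA: "slice A xs j $$ (i, a) = A $$ (qA i, pA j a)"
    if "i < ?rA" "a < card (CA j)" for i a j
    using that by (simp add: slice_def submatrix_index RA_def CA_def pA_def qA_def)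
  have entB: "slice B ys j $$ (i, b) = B $$ (qB i, pB j b)"
    if "i < ?rB" "b < card (CB j)" for i b j
    using that by (simp add: slice_def submatrix_index RB_def CB_def pB_def qB_def)
  have bRA: "bij_betw (qA) {..<?rA} RA" and bRB: "bij_betw (qB) {..<?rB} RB"
    unfolding RA_def RB_def qA_def qB_def by (rule bij_betw_pick)+
  have bCA: "bij_betw (pA j) {..<card (CA j)} (CA j)" and bCB: "bij_betw (pB j) {..<card (CB j)} (CB j)" for j
    unfolding CA_def CB_def pA_def pB_def by (rule bij_betw_pick)+
  have memC: "a < card (CA j) \<Longrightarrow> pA j a \<in> CA j" "b < card (CB j) \<Longrightarrow> pB j b \<in> CB j" for a b j
    using bCA[of j] bCB[of j] by (auto dest: bij_betwE)
  have CA: "c \<in> CA j \<longleftrightarrow> c < dim_col A \<and> marked k (\<lambda>t. A $$ (xs ! t, c)) j" if "j < k" for c j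
    using slice_cols_iff[OF A _ that] unfolding CA_def by blast
  have CB: "c \<in> CB j \<longleftrightarrow> c < dim_col B \<and> marked k (\<lambda>t. B $$ (ys ! t, c)) j" if "j < k" for c j
    using slice_cols_iff[OF B _ that] unfolding CB_def by blast
  \<comment> \<open>\<open>L\<close> lists the triples (j, a, b) in the order in which
    \<open>k_product\<close> lists its columns; a and b are positions inside the slices, which
    \<open>pA\<close> and \<open>pB\<close> turn into column indices of the factors.\<close>
  define L where "L = concat (map (\<lambda>j. map (Pair j)
    (concat (map (\<lambda>a. map (Pair a) [0..<card (CB j)]) [0..<card (CA j)]))) [0..<k])"
  define colv where "colv = (\<lambda>(j, a, b). (col (slice A xs j) a @\<^sub>v col (slice B ys j) b) @\<^sub>v (marker k j :: 'a vec))"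
  have setL: "set L = {(j, a, b). j < k \<and> a < card (CA j) \<and> b < card (CB j)}"
    unfolding L_def by (auto simp: image_iff)
  have distL: "distinct L"
    unfolding L_def by (intro distinct_concat_map_Pair) auto
  have "P = mat_of_cols (?rA + ?rB + (k - 1)) (map colv L)"
    unfolding P_def k_product_def cols_one_product dims L_def colv_def
    by (simp add: map_concat comp_def)
  then have dimP: "dim_row P = ?rA + ?rB + (k - 1)" "dim_col P = length L"
    and entP: "\<And>i c. i < dim_row P \<Longrightarrow> c < dim_col P \<Longrightarrow> P $$ (i, c) = colv (L ! c) $ i"
    by (simp_all add: mat_of_cols_index)
  define \<gamma> where "\<gamma> = (\<lambda>(j, a, b). (pA j a, pB j b)) \<circ> (!) L"
  define \<rho> where "\<rho> i = (if i < ?rA then Inl (qA i)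
     else if i < ?rA + ?rB then Inr (Inl (qB (i - ?rA)))
     else Inr (Inr (i - ?rA - ?rB)))" for i
  have "bij_betw ((!) L) {..<dim_col P} (set L)"
    by (rule bij_betw_nth[OF distL]) (auto simp: dimP)
  moreover have "bij_betw (\<lambda>(j, a, b). (pA j a, pB j b)) (set L) (col_labels k A xs B ys)"
  proof (rule bij_betwI')
    fix x y assume xy: "x \<in> set L" "y \<in> set L"
    obtain j a b j' a' b' where [simp]: "x = (j, a, b)" "y = (j', a', b')" by (cases x, cases y) blast
    have l: "j < k" "a < card (CA j)" "b < card (CB j)" "j' < k" "a' < card (CA j')" "b' < card (CB j')"
      using xy by (auto simp: setL)
    show "((case x of (j, a, b) \<Rightarrow> (pA j a, pB j b)) = (case y of (j, a, b) \<Rightarrow> (pA j a, pB j b))) = (x = y)"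
    proof
      assume "(case x of (j, a, b) \<Rightarrow> (pA j a, pB j b)) = (case y of (j, a, b) \<Rightarrow> (pA j a, pB j b))"
      then have eq: "pA j a = pA j' a'" "pB j b = pB j' b'" by auto
      \<comment> \<open>The slice index is recovered from the column of the first factor, as no
        column carries two markers.\<close>
      have "pA j a \<in> CA j" "pA j' a' \<in> CA j'" using memC l by blast+
      then have "j = j'" using marked_unique[of k _ j j'] eq(1) CA l by metis
      then have "a = a'" "b = b'"
        using eq l bij_betw_imp_inj_on[OF bCA[of j]] bij_betw_imp_inj_on[OF bCB[of j]]
        by (auto dest: inj_onD)
      with \<open>j = j'\<close> show "x = y" by simp
    qed simp
  next
    fix x assume "x \<in> set L"
    obtain j a b where [simp]: "x = (j, a, b)" by (cases x) blast
    have l: "j < k" "a < card (CA j)" "b < card (CB j)"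
      using \<open>x \<in> set L\<close> by (auto simp: setL)
    have "pA j a \<in> CA j" "pB j b \<in> CB j" using memC l by blast+
    then show "(case x of (j, a, b) \<Rightarrow> (pA j a, pB j b)) \<in> col_labels k A xs B ys"
      using CA CB l(1) by (auto simp: col_labels_def marked_def)
  next
    fix y assume y: "y \<in> col_labels k A xs B ys"
    obtain c d where [simp]: "y = (c, d)" by (cases y)
    have cd: "c < dim_col A" "d < dim_col B" "\<And>t. t < k - 1 \<Longrightarrow> A $$ (xs ! t, c) = B $$ (ys ! t, d)"
      using y by (auto simp: col_labels_def)
    obtain j where j: "j < k" "marked k (\<lambda>t. A $$ (xs ! t, c)) j"
      using A cd(1) by (auto simp: special_rows_iff)
    then have "c \<in> CA j" using CA cd by simp
    moreover have "d \<in> CB j" using j cd CB by (auto simp: marked_def)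
    ultimately obtain a b where "a < card (CA j)" "pA j a = c" "b < card (CB j)" "pB j b = d"
      using bCA[of j] bCB[of j] unfolding bij_betw_def by (metis imageE lessThan_iff)
    then show "\<exists>x\<in>set L. y = (case x of (j, a, b) \<Rightarrow> (pA j a, pB j b))"
      using j by (intro bexI[of _ "(j, a, b)"]) (auto simp: setL)
  qed
  ultimately have g: "bij_betw \<gamma> {..<dim_col P} (col_labels k A xs B ys)"
    unfolding \<gamma>_def by (rule bij_betw_trans)
  have "bij_betw \<rho> {..<dim_row P} (RA <+> RB <+> {..<k - 1})"
  proof (rule bij_betwI')
    fix x y assume "x \<in> {..<dim_row P}" "y \<in> {..<dim_row P}"
    then show "(\<rho> x = \<rho> y) = (x = y)"
      using inj_onD[OF bij_betw_imp_inj_on[OF bRA], of x y]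
        inj_onD[OF bij_betw_imp_inj_on[OF bRB], of "x - ?rA" "y - ?rA"]
      by (auto simp: \<rho>_def dimP split: if_splits; arith)
  next
    fix x assume x: "x \<in> {..<dim_row P}"
    have "x < ?rA \<Longrightarrow> qA x \<in> RA" using bRA by (auto simp: bij_betw_def)
    moreover have "\<not> x < ?rA \<Longrightarrow> x < ?rA + ?rB \<Longrightarrow> qB (x - ?rA) \<in> RB"
      using bRB by (auto simp: bij_betw_def)
    ultimately show "\<rho> x \<in> RA <+> RB <+> {..<k - 1}" using x by (auto simp: \<rho>_def dimP)
  next
    fix y assume "y \<in> RA <+> RB <+> {..<k - 1}"
    then consider i where "i \<in> RA" "y = Inl i" | i where "i \<in> RB" "y = Inr (Inl i)"
      | i where "i < k - 1" "y = Inr (Inr i)" by auto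
    then show "\<exists>x\<in>{..<dim_row P}. y = \<rho> x"
    proof cases
      case 1
      then obtain x where "x < ?rA" "qA x = i"
        using bRA unfolding bij_betw_def by (metis imageE lessThan_iff)
      then show ?thesis using 1 by (intro bexI[of _ x]) (auto simp: \<rho>_def dimP)
    next
      case 2
      then obtain x where "x < ?rB" "qB x = i"
        using bRB unfolding bij_betw_def by (metis imageE lessThan_iff)
      then show ?thesis using 2 by (intro bexI[of _ "?rA + x"]) (auto simp: \<rho>_def dimP)
    next
      case 3
      then show ?thesis by (intro bexI[of _ "?rA + ?rB + i"]) (auto simp: \<rho>_def dimP)
    qed
  qed
  moreover have "RA <+> RB <+> {..<k - 1} = row_labels k A xs B ys"
    unfolding row_labels_def RA_def RB_def by (intro arg_cong2[of _ _ _ _ "(<+>)"]) auto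
  ultimately have r: "bij_betw \<rho> {..<dim_row P} (row_labels k A xs B ys)" by simp
  show thesis
  proof (rule that[OF r g])
    fix i c assume i: "i < dim_row P" and c: "c < dim_col P"
    obtain j a b where jab: "L ! c = (j, a, b)" by (cases "L ! c")
    then have l: "j < k" "a < card (CA j)" "b < card (CB j)"
      using c nth_mem[of c L] by (auto simp: setL dimP)
    have "pA j a \<in> CA j" using memC l by blast+
    then have "marked k (\<lambda>t. A $$ (xs ! t, pA j a)) j" using CA l by simp
    moreover have "marker k j $ t = (if Suc t = j then 1 else (0::'a))" if "t < k - 1" for t
      using that l(1) by (auto simp: marker_def unit_vec_def)
    ultimately show "P $$ (i, c) = label_entry A xs B (\<rho> i) (\<gamma> c)"
      using i l entA[of i a j] entB[of "i - ?rA" b j] jab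
      by (auto simp: entP[OF i c] colv_def dims \<rho>_def \<gamma>_def dimP marked_def marker_def)
  qed
qed

text \<open>With bijections between index ranges in place of permutations, isomorphisms can be
  composed with labellings.\<close>

lemma isomorphic_mat_iff:
  "isomorphic_mat A B \<longleftrightarrow> (\<exists>p q. bij_betw p {..<dim_row A} {..<dim_row B} \<and>
     bij_betw q {..<dim_col A} {..<dim_col B} \<and>
     (\<forall>i<dim_row A. \<forall>j<dim_col A. A $$ (i, j) = B $$ (p i, q j)))"
proof
  assume "isomorphic_mat A B"
  then obtain p q where pq: "dim_row A = dim_row B" "dim_col A = dim_col B"
    "p permutes {..<dim_row B}" "q permutes {..<dim_col B}"
    "A = mat (dim_row B) (dim_col B) (\<lambda>(i, j). B $$ (p i, q j))"
    unfolding isomorphic_mat_def by blast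
  have "\<forall>i<dim_row A. \<forall>j<dim_col A. A $$ (i, j) = B $$ (p i, q j)"
    by (subst (3) pq(5)) (simp add: pq(1,2))
  with pq(1-4) show "\<exists>p q. bij_betw p {..<dim_row A} {..<dim_row B} \<and>
     bij_betw q {..<dim_col A} {..<dim_col B} \<and>
     (\<forall>i<dim_row A. \<forall>j<dim_col A. A $$ (i, j) = B $$ (p i, q j))"
    by (metis permutes_imp_bij)
next
  assume "\<exists>p q. bij_betw p {..<dim_row A} {..<dim_row B} \<and>
     bij_betw q {..<dim_col A} {..<dim_col B} \<and>
     (\<forall>i<dim_row A. \<forall>j<dim_col A. A $$ (i, j) = B $$ (p i, q j))"
  then obtain p q where p: "bij_betw p {..<dim_row A} {..<dim_row B}"
    and q: "bij_betw q {..<dim_col A} {..<dim_col B}"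
    and ent: "\<forall>i<dim_row A. \<forall>j<dim_col A. A $$ (i, j) = B $$ (p i, q j)" by blast
  have dims: "dim_row A = dim_row B" "dim_col A = dim_col B"
    using bij_betw_same_card[OF p] bij_betw_same_card[OF q] by simp_all
  \<comment> \<open>\<open>permutes\<close> demands the identity outside the index range.\<close>
  define p' q' where "p' i = (if i \<in> {..<dim_row B} then p i else i)"
    and "q' j = (if j \<in> {..<dim_col B} then q j else j)" for i j
  have "bij_betw p' {..<dim_row B} {..<dim_row B}" "bij_betw q' {..<dim_col B} {..<dim_col B}"
    using p q dims bij_betw_cong[of "{..<dim_row B}" p p'] bij_betw_cong[of "{..<dim_col B}" q q']
    by (simp_all add: p'_def q'_def)
  then have "p' permutes {..<dim_row B}" "q' permutes {..<dim_col B}"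
    by (auto intro!: bij_imp_permutes simp: p'_def q'_def split: if_splits)
  moreover have "A = mat (dim_row B) (dim_col B) (\<lambda>(i, j). B $$ (p' i, q' j))"
    using ent dims by (intro eq_matI) (auto simp: p'_def q'_def)
  ultimately show "isomorphic_mat A B" using dims unfolding isomorphic_mat_def by blast
qed

text \<open>An isomorphism followed by the labelling of the product labels \<open>S\<close>;
  conversely a labelling of \<open>S\<close> is followed by the inverse of that of the product. The
  order of rows and columns inside \<open>k_product\<close> can be forgotten from here on.\<close>

lemma isomorphic_k_product_iff:
  fixes S A B :: "'a::zero_neq_one mat"
  assumes "special_rows k A xs" "special_rows k B ys" "k \<ge> 1"
  shows "isomorphic_mat S (k_product k A xs B ys) \<longleftrightarrow>
     (\<exists>\<rho> \<gamma>. bij_betw \<rho> {..<dim_row S} (row_labels k A xs B ys) \<and>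
        bij_betw \<gamma> {..<dim_col S} (col_labels k A xs B ys) \<and>
        (\<forall>i<dim_row S. \<forall>c<dim_col S. S $$ (i, c) = label_entry A xs B (\<rho> i) (\<gamma> c)))"
    (is "_ \<longleftrightarrow> ?labelled")
proof -
  let ?P = "k_product k A xs B ys"
  obtain \<rho> \<gamma> where r: "bij_betw \<rho> {..<dim_row ?P} (row_labels k A xs B ys)"
    and g: "bij_betw \<gamma> {..<dim_col ?P} (col_labels k A xs B ys)"
    and ent: "\<And>i c. i < dim_row ?P \<Longrightarrow> c < dim_col ?P \<Longrightarrow> ?P $$ (i, c) = label_entry A xs B (\<rho> i) (\<gamma> c)"
    using k_product_labels[OF assms] by blast
  show ?thesis
  proof
    assume "isomorphic_mat S ?P"
    then obtain p q where pq: "bij_betw p {..<dim_row S} {..<dim_row ?P}"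
      "bij_betw q {..<dim_col S} {..<dim_col ?P}"
      "\<forall>i<dim_row S. \<forall>j<dim_col S. S $$ (i, j) = ?P $$ (p i, q j)"
      unfolding isomorphic_mat_iff by blast
    have "S $$ (i, c) = label_entry A xs B ((\<rho> \<circ> p) i) ((\<gamma> \<circ> q) c)"
      if "i < dim_row S" "c < dim_col S" for i c
      using that pq(3) ent[of "p i" "q c"] bij_betwE[OF pq(1)] bij_betwE[OF pq(2)] by auto
    then show ?labelled
      using bij_betw_trans[OF pq(1) r] bij_betw_trans[OF pq(2) g] by blast
  next
    assume ?labelled
    then obtain \<rho>' \<gamma>' where r': "bij_betw \<rho>' {..<dim_row S} (row_labels k A xs B ys)"
      and g': "bij_betw \<gamma>' {..<dim_col S} (col_labels k A xs B ys)"
      and ent': "\<forall>i<dim_row S. \<forall>c<dim_col S. S $$ (i, c) = label_entry A xs B (\<rho>' i) (\<gamma>' c)"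
      by blast
    define p where "p = inv_into {..<dim_row ?P} \<rho> \<circ> \<rho>'"
    define q where "q = inv_into {..<dim_col ?P} \<gamma> \<circ> \<gamma>'"
    have p: "bij_betw p {..<dim_row S} {..<dim_row ?P}" and q: "bij_betw q {..<dim_col S} {..<dim_col ?P}"
      unfolding p_def q_def
      using bij_betw_trans[OF r' bij_betw_inv_into[OF r]] bij_betw_trans[OF g' bij_betw_inv_into[OF g]]
      by simp_all
    have "\<rho> (p i) = \<rho>' i" if "i < dim_row S" for i
      using that bij_betw_inv_into_right[OF r] bij_betwE[OF r'] by (simp add: p_def)
    moreover have "\<gamma> (q c) = \<gamma>' c" if "c < dim_col S" for c
      using that bij_betw_inv_into_right[OF g] bij_betwE[OF g'] by (simp add: q_def)
    ultimately have "\<forall>i<dim_row S. \<forall>c<dim_col S. S $$ (i, c) = ?P $$ (p i, q c)"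
      using ent ent' bij_betwE[OF p] bij_betwE[OF q] by simp
    then show "isomorphic_mat S ?P" unfolding isomorphic_mat_iff using p q by blast
  qed
qed

text \<open>The case \<open>k = 1\<close> fits the general form: there are no special rows, the only
  slice is the whole matrix and the marker is the empty vector. Existence of a column is part of
  \<open>special_rows\<close>, and as the numbers of rows add up, a factor has a row exactly when
  the other has fewer rows than \<open>S\<close>. Only the bound on columns is specific to
  \<open>k \<ge> 2\<close>: a 1-product may have a factor with a single column.\<close>

lemma k_factorisation_iff:
  fixes S A B :: "'a::zero_neq_one mat"
  assumes "k \<ge> 1"
  shows "k_factorisation k S A xs B ys \<longleftrightarrow>
     special_rows k A xs \<and> special_rows k B ys \<and> dim_row A < dim_row S \<and> dim_row B < dim_row S \<and>
     (k \<ge> 2 \<longrightarrow> dim_col A < dim_col S \<and> dim_col B < dim_col S) \<and>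
     isomorphic_mat S (k_product k A xs B ys)"
proof (cases "k = 1")
  case True
  have sp: "special_rows 1 T zs \<longleftrightarrow> zs = [] \<and> 0 < dim_col T" for T :: "'a mat" and zs
    by (auto simp: special_rows_iff marked_def)
  have slice: "slice T [] (0::nat) = T" for T :: "'a mat"
    by (auto simp: slice_def submatrix_def pick_UNIV intro!: eq_matI)
  have "k_product 1 A [] B [] = one_product A B"
  proof -
    have "map (\<lambda>v. v @\<^sub>v marker 1 0) (cols (one_product A B)) = cols (one_product A B)"
      by (intro map_idI eq_vecI) (auto simp: marker_def)
    then have "k_product 1 A [] B [] = mat_of_cols (dim_row A + dim_row B) (cols (one_product A B))"
      by (simp add: k_product_def slice)
    moreover have "dim_row A + dim_row B = dim_row (one_product A B)" by (simp add: one_product_def)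
    ultimately show ?thesis by (simp only: mat_of_cols_cols)
  qed
  moreover have "dim_row S = dim_row A + dim_row B" if "isomorphic_mat S (one_product A B)"
    using that by (simp add: isomorphic_mat_def one_product_def)
  ultimately show ?thesis
    using True by (auto simp: k_factorisation_def sp[unfolded One_nat_def])
next
  case False
  then show ?thesis using assms by (auto simp: k_factorisation_def)
qed

section \<open>Independence of rows and factorisation of column counts\<close>

text \<open>Bijections between the fibres are glued. The result is injective because fibres are
  disjoint, and it is onto because the total cardinalities agree, so the fibres of \<open>g\<close>
  over values missed by \<open>f\<close> turn out to be empty.\<close>

lemma bij_betw_of_fibres:
  assumes fin: "finite C" "finite P" and card: "card C = card P"
    and fib: "\<And>c. c \<in> C \<Longrightarrow> card {c' \<in> C. f c' = f c} = card {p \<in> P. g p = f c}"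
  obtains h where "bij_betw h C P" "\<And>c. c \<in> C \<Longrightarrow> g (h c) = f c"
proof -
  have "\<exists>H. bij_betw H {c \<in> C. f c = v} {p \<in> P. g p = v}" if "v \<in> f ` C" for v
    using that fib fin by (auto intro!: finite_same_card_bij)
  then obtain H where H: "\<And>v. v \<in> f ` C \<Longrightarrow> bij_betw (H v) {c \<in> C. f c = v} {p \<in> P. g p = v}"
    by metis
  define h where "h c = H (f c) c" for c
  have hP: "h c \<in> P" and hg: "g (h c) = f c" if "c \<in> C" for c
    using H[of "f c"] that by (auto simp: h_def bij_betw_def)
  have "inj_on h C"
  proof (rule inj_onI)
    fix c d assume cd: "c \<in> C" "d \<in> C" "h c = h d"
    then have "f c = f d" using hg by metis
    with cd show "c = d"
      using bij_betw_imp_inj_on[OF H[of "f c"]] by (auto simp: h_def inj_on_def)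
  qed
  moreover from this have "h ` C = P"
    using hP card fin by (intro card_subset_eq) (auto simp: card_image)
  ultimately show thesis using that hg by (auto simp: bij_betw_def)
qed

definition agree :: "(nat \<Rightarrow> nat \<Rightarrow> 'a) \<Rightarrow> nat set \<Rightarrow> nat \<Rightarrow> nat \<Rightarrow> bool" where
  "agree S R c d \<longleftrightarrow> (\<forall>i\<in>R. S i c = S i d)"

lemma agree_Un: "agree S (R \<union> R') c d \<longleftrightarrow> agree S R c d \<and> agree S R' c d"
  by (auto simp: agree_def)

lemma agree_refl [simp]: "agree S R c c"
  by (simp add: agree_def)

lemma agree_sym: "agree S R c d \<Longrightarrow> agree S R d c"
  by (auto simp: agree_def)

lemma agree_trans: "agree S R c d \<Longrightarrow> agree S R d e \<Longrightarrow> agree S R c e"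
  by (auto simp: agree_def)

lemma agree_mono: "agree S R c d \<Longrightarrow> R' \<subseteq> R \<Longrightarrow> agree S R' c d"
  by (auto simp: agree_def)

text \<open>The pair of columns \<open>d\<close>, \<open>d'\<close> equals \<open>c\<close>, \<open>c'\<close> in row \<open>x\<close>, \<open>e\<close>, \<open>e'\<close> in row \<open>y\<close>, and \<open>c\<close>, \<open>c'\<close> up to
  an exchange in every other row.\<close>

definition pair_match ::
  "(nat \<Rightarrow> nat \<Rightarrow> 'a) \<Rightarrow> nat \<Rightarrow> nat \<Rightarrow> nat \<Rightarrow> nat \<Rightarrow> nat \<Rightarrow> nat \<Rightarrow> nat \<Rightarrow> nat \<Rightarrow> nat \<Rightarrow> bool" where
  "pair_match S m x y c c' e e' d d' \<longleftrightarrow>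
     S x d = S x c \<and> S x d' = S x c' \<and> S y d = S y e \<and> S y d' = S y e' \<and>
     (\<forall>i<m. i \<noteq> x \<longrightarrow> i \<noteq> y \<longrightarrow>
        S i d = S i c \<and> S i d' = S i c' \<or> S i d = S i c' \<and> S i d' = S i c)"

text \<open>Let $f$ be the polynomial with one variable $z_{i,v}$ for every row $i$ and value $v$ and one
  monomial $\prod_i z_{i,S_{ic}}$ for every column $c$ of a slice, and let $f_{ab}$ be the coefficient
  of $z_{x,a}z_{y,b}$. The condition says that $f_{ab}f_{a'b'} = f_{ab'}f_{a'b}$ for all $a, a', b, b'$,
  in every slice.\<close>

definition indep_rows :: "(nat \<Rightarrow> nat \<Rightarrow> 'a) \<Rightarrow> nat \<Rightarrow> nat \<Rightarrow> nat set \<Rightarrow> nat \<Rightarrow> nat \<Rightarrow> bool" where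
  "indep_rows S m n Z x y \<longleftrightarrow> (\<forall>c<n. \<forall>c'<n. agree S Z c c' \<longrightarrow>
     card {(d, d'). d < n \<and> d' < n \<and> pair_match S m x y c c' c c' d d'} =
     card {(d, d'). d < n \<and> d' < n \<and> pair_match S m x y c c' c' c d d'})"

text \<open>Both sides expand into sums over pairs of columns of the slice; they differ in whether
  the factor \<open>w y\<close> is taken at the first or at the second column. Independence yields a
  bijection of pairs that exchanges the entries in row y, keeps those in row x, and preserves the
  unordered pair of entries in all other rows. The product over \<open>W\<close> only sees these
  unordered pairs.\<close>

lemma indep_rows_exchange:
  fixes w :: "nat \<Rightarrow> nat \<Rightarrow> 'b::comm_semiring_1" and c0 :: nat
  assumes ind: "indep_rows S m n Z x y" and Z: "Z \<subseteq> {..<m}" and xy: "x \<notin> Z" "y \<notin> Z" "x \<noteq> y"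
    and w: "\<And>i c d. S i c = S i d \<Longrightarrow> w i c = w i d"
    and W: "W \<subseteq> {..<m}" "x \<notin> W" "y \<notin> W"
  defines "C \<equiv> {c. c < n \<and> agree S Z c0 c}"
  defines "F \<equiv> \<lambda>W. \<Sum>c\<in>C. \<Prod>i\<in>W. w i c"
  shows "F (insert x (insert y W)) * F W = F (insert x W) * F (insert y W)"
proof -
  \<comment> \<open>\<open>rest\<close> records the unordered pair of entries of each row other than
    x and y. A pair q has \<open>key' q = key p\<close> when it looks like p with the entries in row
    y exchanged.\<close>
  define rest where "rest = (\<lambda>(c, c') i. if i < m \<and> i \<noteq> x \<and> i \<noteq> y then {S i c, S i c'} else {})"
  define key where "key p = (S x (fst p), S x (snd p), S y (fst p), S y (snd p), rest p)" for p
  define key' where "key' p = (S x (fst p), S x (snd p), S y (snd p), S y (fst p), rest p)" for p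
  have finW: "finite W" using W(1) finite_subset by blast
  have fin: "finite (C \<times> C)" by (simp add: C_def)
  have rest: "rest (d, d') = rest (c, c') \<longleftrightarrow> (\<forall>i<m. i \<noteq> x \<longrightarrow> i \<noteq> y \<longrightarrow>
      S i d = S i c \<and> S i d' = S i c' \<or> S i d = S i c' \<and> S i d' = S i c)" for c c' d d'
    by (auto simp: rest_def fun_eq_iff doubleton_eq_iff)
  \<comment> \<open>Matching pairs stay in the slice: in a row of \<open>Z\<close> the columns
    \<open>c\<close> and \<open>c'\<close> have equal entries, so an exchange there changes nothing,
    and x and y lie outside \<open>Z\<close>.\<close>
  have inC: "d \<in> C \<and> d' \<in> C" if "c \<in> C" "c' \<in> C" "rest (d, d') = rest (c, c')" "d < n" "d' < n" for c c' d d'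
  proof -
    have "S i d = S i c0 \<and> S i d' = S i c0" if i: "i \<in> Z" for i
    proof -
      have "i < m" "i \<noteq> x" "i \<noteq> y" using i Z xy by auto
      with \<open>rest (d, d') = rest (c, c')\<close>
      have "S i d = S i c \<and> S i d' = S i c' \<or> S i d = S i c' \<and> S i d' = S i c"
        unfolding rest by blast
      moreover have "S i c = S i c0" "S i c' = S i c0"
        using \<open>c \<in> C\<close> \<open>c' \<in> C\<close> i by (auto simp: C_def agree_def)
      ultimately show ?thesis by auto
    qed
    then show ?thesis using that by (auto simp: C_def agree_def)
  qed
  obtain h where h: "bij_betw h (C \<times> C) (C \<times> C)" "\<And>p. p \<in> C \<times> C \<Longrightarrow> key' (h p) = key p"
  proof (rule bij_betw_of_fibres[OF fin fin refl])
    fix p assume p: "p \<in> C \<times> C"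
    obtain c c' where [simp]: "p = (c, c')" by (cases p)
    have cc: "c \<in> C" "c' \<in> C" using p by auto
    then have "agree S Z c c'" "c < n" "c' < n" by (auto simp: C_def agree_def)
    then have "card {(d, d'). d < n \<and> d' < n \<and> pair_match S m x y c c' c c' d d'} =
      card {(d, d'). d < n \<and> d' < n \<and> pair_match S m x y c c' c' c d d'}"
      using ind by (auto simp: indep_rows_def)
    moreover have "pair_match S m x y c c' c c' d d' \<longleftrightarrow> key (d, d') = key p"
      "pair_match S m x y c c' c' c d d' \<longleftrightarrow> key' (d, d') = key p" for d d'
      by (simp_all add: pair_match_def key_def key'_def rest) blast
    moreover have "{(d, d'). d < n \<and> d' < n \<and> k (d, d') = key p} = {p' \<in> C \<times> C. k p' = key p}"
      if "\<And>d d'. k (d, d') = key p \<Longrightarrow> rest (d, d') = rest (c, c')" for k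
    proof -
      have "d \<in> C \<and> d' \<in> C \<longleftrightarrow> d < n \<and> d' < n" if "k (d, d') = key p" for d d'
        using inC[OF cc] \<open>\<And>d d'. k (d, d') = key p \<Longrightarrow> rest (d, d') = rest (c, c')\<close>[OF that]
        by (auto simp: C_def)
      then show ?thesis by auto
    qed
    from this[of key] this[of key'] have
      "{(d, d'). d < n \<and> d' < n \<and> key (d, d') = key p} = {p' \<in> C \<times> C. key p' = key p}"
      "{(d, d'). d < n \<and> d' < n \<and> key' (d, d') = key p} = {p' \<in> C \<times> C. key' p' = key p}"
      by (simp_all add: key_def key'_def)
    ultimately show "card {p' \<in> C \<times> C. key p' = key p} = card {p' \<in> C \<times> C. key' p' = key p}" by simp
  qed blast
  define Q where "Q p = (\<Prod>i\<in>W. w i (fst p) * w i (snd p))" for p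
  have eq: "w x (fst q) * w y (snd q) * Q q = w x (fst p) * w y (fst p) * Q p" if "key' q = key p" for p q
  proof -
    have "rest q = rest p" using that by (simp add: key_def key'_def)
    then have "rest (fst q, snd q) = rest (fst p, snd p)" by simp
    then have *: "\<forall>i<m. i \<noteq> x \<longrightarrow> i \<noteq> y \<longrightarrow>
        S i (fst q) = S i (fst p) \<and> S i (snd q) = S i (snd p) \<or>
        S i (fst q) = S i (snd p) \<and> S i (snd q) = S i (fst p)"
      unfolding rest .
    have "w i (fst q) * w i (snd q) = w i (fst p) * w i (snd p)" if "i \<in> W" for i
    proof -
      have "i < m" "i \<noteq> x" "i \<noteq> y" using that W by auto
      with * consider "S i (fst q) = S i (fst p)" "S i (snd q) = S i (snd p)"
        | "S i (fst q) = S i (snd p)" "S i (snd q) = S i (fst p)" by blast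
      then show ?thesis
        by cases (auto dest!: w simp: mult.commute)
    qed
    then have "Q q = Q p" unfolding Q_def by (intro prod.cong) auto
    moreover have "w x (fst q) = w x (fst p)" "w y (snd q) = w y (fst p)"
      using that by (auto simp: key_def key'_def intro!: w)
    ultimately show ?thesis by simp
  qed
  have "F (insert x (insert y W)) * F W = (\<Sum>p\<in>C \<times> C. w x (fst p) * w y (fst p) * Q p)"
    unfolding F_def sum_product sum.cartesian_product using finW W(2,3) xy(3)
    by (intro sum.cong) (auto simp: Q_def prod.distrib mult_ac)
  also have "\<dots> = (\<Sum>p\<in>C \<times> C. w x (fst (h p)) * w y (snd (h p)) * Q (h p))"
    using h(2) eq by (intro sum.cong) auto
  also have "\<dots> = (\<Sum>p\<in>C \<times> C. w x (fst p) * w y (snd p) * Q p)"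
    by (rule sum.reindex_bij_betw[OF h(1)])
  also have "\<dots> = F (insert x W) * F (insert y W)"
    unfolding F_def sum_product sum.cartesian_product using finW W(2,3) xy(3)
    by (intro sum.cong) (auto simp: Q_def prod.distrib mult_ac)
  finally show ?thesis .
qed

text \<open>A set function whose mixed second differences across \<open>A\<close>, \<open>B\<close> vanish multiplicatively splits.\<close>

lemma separate_set_function:
  fixes F :: "'a set \<Rightarrow> 'b::idom"
  assumes fin: "finite A" "finite B" and disj: "A \<inter> B = {}"
    and nz: "\<And>W. W \<subseteq> A \<union> B \<Longrightarrow> F W \<noteq> 0"
    and ex: "\<And>x y W. x \<in> A \<Longrightarrow> y \<in> B \<Longrightarrow> W \<subseteq> A \<union> B \<Longrightarrow> x \<notin> W \<Longrightarrow> y \<notin> W \<Longrightarrow>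
      F (insert x (insert y W)) * F W = F (insert x W) * F (insert y W)"
  shows "F (A \<union> B) * F {} = F A * F B"
proof -
  \<comment> \<open>Elements of \<open>B\<close> are added one at a time for a fixed x; elements of
    \<open>A\<close> are added one at a time afterwards.\<close>
  have step: "F (insert x (U \<union> V)) * F U = F (insert x U) * F (U \<union> V)"
    if "finite V" "V \<subseteq> B" "x \<in> A" "x \<notin> U" "U \<subseteq> A" for x U V
    using that
  proof (induction V rule: finite_induct)
    case (insert y V)
    have "y \<notin> U \<union> V" "x \<notin> U \<union> V" using insert disj by auto
    then have "F (insert x (insert y (U \<union> V))) * F (U \<union> V) = F (insert x (U \<union> V)) * F (insert y (U \<union> V))"
      using insert.prems by (intro ex) auto
    \<comment> \<open>The exchange identity and the induction hypothesis are combined after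
      multiplying by \<open>F (U \<union> V)\<close>, which is cancelled at the end because it is
      nonzero.\<close>
    then have "F (insert x (insert y (U \<union> V))) * F U * F (U \<union> V) =
        F (insert x (U \<union> V)) * F U * F (insert y (U \<union> V))"
      by (simp add: mult_ac)
    also have "\<dots> = F (insert x U) * F (insert y (U \<union> V)) * F (U \<union> V)"
      using insert by (simp add: mult_ac)
    finally have "F (insert x (insert y (U \<union> V))) * F U = F (insert x U) * F (insert y (U \<union> V))"
      using nz[of "U \<union> V"] insert.prems by auto
    then show ?case by simp
  qed (simp add: mult.commute)
  have "F (U \<union> B) * F {} = F U * F B" if "finite U" "U \<subseteq> A" for U
    using that
  proof (induction U rule: finite_induct)
    case (insert x U)
    have "F (insert x U \<union> B) * F {} * F U = F (insert x U) * (F (U \<union> B) * F {})"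
      using step[of B x U] insert fin by (simp add: mult_ac)
    also have "\<dots> = F (insert x U) * F B * F U" using insert by (simp add: mult_ac)
    finally show ?case using nz[of U] insert.prems by auto
  qed (simp add: mult.commute)
  then show ?thesis using fin by blast
qed

text \<open>Counting matching columns is a sum of products of 0/1 weights, to which
  \<open>separate_set_function\<close> would apply if no such count could vanish. The weight 0 of a
  mismatch is therefore replaced by an indeterminate: the resulting polynomials \<open>F W\<close>
  are nonzero, as their value at 1 is the size of the slice, and their value at 0 is the
  count.\<close>

lemma indep_rows_card:
  assumes ind: "\<And>x y. x \<in> A \<Longrightarrow> y \<in> B \<Longrightarrow> indep_rows S m n Z x y"
    and Z: "Z \<subseteq> {..<m}" and A: "A \<subseteq> {..<m} - Z" and B: "B \<subseteq> {..<m} - Z" and disj: "A \<inter> B = {}"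
    and c: "c1 < n" "c2 < n" "agree S Z c1 c2"
  shows "card {c. c < n \<and> agree S (Z \<union> A) c1 c \<and> agree S (Z \<union> B) c2 c} * card {c. c < n \<and> agree S Z c1 c} =
    card {c. c < n \<and> agree S (Z \<union> A) c1 c} * card {c. c < n \<and> agree S (Z \<union> B) c2 c}"
proof -
  define C where "C = {c. c < n \<and> agree S Z c1 c}"
  \<comment> \<open>The target pattern is mixed: rows of \<open>A\<close> are compared with
    \<open>c1\<close>, all others with \<open>c2\<close>.\<close>
  define w where "w i c = (if S i c = (if i \<in> A then S i c1 else S i c2) then 1 else [:0, 1:] :: int poly)" for i c
  define F where "F W = (\<Sum>c\<in>C. \<Prod>i\<in>W. w i c)" for W
  have finC: "finite C" by (simp add: C_def)
  have fin: "finite A" "finite B" using A B finite_subset by blast+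
  have F1: "poly (F W) 1 = int (card C)" for W
  proof -
    have "poly (w i c) 1 = 1" for i c by (simp add: w_def)
    then show ?thesis by (simp add: F_def poly_sum poly_prod)
  qed
  have "card C > 0" using finC c by (auto simp: C_def card_gt_0_iff)
  then have nz: "F W \<noteq> 0" for W using F1[of W] by auto
  have F0: "poly (F W) 0 = int (card {c. c < n \<and> agree S (Z \<union> (W \<inter> A)) c1 c \<and> agree S (Z \<union> (W - A)) c2 c})"
    if "finite W" for W
  proof -
    have "poly (\<Prod>i\<in>W. w i c) 0 = (if agree S (W \<inter> A) c1 c \<and> agree S (W - A) c2 c then 1 else 0)" for c
    proof (cases "agree S (W \<inter> A) c1 c \<and> agree S (W - A) c2 c")
      case True
      then have "w i c = 1" if "i \<in> W" for i using that by (auto simp: w_def agree_def)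
      with True show ?thesis by simp
    next
      case False
      then obtain i where "i \<in> W" "S i c \<noteq> (if i \<in> A then S i c1 else S i c2)"
        by (auto simp: agree_def)
      then have "\<exists>i\<in>W. poly (w i c) 0 = 0" by (intro bexI[of _ i]) (auto simp: w_def)
      with False that show ?thesis by (auto simp: poly_prod)
    qed
    then have "poly (F W) 0 = (\<Sum>c\<in>C. if agree S (W \<inter> A) c1 c \<and> agree S (W - A) c2 c then 1 else 0)"
      by (simp add: F_def poly_sum)
    also have "\<dots> = int (card {c \<in> C. agree S (W \<inter> A) c1 c \<and> agree S (W - A) c2 c})"
      using finC by (simp add: sum.If_cases Int_def)
    also have "{c \<in> C. agree S (W \<inter> A) c1 c \<and> agree S (W - A) c2 c} =
        {c. c < n \<and> agree S (Z \<union> (W \<inter> A)) c1 c \<and> agree S (Z \<union> (W - A)) c2 c}"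
      using c(3) agree_trans[of S Z c1 c2] agree_trans[OF agree_sym[OF c(3)]] by (auto simp: C_def agree_Un)
    finally show ?thesis .
  qed
  have "F (A \<union> B) * F {} = F A * F B"
  proof (rule separate_set_function[OF fin disj nz])
    fix x y W assume h: "x \<in> A" "y \<in> B" "W \<subseteq> A \<union> B" "x \<notin> W" "y \<notin> W"
    show "F (insert x (insert y W)) * F W = F (insert x W) * F (insert y W)"
      unfolding F_def C_def
      by (rule indep_rows_exchange[OF ind]) (use h A B Z disj in \<open>auto simp: w_def\<close>)
  qed
  then have *: "poly (F (A \<union> B)) 0 * poly (F {}) 0 = poly (F A) 0 * poly (F B) 0"
    by (metis poly_mult)
  have "{c. c < n \<and> agree S Z c1 c \<and> agree S Z c2 c} = {c. c < n \<and> agree S Z c1 c}"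
    "{c. c < n \<and> agree S (Z \<union> A) c1 c \<and> agree S Z c2 c} = {c. c < n \<and> agree S (Z \<union> A) c1 c}"
    "{c. c < n \<and> agree S Z c1 c \<and> agree S (Z \<union> B) c2 c} = {c. c < n \<and> agree S (Z \<union> B) c2 c}"
    using c(3) agree_trans[OF c(3)] agree_trans[OF agree_sym[OF c(3)]] by (auto simp: agree_Un)
  moreover have "(A \<union> B) \<inter> A = A" "A \<union> B - A = B" "B \<inter> A = {}" "B - A = B" using disj by auto
  ultimately show ?thesis
    using * fin by (simp add: F0 flip: of_nat_mult)
qed

section \<open>Soundness: counting identities yield a factorisation\<close>

text \<open>A certificate that can be checked by counting. \<open>K1\<close> and \<open>K2\<close>
  select the columns of \<open>S\<close> that become columns of the factors; \<open>A\<close> and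
  the special rows are the rows of the first factor, and the rows outside \<open>A\<close> are those
  of the second. The first family of equations compares, for each full pattern, columns of
  \<open>S\<close> with pairs of kept columns; the second does so for each slice.\<close>

definition splits ::
  "nat \<Rightarrow> (nat \<Rightarrow> nat \<Rightarrow> 'a::zero_neq_one) \<Rightarrow> nat \<Rightarrow> nat \<Rightarrow> (nat \<Rightarrow> nat) \<Rightarrow> nat set \<Rightarrow>
     (nat \<Rightarrow> bool) \<Rightarrow> (nat \<Rightarrow> bool) \<Rightarrow> bool" where
  "splits k S m n X A K1 K2 \<longleftrightarrow>
     X ` {..<k - 1} \<subseteq> {..<m} \<and> A \<subseteq> {..<m} - X ` {..<k - 1} \<and> A \<noteq> {} \<and>
     {..<m} - X ` {..<k - 1} - A \<noteq> {} \<and>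
     (\<forall>c<n. \<exists>j<k. marked k (\<lambda>t. S (X t) c) j) \<and> (\<forall>j<k. \<exists>c<n. marked k (\<lambda>t. S (X t) c) j) \<and>
     (\<forall>c<n. card {d. d < n \<and> agree S {..<m} c d} =
        card {d. d < n \<and> K1 d \<and> agree S (A \<union> X ` {..<k - 1}) c d} *
        card {d. d < n \<and> K2 d \<and> agree S ({..<m} - A) c d}) \<and>
     (\<forall>c<n. card {d. d < n \<and> agree S (X ` {..<k - 1}) c d} =
        card {d. d < n \<and> K1 d \<and> agree S (X ` {..<k - 1}) c d} *
        card {d. d < n \<and> K2 d \<and> agree S (X ` {..<k - 1}) c d}) \<and>
     (k \<ge> 2 \<longrightarrow> card {d. d < n \<and> K1 d} < n \<and> card {d. d < n \<and> K2 d} < n)"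

definition select_mat :: "(nat \<Rightarrow> nat \<Rightarrow> 'a) \<Rightarrow> nat list \<Rightarrow> nat list \<Rightarrow> 'a mat" where
  "select_mat S rs cs = mat (length rs) (length cs) (\<lambda>(i, j). S (rs ! i) (cs ! j))"

text \<open>The special rows are put first in the row list, so their indices in either factor are
  \<open>[0..<k - 1]\<close>. Restricting the columns keeps every column marked, so only the
  occurrence of each marker has to be assumed for \<open>K\<close>.\<close>

lemma special_rows_select_mat:
  assumes "\<forall>c<n. \<exists>j<k. marked k (\<lambda>t. S (X t) c) j"
    and "\<forall>j<k. \<exists>c<n. K c \<and> marked k (\<lambda>t. S (X t) c) j"
  shows "special_rows k (select_mat S (map X [0..<k - 1] @ R) (filter K [0..<n])) [0..<k - 1]"
proof -
  let ?cs = "filter K [0..<n]"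
  let ?T = "select_mat S (map X [0..<k - 1] @ R) ?cs"
  have eq: "marked k (\<lambda>t. ?T $$ ([0..<k - 1] ! t, c)) j = marked k (\<lambda>t. S (X t) (?cs ! c)) j"
    if "c < length ?cs" for c j
    using that by (intro marked_cong) (simp add: select_mat_def nth_append)
  have "\<exists>j<k. marked k (\<lambda>t. ?T $$ ([0..<k - 1] ! t, c)) j" if "c < dim_col ?T" for c
  proof -
    have c: "c < length ?cs" using that by (simp add: select_mat_def)
    then have "?cs ! c < n" using nth_mem[OF c] by auto
    then show ?thesis unfolding eq[OF c] using assms(1) by blast
  qed
  moreover have "\<exists>c<dim_col ?T. marked k (\<lambda>t. ?T $$ ([0..<k - 1] ! t, c)) j" if "j < k" for j
  proof -
    obtain c where "c < n" "K c" and c: "marked k (\<lambda>t. S (X t) c) j" using assms(2) \<open>j < k\<close> by blast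
    then have "c \<in> set ?cs" by simp
    then obtain i where i: "i < length ?cs" "?cs ! i = c" by (auto simp only: in_set_conv_nth)
    then show ?thesis using c eq[OF i(1)] by (intro exI[of _ i]) (simp add: select_mat_def)
  qed
  ultimately show ?thesis unfolding special_rows_iff by (auto simp: select_mat_def)
qed

text \<open>The pairs are counted slice by slice: in each slice they form a full product of the kept
  columns, which by assumption is as large as the slice.\<close>

lemma card_agreeing_pairs:
  assumes "\<And>c. c < n \<Longrightarrow> card {d. d < n \<and> agree S Z c d} =
        card {d. d < n \<and> K1 d \<and> agree S Z c d} * card {d. d < n \<and> K2 d \<and> agree S Z c d}"
  shows "card {(a, b). a < n \<and> K1 a \<and> b < n \<and> K2 b \<and> agree S Z a b} = n"
proof -
  \<comment> \<open>Cutting a column off to \<open>undefined\<close> outside \<open>Z\<close> turns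
    agreement on \<open>Z\<close> into equality of functions, so that slices become fibres.\<close>
  define key where "key c = (\<lambda>i. if i \<in> Z then S i c else undefined)" for c
  have key: "key c = key d \<longleftrightarrow> agree S Z c d" for c d
    by (auto simp: key_def agree_def fun_eq_iff)
  let ?V = "key ` {..<n}"
  have "{(a, b). a < n \<and> K1 a \<and> b < n \<and> K2 b \<and> agree S Z a b} =
    (\<Union>v\<in>?V. {d. d < n \<and> K1 d \<and> key d = v} \<times> {d. d < n \<and> K2 d \<and> key d = v})"
    by (auto simp flip: key)
  also have "card \<dots> = (\<Sum>v\<in>?V. card ({d. d < n \<and> K1 d \<and> key d = v} \<times> {d. d < n \<and> K2 d \<and> key d = v}))"
    by (rule card_UN_disjoint) auto
  also have "\<dots> = (\<Sum>v\<in>?V. card {d. d < n \<and> key d = v})"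
  proof (rule sum.cong[OF refl])
    fix v assume "v \<in> ?V"
    then obtain c where c: "c < n" "v = key c" by auto
    then show "card ({d. d < n \<and> K1 d \<and> key d = v} \<times> {d. d < n \<and> K2 d \<and> key d = v}) =
        card {d. d < n \<and> key d = v}"
      using assms[OF c(1)] by (simp add: card_cartesian_product key[symmetric] eq_commute)
  qed
  also have "\<dots> = card (\<Union>v\<in>?V. {d. d < n \<and> key d = v})"
    by (rule card_UN_disjoint[symmetric]) auto
  also have "(\<Union>v\<in>?V. {d. d < n \<and> key d = v}) = {..<n}" by auto
  finally show ?thesis by simp
qed

lemma bij_betw_nth_filter:
  "bij_betw ((!) (filter P [0..<n])) {..<card {i. i < n \<and> P i}} {i. i < n \<and> P i}"
proof -
  have len: "length (filter P [0..<n]) = card {i. i < n \<and> P i}"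
    by (simp add: length_filter_conv_card) (auto intro!: arg_cong[where f = card])
  show ?thesis by (rule bij_betw_nth) (auto simp: len)
qed

lemma length_filter_upt: "length (filter P [0..<n]) = card {i. i < n \<and> P i}"
  using bij_betw_same_card[OF bij_betw_nth[OF _ refl refl, of "filter P [0..<n]"]]
  by (simp) 

text \<open>Rows are labelled according to whether they lie in \<open>A\<close>, in \<open>Z\<close>
  or in neither. For columns, \<open>bij_betw_of_fibres\<close> compares the columns of
  \<open>S\<close> showing a given pattern with the compatible pairs of kept columns that produce
  it.\<close>

theorem splits_imp_k_factorisation:
  fixes M :: "'a::zero_neq_one mat"
  defines "m \<equiv> dim_row M" and "n \<equiv> dim_col M"
  assumes S: "\<And>i c. i < m \<Longrightarrow> c < n \<Longrightarrow> S i c = M $$ (i, c)"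
    and k: "k \<ge> 1" and sp: "splits k S m n X A K1 K2"
  shows "k_factorisation k M
    (select_mat S (map X [0..<k - 1] @ filter (\<lambda>i. i \<in> A) [0..<m]) (filter K1 [0..<n])) [0..<k - 1]
    (select_mat S (map X [0..<k - 1] @ filter (\<lambda>i. i \<notin> A \<and> i \<notin> X ` {..<k - 1}) [0..<m])
       (filter K2 [0..<n])) [0..<k - 1]"
    (is "k_factorisation k M ?S1 ?xs ?S2 ?xs")
proof -
  define Z where "Z = X ` {..<k - 1}"
  define B where "B = {..<m} - Z - A"
  define LA LB where "LA = filter (\<lambda>i. i \<in> A) [0..<m]" and "LB = filter (\<lambda>i. i \<notin> A \<and> i \<notin> Z) [0..<m]"
  define cs1 cs2 where "cs1 = filter K1 [0..<n]" and "cs2 = filter K2 [0..<n]"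
  have ZA: "Z \<subseteq> {..<m}" "A \<subseteq> {..<m} - Z" "A \<noteq> {}" "B \<noteq> {}"
    and mk: "\<forall>c<n. \<exists>j<k. marked k (\<lambda>t. S (X t) c) j" "\<forall>j<k. \<exists>c<n. marked k (\<lambda>t. S (X t) c) j"
    and c5: "\<And>c. c < n \<Longrightarrow> card {d. d < n \<and> agree S {..<m} c d} =
        card {d. d < n \<and> K1 d \<and> agree S (A \<union> Z) c d} * card {d. d < n \<and> K2 d \<and> agree S ({..<m} - A) c d}"
    and c6: "\<And>c. c < n \<Longrightarrow> card {d. d < n \<and> agree S Z c d} =
        card {d. d < n \<and> K1 d \<and> agree S Z c d} * card {d. d < n \<and> K2 d \<and> agree S Z c d}"
    and c7: "k \<ge> 2 \<longrightarrow> card {d. d < n \<and> K1 d} < n \<and> card {d. d < n \<and> K2 d} < n"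
    using sp unfolding splits_def Z_def B_def by auto
  have fin: "finite A" "finite B" "finite Z" using ZA unfolding B_def by (auto intro: finite_subset)
  \<comment> \<open>In a column carrying the marker \<open>Suc s\<close> the row \<open>X s\<close>
    has entry 1 and the other special rows have entry 0.\<close>
  have injX: "inj_on X {..<k - 1}"
  proof (rule inj_onI)
    fix s t assume st: "s \<in> {..<k - 1}" "t \<in> {..<k - 1}" "X s = X t"
    then obtain c where c: "marked k (\<lambda>t. S (X t) c) (Suc s)" using mk(2) by (auto dest: spec[of _ "Suc s"])
    then have "S (X s) c = 1" using st(1) by (simp add: marked_def)
    then have "S (X t) c = 1" using st by simp
    moreover have "S (X t) c = (if t = s then 1 else 0)" using c st(2) by (simp add: marked_def)
    ultimately show "s = t" by (auto split: if_splits)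
  qed
  then have cardZ: "card Z = k - 1" by (simp add: Z_def card_image)
  have setLA: "{i. i < m \<and> i \<in> A} = A" and setLB: "{i. i < m \<and> i \<notin> A \<and> i \<notin> Z} = B"
    using ZA by (auto simp: B_def)
  have lens: "length LA = card A" "length LB = card B" "length cs1 = card {d. d < n \<and> K1 d}"
    "length cs2 = card {d. d < n \<and> K2 d}"
    by (simp_all add: LA_def LB_def cs1_def cs2_def length_filter_upt setLA setLB)
  have m: "m = card A + card B + (k - 1)"
  proof -
    have "{..<m} = A \<union> B \<union> Z" using ZA by (auto simp: B_def)
    then have "m = card (A \<union> B \<union> Z)" by (metis card_lessThan)
    also have "\<dots> = card A + card B + card Z"
      using fin ZA by (subst card_Un_disjoint; (subst card_Un_disjoint)?) (auto simp: B_def)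
    finally show ?thesis by (simp add: cardZ)
  qed
  have dims: "dim_row ?S1 = k - 1 + card A" "dim_row ?S2 = k - 1 + card B"
    "dim_col ?S1 = length cs1" "dim_col ?S2 = length cs2"
    using lens by (simp_all add: select_mat_def LA_def LB_def Z_def cs1_def cs2_def)
  have S1: "?S1 = select_mat S (map X [0..<k - 1] @ LA) cs1"
    and S2: "?S2 = select_mat S (map X [0..<k - 1] @ LB) cs2"
    unfolding LA_def LB_def cs1_def cs2_def Z_def by (rule refl)+
  have pos: "card A > 0" "card B > 0" using fin ZA by (simp_all add: card_gt_0_iff)
  \<comment> \<open>Both factors keep a column of every slice, because a slice is nonempty and its
    size is the product of the two kept counts.\<close>
  have ex: "\<exists>c<n. K1 c \<and> marked k (\<lambda>t. S (X t) c) j" "\<exists>c<n. K2 c \<and> marked k (\<lambda>t. S (X t) c) j" if j: "j < k" for j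
  proof -
    obtain c where c: "c < n" "marked k (\<lambda>t. S (X t) c) j" using mk(2) j by blast
    have "card {d. d < n \<and> agree S Z c d} > 0" using c(1) by (auto simp: card_gt_0_iff)
    then have "card {d. d < n \<and> K1 d \<and> agree S Z c d} > 0" "card {d. d < n \<and> K2 d \<and> agree S Z c d} > 0"
      using c6[OF c(1)] by (metis mult_0 mult_0_right gr0I)+
    then obtain d e where de: "d < n" "K1 d" "agree S Z c d" "e < n" "K2 e" "agree S Z c e"
      by (auto simp: card_gt_0_iff)
    have "marked k (\<lambda>t. S (X t) d) j = marked k (\<lambda>t. S (X t) c) j"
      "marked k (\<lambda>t. S (X t) e) j = marked k (\<lambda>t. S (X t) c) j"
      using de(3,6) by (auto intro!: marked_cong simp: agree_def Z_def)
    with c de show "\<exists>c<n. K1 c \<and> marked k (\<lambda>t. S (X t) c) j" "\<exists>c<n. K2 c \<and> marked k (\<lambda>t. S (X t) c) j" by blast+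
  qed
  have sr: "special_rows k ?S1 ?xs" "special_rows k ?S2 ?xs"
    by (rule special_rows_select_mat[where X = X and S = S, OF mk(1)]; use ex in blast)+
  have bcs: "bij_betw ((!) cs1) {..<length cs1} {d. d < n \<and> K1 d}" "bij_betw ((!) cs2) {..<length cs2} {d. d < n \<and> K2 d}"
    unfolding lens unfolding cs1_def cs2_def by (rule bij_betw_nth_filter)+
  have bA: "bij_betw ((!) LA) {..<card A} A" and bB: "bij_betw ((!) LB) {..<card B} B"
    using bij_betw_nth_filter[of "\<lambda>i. i \<in> A" m] bij_betw_nth_filter[of "\<lambda>i. i \<notin> A \<and> i \<notin> Z" m]
    unfolding LA_def LB_def setLA setLB .
  define posA posB posZ where "posA = inv_into {..<card A} ((!) LA)" and "posB = inv_into {..<card B} ((!) LB)"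
    and "posZ = inv_into {..<k - 1} X"
  have posA: "posA i < card A" "LA ! posA i = i" if "i \<in> A" for i
    using that bij_betw_inv_into_right[OF bA] bij_betwE[OF bij_betw_inv_into[OF bA]] by (auto simp: posA_def)
  have posB: "posB i < card B" "LB ! posB i = i" if "i \<in> B" for i
    using that bij_betw_inv_into_right[OF bB] bij_betwE[OF bij_betw_inv_into[OF bB]] by (auto simp: posB_def)
  have posZ: "posZ i < k - 1" "X (posZ i) = i" if "i \<in> Z" for i
    using that inv_into_into[of i X "{..<k - 1}"] by (auto simp: posZ_def Z_def f_inv_into_f)
  define \<rho> :: "nat \<Rightarrow> nat + nat + nat" where "\<rho> i = (if i \<in> A then Inl (k - 1 + posA i) else if i \<in> Z then Inr (Inr (posZ i))
     else Inr (Inl (k - 1 + posB i)))" for i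
  \<comment> \<open>A left inverse of \<open>\<rho>\<close>, for injectivity. That
    \<open>\<rho>\<close> is onto follows by counting labels.\<close>
  define unlabel :: "nat + nat + nat \<Rightarrow> nat" where
    "unlabel = case_sum (\<lambda>i. LA ! (i - (k - 1))) (case_sum (\<lambda>i. LB ! (i - (k - 1))) X)"
  have inB: "i \<in> B" if "i < m" "i \<notin> A" "i \<notin> Z" for i using that by (simp add: B_def)
  have "unlabel (\<rho> i) = i" if "i < m" for i
    using that posA posB posZ inB by (auto simp: unlabel_def \<rho>_def)
  then have inj: "inj_on \<rho> {..<m}" by (metis inj_onI lessThan_iff)
  have RL: "row_labels k ?S1 ?xs ?S2 ?xs = {k - 1..<k - 1 + card A} <+> {k - 1..<k - 1 + card B} <+> {..<k - 1}"
    unfolding row_labels_def dims by (intro arg_cong2[of _ _ _ _ "(<+>)"]) auto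
  have r: "bij_betw \<rho> {..<m} (row_labels k ?S1 ?xs ?S2 ?xs)"
    unfolding bij_betw_def
  proof (intro conjI inj card_subset_eq)
    show "\<rho> ` {..<m} \<subseteq> row_labels k ?S1 ?xs ?S2 ?xs"
      unfolding RL using posA posB posZ inB by (auto simp: \<rho>_def)
    show "card (\<rho> ` {..<m}) = card (row_labels k ?S1 ?xs ?S2 ?xs)"
      unfolding RL using inj by (simp add: card_image card_Plus m)
    show "finite (row_labels k ?S1 ?xs ?S2 ?xs)" unfolding RL by simp
  qed
  have entry: "label_entry ?S1 ?xs ?S2 (\<rho> i) (a, b) = (if i \<in> A \<union> Z then S i (cs1 ! a) else S i (cs2 ! b))"
    if "i < m" "a < length cs1" "b < length cs2" for i a b
  proof -
    consider "i \<in> A" | "i \<in> Z" "i \<notin> A" | "i \<in> B" "i \<notin> A" "i \<notin> Z" using inB \<open>i < m\<close> by blast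
    then show ?thesis
    proof cases
      case 1
      with that(2) show ?thesis using posA[of i] lens(1)
        unfolding S1 by (simp add: \<rho>_def select_mat_def nth_append)
    next
      case 2
      with that(2) show ?thesis using posZ[of i]
        unfolding S1 by (simp add: \<rho>_def select_mat_def nth_append)
    next
      case 3
      with that(3) show ?thesis using posB[of i] lens(2)
        unfolding S2 by (simp add: \<rho>_def select_mat_def nth_append)
    qed
  qed
  have CL: "col_labels k ?S1 ?xs ?S2 ?xs =
      {(a, b). a < length cs1 \<and> b < length cs2 \<and> agree S Z (cs1 ! a) (cs2 ! b)}"
  proof -
    have "?S1 $$ (?xs ! t, a) = S (X t) (cs1 ! a)" if "t < k - 1" "a < length cs1" for t a
      using that unfolding S1 by (simp add: select_mat_def nth_append)
    moreover have "?S2 $$ (?xs ! t, b) = S (X t) (cs2 ! b)" if "t < k - 1" "b < length cs2" for t b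
      using that unfolding S2 by (simp add: select_mat_def nth_append)
    moreover have "agree S Z c d \<longleftrightarrow> (\<forall>t<k - 1. S (X t) c = S (X t) d)" for c d
      by (auto simp: agree_def Z_def)
    ultimately show ?thesis unfolding col_labels_def dims by auto
  qed
  \<comment> \<open>Passes from positions in the lists of kept columns to column indices of
    \<open>S\<close>.\<close>
  define \<kappa> where "\<kappa> = map_prod ((!) cs1) ((!) cs2)"
  have inj\<kappa>: "inj_on \<kappa> ({..<length cs1} \<times> {..<length cs2})"
    unfolding \<kappa>_def by (intro map_prod_inj_on bij_betw_imp_inj_on[OF bcs(1)] bij_betw_imp_inj_on[OF bcs(2)])
  have im: "\<kappa> ` {(a, b). a < length cs1 \<and> b < length cs2 \<and> Q (cs1 ! a) (cs2 ! b)} =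
      {(a, b). a < n \<and> K1 a \<and> b < n \<and> K2 b \<and> Q a b}" for Q
  proof (rule equalityI; rule subsetI)
    fix p assume "p \<in> {(a, b). a < n \<and> K1 a \<and> b < n \<and> K2 b \<and> Q a b}"
    then obtain a b where ab: "p = (a, b)" "a \<in> {d. d < n \<and> K1 d}" "b \<in> {d. d < n \<and> K2 d}" "Q a b" by blast
    then have "a \<in> (!) cs1 ` {..<length cs1}" "b \<in> (!) cs2 ` {..<length cs2}"
      using bcs by (simp_all add: bij_betw_def)
    then obtain a' b' where "a' < length cs1" "cs1 ! a' = a" "b' < length cs2" "cs2 ! b' = b"
      by blast
    then show "p \<in> \<kappa> ` {(a, b). a < length cs1 \<and> b < length cs2 \<and> Q (cs1 ! a) (cs2 ! b)}"
      using ab by (intro image_eqI[of _ _ "(a', b')"]) (auto simp: \<kappa>_def)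
  qed (use bij_betwE[OF bcs(1)] bij_betwE[OF bcs(2)] in \<open>auto simp: \<kappa>_def\<close>)
  have cardQ: "card {(a, b). a < length cs1 \<and> b < length cs2 \<and> Q (cs1 ! a) (cs2 ! b)} =
      card {(a, b). a < n \<and> K1 a \<and> b < n \<and> K2 b \<and> Q a b}" for Q
  proof -
    have "card (\<kappa> ` {(a, b). a < length cs1 \<and> b < length cs2 \<and> Q (cs1 ! a) (cs2 ! b)}) =
        card {(a, b). a < length cs1 \<and> b < length cs2 \<and> Q (cs1 ! a) (cs2 ! b)}"
      by (intro card_image inj_on_subset[OF inj\<kappa>]) auto
    then show ?thesis unfolding im by simp
  qed
  \<comment> \<open>\<open>f c\<close> is column \<open>c\<close> of \<open>S\<close> as a list, and
    \<open>g p\<close> is the column of the product with label \<open>p\<close>, in the row order of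
    \<open>S\<close>.\<close>
  define f where "f c = map (\<lambda>i. S i c) [0..<m]" for c
  define g where "g p = map (\<lambda>i. label_entry ?S1 ?xs ?S2 (\<rho> i) p) [0..<m]" for p
  have "card {(a, b). a < n \<and> K1 a \<and> b < n \<and> K2 b \<and> agree S Z a b} = n"
    using c6 by (rule card_agreeing_pairs)
  then have card_col_labels: "card {(a, b). a < length cs1 \<and> b < length cs2 \<and> agree S Z (cs1 ! a) (cs2 ! b)} = n"
    using cardQ[of "agree S Z"] by simp
  obtain \<gamma> where \<gamma>: "bij_betw \<gamma> {..<n} (col_labels k ?S1 ?xs ?S2 ?xs)" "\<And>c. c \<in> {..<n} \<Longrightarrow> g (\<gamma> c) = f c"
  proof (rule bij_betw_of_fibres[of "{..<n}" "col_labels k ?S1 ?xs ?S2 ?xs" f g])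
    show "finite (col_labels k ?S1 ?xs ?S2 ?xs)"
      unfolding CL by (rule finite_subset[of _ "{..<length cs1} \<times> {..<length cs2}"]) auto
    show "card {..<n} = card (col_labels k ?S1 ?xs ?S2 ?xs)"
      unfolding CL card_col_labels by simp
    fix c assume c: "c \<in> {..<n}"
    have gf: "g (a, b) = f c \<longleftrightarrow> agree S (A \<union> Z) c (cs1 ! a) \<and> agree S B c (cs2 ! b)"
      if "a < length cs1" "b < length cs2" for a b
    proof -
      have "g (a, b) = f c \<longleftrightarrow> (\<forall>i<m. label_entry ?S1 ?xs ?S2 (\<rho> i) (a, b) = S i c)"
        by (auto simp: f_def g_def)
      also have "\<dots> \<longleftrightarrow> (\<forall>i<m. (if i \<in> A \<union> Z then S i (cs1 ! a) else S i (cs2 ! b)) = S i c)"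
        using entry[OF _ that] by simp
      also have "\<dots> \<longleftrightarrow> (\<forall>i\<in>A \<union> Z. S i (cs1 ! a) = S i c) \<and> (\<forall>i\<in>B. S i (cs2 ! b) = S i c)"
        using ZA(1,2) by (fastforce simp: B_def)
      finally show ?thesis by (simp add: agree_def eq_commute)
    qed
    have AB: "agree S ({..<m} - A) c b \<longleftrightarrow> agree S B c b \<and> agree S Z c b" for b
    proof -
      have "{..<m} - A = B \<union> Z" using ZA by (auto simp: B_def)
      then show ?thesis by (simp add: agree_Un)
    qed
    \<comment> \<open>Special rows of the product are read off the first factor. Compatibility of
      the pair carries them over to the second one, so its condition can be stated on all rows
      outside \<open>A\<close>, and the two conditions become independent of each other.\<close>
    have AZ: "agree S (A \<union> Z) c a \<Longrightarrow> agree S Z a b \<longleftrightarrow> agree S Z c b" for a b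
      by (simp add: agree_def)
    have "g (a, b) = f c \<and> agree S Z (cs1 ! a) (cs2 ! b) \<longleftrightarrow>
        agree S (A \<union> Z) c (cs1 ! a) \<and> agree S ({..<m} - A) c (cs2 ! b)"
      if "a < length cs1" "b < length cs2" for a b
      using gf[OF that] AZ[of "cs1 ! a" "cs2 ! b"] unfolding AB by blast
    then have 1: "{p \<in> col_labels k ?S1 ?xs ?S2 ?xs. g p = f c} = {(a, b). a < length cs1 \<and> b < length cs2 \<and>
        (agree S (A \<union> Z) c (cs1 ! a) \<and> agree S ({..<m} - A) c (cs2 ! b))}"
      unfolding CL by blast
    have 2: "{(a, b). a < n \<and> K1 a \<and> b < n \<and> K2 b \<and> (agree S (A \<union> Z) c a \<and> agree S ({..<m} - A) c b)} =
        {d. d < n \<and> K1 d \<and> agree S (A \<union> Z) c d} \<times> {d. d < n \<and> K2 d \<and> agree S ({..<m} - A) c d}"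
      by blast
    have 3: "{d. d < n \<and> agree S {..<m} c d} = {c' \<in> {..<n}. f c' = f c}"
      by (auto simp: agree_def f_def)
    have "c < n" using c by simp
    show "card {c' \<in> {..<n}. f c' = f c} = card {p \<in> col_labels k ?S1 ?xs ?S2 ?xs. g p = f c}"
      unfolding 1 cardQ[of "\<lambda>a b. agree S (A \<union> Z) c a \<and> agree S ({..<m} - A) c b"] 2
        card_cartesian_product 3[symmetric] by (rule c5[OF \<open>c < n\<close>])
  qed auto
  have "M $$ (i, c) = label_entry ?S1 ?xs ?S2 (\<rho> i) (\<gamma> c)" if "i < m" "c < n" for i c
  proof -
    have "map (\<lambda>i. label_entry ?S1 ?xs ?S2 (\<rho> i) (\<gamma> c)) [0..<m] = map (\<lambda>i. S i c) [0..<m]"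
      using \<gamma>(2)[of c] that unfolding f_def g_def by simp
    then show ?thesis using that by (simp add: S)
  qed
  then have "isomorphic_mat M (k_product k ?S1 ?xs ?S2 ?xs)"
    unfolding isomorphic_k_product_iff[OF sr k] using r \<gamma>(1) unfolding m_def n_def by blast
  moreover have "dim_row ?S1 < dim_row M" "dim_row ?S2 < dim_row M"
    unfolding dims using m pos unfolding m_def by simp_all
  moreover have "k \<ge> 2 \<longrightarrow> dim_col ?S1 < dim_col M \<and> dim_col ?S2 < dim_col M"
    unfolding dims lens using c7 by (simp add: n_def)
  ultimately show ?thesis unfolding k_factorisation_iff[OF k] using sr by blast
qed

section \<open>Keeping a fixed fraction of every class of columns\<close>

lemma bij_betw_rank:
  fixes E :: "nat set"
  assumes "finite E"
  shows "bij_betw (\<lambda>d. card {e \<in> E. e < d}) E {..<card E}"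
proof -
  let ?r = "\<lambda>d. card {e \<in> E. e < d}"
  have less: "?r d < ?r e" if "d \<in> E" "d < e" for d e
    using that assms by (intro psubset_card_mono) auto
  have inj: "inj_on ?r E"
  proof (rule inj_onI)
    fix d e assume "d \<in> E" "e \<in> E" "?r d = ?r e"
    then show "d = e" using less[of d e] less[of e d] by (cases d e rule: linorder_cases) auto
  qed
  have "?r d < card E" if "d \<in> E" for d
    using that assms by (intro psubset_card_mono) auto
  then have "?r ` E = {..<card E}"
    using inj by (intro card_subset_eq) (auto simp: card_image)
  with inj show ?thesis unfolding bij_betw_def by blast
qed

text \<open>Keeps one in \<open>w c\<close> of the columns that agree with \<open>c\<close> on \<open>R\<close>.\<close>

definition keep :: "(nat \<Rightarrow> nat \<Rightarrow> 'a) \<Rightarrow> nat \<Rightarrow> nat set \<Rightarrow> (nat \<Rightarrow> nat) \<Rightarrow> nat \<Rightarrow> bool" where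
  "keep S n R w c \<longleftrightarrow>
     card {d. d < n \<and> d < c \<and> agree S R c d} * w c < card {d. d < n \<and> agree S R c d}"

text \<open>In a class of size \<open>w c * q\<close>, the column of rank r is kept when
  \<open>r * w c < w c * q\<close>, that is, when r < q. So exactly the first q columns are
  kept.\<close>

lemma card_keep:
  assumes c: "c < n" and w: "\<And>d. d < n \<Longrightarrow> agree S R c d \<Longrightarrow> w d = w c" and dvd: "w c dvd card {d. d < n \<and> agree S R c d}"
  shows "card {d. d < n \<and> keep S n R w d \<and> agree S R c d} * w c = card {d. d < n \<and> agree S R c d}"
proof -
  define E where "E = {d. d < n \<and> agree S R c d}"
  have fin: "finite E" by (simp add: E_def)
  have "card E > 0" using fin c by (auto simp: E_def card_gt_0_iff)
  moreover obtain q where q: "card E = w c * q" using dvd unfolding E_def by (elim dvdE)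
  ultimately have pos: "w c > 0" by auto
  then have "q \<le> card E" by (simp add: q)
  have "keep S n R w d \<longleftrightarrow> card {e \<in> E. e < d} < q" if d: "d \<in> E" for d
  proof -
    have "agree S R d e \<longleftrightarrow> agree S R c e" for e
      using d agree_trans agree_sym unfolding E_def by blast
    then have "{e. e < n \<and> e < d \<and> agree S R d e} = {e \<in> E. e < d}" "{e. e < n \<and> agree S R d e} = E"
      by (auto simp: E_def)
    moreover have "w d = w c" using d w by (simp add: E_def)
    ultimately show ?thesis using pos by (simp add: keep_def q mult.commute)
  qed
  then have "{d. d < n \<and> keep S n R w d \<and> agree S R c d} = {d \<in> E. card {e \<in> E. e < d} < q}"
    by (auto simp: E_def)
  moreover have "card {d \<in> E. card {e \<in> E. e < d} < q} = card {..<q}"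
  proof (rule bij_betw_same_card, rule bij_betw_subset[OF bij_betw_rank[OF fin]])
    show "(\<lambda>d. card {e \<in> E. e < d}) ` {d \<in> E. card {e \<in> E. e < d} < q} = {..<q}"
    proof (rule equalityI; rule subsetI)
      fix r assume "r \<in> {..<q}"
      then have "r \<in> {..<card E}" using \<open>q \<le> card E\<close> by auto
      then have "r \<in> (\<lambda>d. card {e \<in> E. e < d}) ` E" using bij_betw_rank[OF fin] by (simp add: bij_betw_def)
      then obtain d where "d \<in> E" "r = card {e \<in> E. e < d}" by (rule imageE)
      then show "r \<in> (\<lambda>d. card {e \<in> E. e < d}) ` {d \<in> E. card {e \<in> E. e < d} < q}"
        using \<open>r \<in> {..<q}\<close> by (intro image_eqI[of _ _ d]) auto
    qed auto
  qed auto
  ultimately show ?thesis using q unfolding E_def by simp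
qed

lemma card_by_classes:
  assumes fin: "finite D"
    and "\<And>d. d \<in> D \<Longrightarrow> card {e \<in> D. P e \<and> agree S R d e} * w = card {e \<in> D. agree S R d e}"
  shows "card {e \<in> D. P e} * w = card D"
proof -
  define key where "key c = (\<lambda>i. if i \<in> R then S i c else undefined)" for c
  have key: "agree S R c d \<longleftrightarrow> key d = key c" for c d
    by (auto simp: key_def agree_def fun_eq_iff)
  have U: "card {e \<in> D. Q e} = (\<Sum>v\<in>key ` D. card {e \<in> D. Q e \<and> key e = v})" for Q
  proof -
    have "{e \<in> D. Q e} = (\<Union>v\<in>key ` D. {e \<in> D. Q e \<and> key e = v})" by auto
    moreover have "card (\<Union>v\<in>key ` D. {e \<in> D. Q e \<and> key e = v}) = (\<Sum>v\<in>key ` D. card {e \<in> D. Q e \<and> key e = v})"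
      using fin by (intro card_UN_disjoint) auto
    ultimately show ?thesis by simp
  qed
  have "card {e \<in> D. P e} * w = (\<Sum>v\<in>key ` D. card {e \<in> D. P e \<and> key e = v} * w)"
    unfolding U[of P] by (rule sum_distrib_right)
  also have "\<dots> = (\<Sum>v\<in>key ` D. card {e \<in> D. True \<and> key e = v})"
    using assms(2) by (intro sum.cong refl) (auto simp: key)
  also have "\<dots> = card {e \<in> D. True}" by (rule U[symmetric])
  finally show ?thesis by simp
qed

lemma dvd_card_by_classes:
  assumes "finite D" and "\<And>d. d \<in> D \<Longrightarrow> w dvd card {e \<in> D. agree S R d e}"
  shows "w dvd card D"
proof -
  define key where "key c = (\<lambda>i. if i \<in> R then S i c else undefined)" for c
  have key: "agree S R c d \<longleftrightarrow> key d = key c" for c d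
    by (auto simp: key_def agree_def fun_eq_iff)
  have "D = (\<Union>v\<in>key ` D. {e \<in> D. key e = v})" by auto
  moreover have "card (\<Union>v\<in>key ` D. {e \<in> D. key e = v}) = (\<Sum>v\<in>key ` D. card {e \<in> D. key e = v})"
    using assms(1) by (intro card_UN_disjoint) auto
  moreover have "w dvd (\<Sum>v\<in>key ` D. card {e \<in> D. key e = v})"
    using assms(2) by (intro dvd_sum) (auto simp: key)
  ultimately show ?thesis by simp
qed

abbreviation class_size :: "(nat \<Rightarrow> nat \<Rightarrow> 'a) \<Rightarrow> nat \<Rightarrow> nat set \<Rightarrow> nat \<Rightarrow> nat" where
  "class_size S n R c \<equiv> card {d. d < n \<and> agree S R c d}"

lemma class_size_pos: "c < n \<Longrightarrow> class_size S n R c > 0"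
  by (auto simp: card_gt_0_iff)

lemma class_size_cong:
  assumes "agree S R c d"
  shows "class_size S n R c = class_size S n R d"
proof -
  have "agree S R c e \<longleftrightarrow> agree S R d e" for e using assms agree_sym agree_trans by blast
  then show ?thesis by simp
qed

text \<open>A slice is a disjoint union of classes for the larger row set \<open>R\<close>, and the
  fraction kept is the same in all of them.\<close>

lemma card_keep_coarse:
  assumes c: "c < n" and w: "\<And>d. d < n \<Longrightarrow> agree S Z c d \<Longrightarrow> w d = w c" and "Z \<subseteq> R"
    and dvd: "\<And>d. d < n \<Longrightarrow> agree S Z c d \<Longrightarrow> w c dvd class_size S n R d"
  shows "card {d. d < n \<and> keep S n R w d \<and> agree S Z c d} * w c = class_size S n Z c"
proof -
  let ?D = "{d. d < n \<and> agree S Z c d}"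
  have "card {e \<in> ?D. keep S n R w e} * w c = card ?D"
  proof (rule card_by_classes)
    fix d assume d: "d \<in> ?D"
    have Z: "agree S R d e \<Longrightarrow> agree S Z c e" for e
      using d \<open>Z \<subseteq> R\<close> agree_mono agree_trans by blast
    have wd: "w d = w c" using d w by simp
    have "card {e. e < n \<and> keep S n R w e \<and> agree S R d e} * w d = class_size S n R d"
      using d dvd wd w Z by (intro card_keep) auto
    moreover have "{e \<in> ?D. keep S n R w e \<and> agree S R d e} = {e. e < n \<and> keep S n R w e \<and> agree S R d e}"
      "{e \<in> ?D. agree S R d e} = {e. e < n \<and> agree S R d e}"
      using Z by auto
    ultimately show "card {e \<in> ?D. keep S n R w e \<and> agree S R d e} * w c = card {e \<in> ?D. agree S R d e}"
      using wd by simp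
  qed auto
  moreover have "{e \<in> ?D. keep S n R w e} = {d. d < n \<and> keep S n R w d \<and> agree S Z c d}" by auto
  ultimately show ?thesis by simp
qed

text \<open>Keeping one in \<open>v2\<close> of the columns leaves \<open>v1\<close> columns of each
  slice for the first factor, and symmetrically \<open>v2\<close> for the second. The equations for
  full patterns come from \<open>indep_rows_card\<close>. A slice with \<open>v2 c \<ge> 2\<close>
  loses a column in the first factor, and one with \<open>v1 c \<ge> 2\<close> in the second, which
  gives the bounds on the numbers of columns.\<close>

lemma splitsI:
  fixes k m n :: nat and X :: "nat \<Rightarrow> nat" and S :: "nat \<Rightarrow> nat \<Rightarrow> 'a::zero_neq_one"
  defines "Z \<equiv> X ` {..<k - 1}"
  assumes Z: "Z \<subseteq> {..<m}" and A: "A \<subseteq> {..<m} - Z" "A \<noteq> {}" "{..<m} - Z - A \<noteq> {}"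
    and mk: "\<forall>c<n. \<exists>j<k. marked k (\<lambda>t. S (X t) c) j" "\<forall>j<k. \<exists>c<n. marked k (\<lambda>t. S (X t) c) j"
    and ind: "\<And>x y. x \<in> A \<Longrightarrow> y \<in> {..<m} - Z - A \<Longrightarrow> indep_rows S m n Z x y"
    and cong: "\<And>c d. c < n \<Longrightarrow> d < n \<Longrightarrow> agree S Z c d \<Longrightarrow> v1 d = v1 c \<and> v2 d = v2 c"
    and v: "\<And>c. c < n \<Longrightarrow> v1 c * v2 c = class_size S n Z c"
    and d2: "\<And>c. c < n \<Longrightarrow> v2 c dvd class_size S n (A \<union> Z) c"
    and d1: "\<And>c. c < n \<Longrightarrow> v1 c dvd class_size S n ({..<m} - A) c"
    and big: "k \<ge> 2 \<Longrightarrow> \<exists>c<n. v1 c \<ge> 2" "k \<ge> 2 \<Longrightarrow> \<exists>c<n. v2 c \<ge> 2"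
  shows "splits k S m n X A (keep S n (A \<union> Z) v2) (keep S n ({..<m} - A) v1)"
proof -
  let ?K1 = "keep S n (A \<union> Z) v2" and ?K2 = "keep S n ({..<m} - A) v1"
  let ?B = "{..<m} - Z - A"
  have pos: "v1 c > 0" "v2 c > 0" if "c < n" for c
    using class_size_pos[OF that, of S Z] unfolding v[OF that, symmetric] by simp_all
  have ZA: "Z \<subseteq> {..<m} - A" "Z \<subseteq> A \<union> Z" using A Z by auto
  have cong1: "v1 d = v1 c" and cong2: "v2 d = v2 c" if "c < n" "d < n" "agree S Z c d" for c d
    using cong[OF that] by simp_all
  have s1: "card {d. d < n \<and> ?K1 d \<and> agree S Z c d} * v2 c = class_size S n Z c" if c: "c < n" for c
  proof (rule card_keep_coarse[OF c _ ZA(2)])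
    fix d assume d: "d < n" "agree S Z c d"
    show eq: "v2 d = v2 c" by (rule cong2[OF c d])
    show "v2 c dvd class_size S n (A \<union> Z) d" unfolding eq[symmetric] by (rule d2[OF d(1)])
  qed
  have s2: "card {d. d < n \<and> ?K2 d \<and> agree S Z c d} * v1 c = class_size S n Z c" if c: "c < n" for c
  proof (rule card_keep_coarse[OF c _ ZA(1)])
    fix d assume d: "d < n" "agree S Z c d"
    show eq: "v1 d = v1 c" by (rule cong1[OF c d])
    show "v1 c dvd class_size S n ({..<m} - A) d" unfolding eq[symmetric] by (rule d1[OF d(1)])
  qed
  have s1': "card {d. d < n \<and> ?K1 d \<and> agree S Z c d} = v1 c" if "c < n" for c
    using s1[OF that] pos(2)[OF that] unfolding v[OF that, symmetric] by simp
  have s2': "card {d. d < n \<and> ?K2 d \<and> agree S Z c d} = v2 c" if "c < n" for c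
    using s2[OF that] pos(1)[OF that] unfolding v[OF that, symmetric] by simp
  have 5: "class_size S n {..<m} c = card {d. d < n \<and> ?K1 d \<and> agree S (A \<union> Z) c d} *
      card {d. d < n \<and> ?K2 d \<and> agree S ({..<m} - A) c d}" if c: "c < n" for c
  proof -
    have k1: "card {d. d < n \<and> ?K1 d \<and> agree S (A \<union> Z) c d} * v2 c = class_size S n (A \<union> Z) c"
      using c by (intro card_keep cong2 d2) (auto intro: agree_mono[OF _ ZA(2)])
    have k2: "card {d. d < n \<and> ?K2 d \<and> agree S ({..<m} - A) c d} * v1 c = class_size S n ({..<m} - A) c"
      using c by (intro card_keep cong1 d1) (auto intro: agree_mono[OF _ ZA(1)])
    have "card {d. d < n \<and> agree S (Z \<union> A) c d \<and> agree S (Z \<union> ?B) c d} * class_size S n Z c =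
        class_size S n (Z \<union> A) c * class_size S n (Z \<union> ?B) c"
      by (rule indep_rows_card[where m = m, OF ind]) (use A Z c in auto)
    moreover have "Z \<union> A = A \<union> Z" "Z \<union> ?B = {..<m} - A" using A Z by auto
    moreover have "agree S (A \<union> Z) c d \<and> agree S ({..<m} - A) c d \<longleftrightarrow> agree S {..<m} c d" for d
    proof -
      have "A \<union> Z \<union> ({..<m} - A) = {..<m}" using A Z by auto
      then show ?thesis unfolding agree_Un[symmetric] by simp
    qed
    \<comment> \<open>The independence identity, with the slice size written as
      \<open>v1 c * v2 c\<close>. The same factor comes out of the two kept counts on the right and
      is cancelled.\<close>
    ultimately have "class_size S n {..<m} c * (v1 c * v2 c) =
        class_size S n (A \<union> Z) c * class_size S n ({..<m} - A) c"
      by (simp add: v[OF c])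
    also have "\<dots> = (card {d. d < n \<and> ?K1 d \<and> agree S (A \<union> Z) c d} *
      card {d. d < n \<and> ?K2 d \<and> agree S ({..<m} - A) c d}) * (v1 c * v2 c)"
      unfolding k1[symmetric] k2[symmetric] by (simp add: mult_ac)
    finally show ?thesis using pos[OF c] by simp
  qed
  have 6: "class_size S n Z c = card {d. d < n \<and> ?K1 d \<and> agree S Z c d} * card {d. d < n \<and> ?K2 d \<and> agree S Z c d}"
    if "c < n" for c
    using s1'[OF that] s2'[OF that] v[OF that] by simp
  have less: "card {d. d < n \<and> K d} < n"
    if c: "c < n" and K: "card {d. d < n \<and> K d \<and> agree S Z c d} < class_size S n Z c" for K c
  proof -
    have "\<exists>d<n. \<not> K d"
    proof (rule ccontr)
      assume "\<not> (\<exists>d<n. \<not> K d)"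
      then have "d < n \<and> K d \<and> agree S Z c d \<longleftrightarrow> d < n \<and> agree S Z c d" for d by auto
      with K show False by simp
    qed
    then obtain d where "d < n" "\<not> K d" by auto
    then have "{d. d < n \<and> K d} \<subset> {..<n}" by auto
    from psubset_card_mono[OF _ this] show ?thesis by simp
  qed
  have 7: "card {d. d < n \<and> ?K1 d} < n" if k: "k \<ge> 2"
  proof -
    obtain c where c: "c < n" "v2 c \<ge> 2" using big(2)[OF k] by blast
    have "v1 c * 1 < v1 c * v2 c" using c(2) pos(1)[OF c(1)] by simp
    then show ?thesis by (intro less[OF c(1)]) (simp only: s1'[OF c(1)] v[OF c(1)] mult_1_right)
  qed
  have 8: "card {d. d < n \<and> ?K2 d} < n" if k: "k \<ge> 2"
  proof -
    obtain c where c: "c < n" "v1 c \<ge> 2" using big(1)[OF k] by blast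
    have "1 * v2 c < v1 c * v2 c" using c(2) pos(2)[OF c(1)] by simp
    then show ?thesis by (intro less[OF c(1)]) (simp only: s2'[OF c(1)] v[OF c(1)] mult_1)
  qed
  show ?thesis
    unfolding splits_def Z_def[symmetric]
    by (intro conjI allI impI; (rule Z A 5 6 7 8 mk[rule_format]; assumption))
qed

section \<open>Completeness: blocks of dependent rows and column multiplicities\<close>

text \<open>The rows that can be reached from \<open>r\<close> through dependent pairs, as the least
  set containing \<open>r\<close> that no dependent pair leaves. For an admissible \<open>r\<close>
  the set of all non-special rows is a member of the family; for a special or out-of-range
  \<open>r\<close> the family is empty and its intersection is everything, so such guesses are
  excluded separately.\<close>

definition row_block :: "(nat \<Rightarrow> nat \<Rightarrow> 'a) \<Rightarrow> nat \<Rightarrow> nat \<Rightarrow> nat set \<Rightarrow> nat \<Rightarrow> nat set" where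
  "row_block S m n Z r = \<Inter> {A. r \<in> A \<and> A \<subseteq> {..<m} - Z \<and>
     (\<forall>x\<in>A. \<forall>y\<in>{..<m} - Z - A. indep_rows S m n Z x y)}"

lemma row_block_least:
  assumes "r \<in> A" "A \<subseteq> {..<m} - Z" "\<And>x y. x \<in> A \<Longrightarrow> y \<in> {..<m} - Z - A \<Longrightarrow> indep_rows S m n Z x y"
  shows "row_block S m n Z r \<subseteq> A"
  unfolding row_block_def using assms by (intro Inter_lower) auto

text \<open>A row outside the intersection is missed by some closed set, and this set contains
  x.\<close>

lemma row_block_closed:
  assumes "x \<in> row_block S m n Z r" "y \<in> {..<m} - Z - row_block S m n Z r"
  shows "indep_rows S m n Z x y"
  using assms unfolding row_block_def by auto

lemma row_block_self: "r \<in> row_block S m n Z r"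
  unfolding row_block_def by auto

lemma two_classes_le:
  assumes "agree S Z c d" "\<not> agree S R c d" "Z \<subseteq> R"
  shows "class_size S n R c + class_size S n R d \<le> class_size S n Z c"
proof -
  have "{e. e < n \<and> agree S R c e} \<inter> {e. e < n \<and> agree S R d e} = {}"
    using assms(2) agree_trans agree_sym by blast
  then have "class_size S n R c + class_size S n R d =
      card ({e. e < n \<and> agree S R c e} \<union> {e. e < n \<and> agree S R d e})"
    by (intro card_Un_disjoint[symmetric]) auto
  also have "\<dots> \<le> class_size S n Z c"
  proof (rule card_mono)
    show "{e. e < n \<and> agree S R c e} \<union> {e. e < n \<and> agree S R d e} \<subseteq> {e. e < n \<and> agree S Z c e}"
      using agree_mono[OF _ \<open>Z \<subseteq> R\<close>] agree_trans[OF assms(1)] by blast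
  qed simp
  finally show ?thesis .
qed

text \<open>If the rows \<open>R\<close> separate two columns of a slice, the slice contains two
  disjoint classes, each with at least u columns because u divides their sizes. Hence
  \<open>v * u\<close> is at least \<open>2 * u\<close>.\<close>

lemma two_le_of_classes:
  assumes "agree S Z c d" "\<not> agree S R c d" "Z \<subseteq> R" "c < n" "d < n"
    and "v * u = class_size S n Z c" "u dvd class_size S n R c" "u dvd class_size S n R d"
  shows "v \<ge> (2::nat)"
proof -
  have "u \<le> class_size S n R c" "u \<le> class_size S n R d"
    using assms(4-) by (auto intro!: dvd_imp_le class_size_pos)
  then have "2 * u \<le> v * u" using two_classes_le[OF assms(1-3), of n] assms(6) by linarith
  moreover have "0 < v * u" unfolding assms(6) using assms(4) by (rule class_size_pos)
  ultimately show ?thesis by simp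
qed

text \<open>\<open>v2\<close> is the largest number that divides all pattern counts on
  \<open>A\<close> in the slice, hence also their sum, the size of the slice. By independence the
  size of the slice divides the count on the complement of \<open>A\<close> times every pattern
  count on \<open>A\<close>, hence times their gcd \<open>v2\<close>; cancelling \<open>v2\<close>
  shows that \<open>v1\<close> divides the count on the complement.\<close>

lemma gcd_weights:
  fixes S :: "nat \<Rightarrow> nat \<Rightarrow> 'a"
  assumes Z: "Z \<subseteq> {..<m}" and A: "A \<subseteq> {..<m} - Z"
    and ind: "\<And>x y. x \<in> A \<Longrightarrow> y \<in> {..<m} - Z - A \<Longrightarrow> indep_rows S m n Z x y"
  defines "v2 \<equiv> \<lambda>c. Gcd (class_size S n (A \<union> Z) ` {d. d < n \<and> agree S Z c d})"
  defines "v1 \<equiv> \<lambda>c. class_size S n Z c div v2 c"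
  shows "\<And>c d. agree S Z c d \<Longrightarrow> v1 d = v1 c \<and> v2 d = v2 c"
    and "\<And>c. c < n \<Longrightarrow> v1 c * v2 c = class_size S n Z c"
    and "\<And>c. c < n \<Longrightarrow> v2 c dvd class_size S n (A \<union> Z) c"
    and "\<And>c. c < n \<Longrightarrow> v1 c dvd class_size S n ({..<m} - A) c"
proof -
  show "v1 d = v1 c \<and> v2 d = v2 c" if "agree S Z c d" for c d
  proof -
    have "agree S Z c e \<longleftrightarrow> agree S Z d e" for e using that agree_sym agree_trans by blast
    then show ?thesis by (simp add: v1_def v2_def)
  qed
  show d2: "v2 c dvd class_size S n (A \<union> Z) c" if "c < n" for c
    unfolding v2_def using that by (intro Gcd_dvd) auto
  have dvd: "v2 c dvd class_size S n Z c" if "c < n" for c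
  proof (rule dvd_card_by_classes[where R = "A \<union> Z"])
    fix d assume d: "d \<in> {d. d < n \<and> agree S Z c d}"
    have "{e \<in> {d. d < n \<and> agree S Z c d}. agree S (A \<union> Z) d e} = {e. e < n \<and> agree S (A \<union> Z) d e}"
      using d agree_trans[of S Z c d] by (auto simp: agree_Un)
    moreover have "v2 c dvd class_size S n (A \<union> Z) d"
      unfolding v2_def using d by (intro Gcd_dvd) auto
    ultimately show "v2 c dvd card {e \<in> {d. d < n \<and> agree S Z c d}. agree S (A \<union> Z) d e}" by simp
  qed simp
  show v: "v1 c * v2 c = class_size S n Z c" if "c < n" for c
    unfolding v1_def using dvd[OF that] by simp
  show "v1 c dvd class_size S n ({..<m} - A) c" if c: "c < n" for c
  proof -
    have "class_size S n Z c dvd class_size S n ({..<m} - A) c * v2 c"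
    proof -
      have "class_size S n Z c dvd class_size S n ({..<m} - A) c * class_size S n (A \<union> Z) d"
        if d: "d < n" "agree S Z c d" for d
      proof -
        let ?x = "card {e. e < n \<and> agree S (Z \<union> A) d e \<and> agree S (Z \<union> ({..<m} - Z - A)) c e}"
        have "?x * class_size S n Z d =
            class_size S n (Z \<union> A) d * class_size S n (Z \<union> ({..<m} - Z - A)) c"
          by (rule indep_rows_card[where m = m, OF ind]) (use A Z c d agree_sym[OF d(2)] in auto)
        moreover have "Z \<union> A = A \<union> Z" "Z \<union> ({..<m} - Z - A) = {..<m} - A" using A Z by auto
        ultimately have "class_size S n ({..<m} - A) c * class_size S n (A \<union> Z) d = ?x * class_size S n Z c"
          unfolding class_size_cong[OF d(2)] by (simp only: mult.commute)
        then show ?thesis by simp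
      qed
      then have "class_size S n Z c dvd
          Gcd ((*) (class_size S n ({..<m} - A) c) ` class_size S n (A \<union> Z) ` {d. d < n \<and> agree S Z c d})"
        by (intro Gcd_greatest) auto
      then show ?thesis by (simp add: Gcd_mult v2_def)
    qed
    moreover have "0 < v1 c * v2 c" unfolding v[OF c] using c by (rule class_size_pos)
    ultimately show ?thesis unfolding v[OF c, symmetric] by simp
  qed
qed

text \<open>Column coordinates of a product: \<open>\<alpha> c\<close> and \<open>\<beta> c\<close> are the columns of the factors that
  make up column \<open>c\<close>.\<close>

definition factored ::
  "(nat \<Rightarrow> nat \<Rightarrow> 'a) \<Rightarrow> nat \<Rightarrow> nat \<Rightarrow> nat set \<Rightarrow> nat set \<Rightarrow> nat set \<Rightarrow> (nat \<Rightarrow> nat) \<Rightarrow> (nat \<Rightarrow> nat) \<Rightarrow> bool" where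
  "factored S m n Z A B \<alpha> \<beta> \<longleftrightarrow>
     Z \<subseteq> {..<m} \<and> A \<union> B = {..<m} - Z \<and> A \<inter> B = {} \<and>
     (\<forall>c<n. \<forall>d<n. \<alpha> c = \<alpha> d \<longrightarrow> agree S (A \<union> Z) c d) \<and>
     (\<forall>c<n. \<forall>d<n. \<beta> c = \<beta> d \<longrightarrow> agree S (B \<union> Z) c d) \<and>
     (\<forall>c<n. \<forall>d<n. agree S Z c d \<longrightarrow> (\<exists>e<n. \<alpha> e = \<alpha> c \<and> \<beta> e = \<beta> d)) \<and>
     (\<forall>c<n. \<forall>d<n. \<alpha> c = \<alpha> d \<longrightarrow> \<beta> c = \<beta> d \<longrightarrow> c = d)"

lemma factored_swap:
  assumes "factored S m n Z A B \<alpha> \<beta>"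
  shows "factored S m n Z B A \<beta> \<alpha>"
proof -
  have "\<exists>e<n. \<beta> e = \<beta> c \<and> \<alpha> e = \<alpha> d" if "c < n" "d < n" "agree S Z c d" for c d
  proof -
    have "\<exists>e<n. \<alpha> e = \<alpha> d \<and> \<beta> e = \<beta> c"
      using assms that(1,2) agree_sym[OF that(3)] unfolding factored_def by blast
    then show ?thesis by blast
  qed
  then show ?thesis using assms unfolding factored_def by (simp add: Un_commute Int_commute)
qed

text \<open>Given two columns of one slice, the columns with exchanged second coordinates exist as
  well. This exchange keeps the entries in \<open>A\<close> and \<open>Z\<close> and swaps those in
  \<open>B\<close>, so it keeps row x, swaps row y and preserves unordered pairs elsewhere. It is an
  involution, since columns are determined by their coordinates.\<close>

lemma factored_indep:
  assumes F: "factored S m n Z A B \<alpha> \<beta>" and x: "x \<in> A" and y: "y \<in> B"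
  shows "indep_rows S m n Z x y"
  unfolding indep_rows_def
proof (intro allI impI)
  fix c c' assume c: "c < n" "c' < n" "agree S Z c c'"
  have Z: "Z \<subseteq> {..<m}" "A \<union> B = {..<m} - Z" "A \<inter> B = {}"
    and al: "\<And>c d. c < n \<Longrightarrow> d < n \<Longrightarrow> \<alpha> c = \<alpha> d \<Longrightarrow> agree S (A \<union> Z) c d"
    and be: "\<And>c d. c < n \<Longrightarrow> d < n \<Longrightarrow> \<beta> c = \<beta> d \<Longrightarrow> agree S (B \<union> Z) c d"
    and ex: "\<And>c d. c < n \<Longrightarrow> d < n \<Longrightarrow> agree S Z c d \<Longrightarrow> \<exists>e<n. \<alpha> e = \<alpha> c \<and> \<beta> e = \<beta> d"
    and inj: "\<And>c d. c < n \<Longrightarrow> d < n \<Longrightarrow> \<alpha> c = \<alpha> d \<Longrightarrow> \<beta> c = \<beta> d \<Longrightarrow> c = d"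
    using F unfolding factored_def by blast+
  define mix where "mix c d = (SOME e. e < n \<and> \<alpha> e = \<alpha> c \<and> \<beta> e = \<beta> d)" for c d
  have mix: "mix d e < n" "\<alpha> (mix d e) = \<alpha> d" "\<beta> (mix d e) = \<beta> e" if "d < n" "e < n" "agree S Z d e" for d e
    using someI_ex[OF ex[OF that]] unfolding mix_def by auto
  define f where "f = (\<lambda>(d, d'). (mix d d', mix d' d))"
  define E where "E e e' = {(d, d'). d < n \<and> d' < n \<and> pair_match S m x y c c' e e' d d'}" for e e'
  have sl: "agree S Z d d'" if "(d, d') \<in> E e e'" for d d' e e'
    unfolding agree_def
  proof
    fix i assume i: "i \<in> Z"
    then have "i < m" "i \<noteq> x" "i \<noteq> y" using Z x y by auto
    moreover have "S i c = S i c'" using c(3) i by (simp add: agree_def)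
    ultimately show "S i d = S i d'" using that by (auto simp: E_def pair_match_def)
  qed
  have fE: "f p \<in> E e' e" "f (f p) = p" if p: "p \<in> E e e'" for p e e'
  proof -
    obtain d d' where [simp]: "p = (d, d')" by (cases p)
    have d: "d < n" "d' < n" and pm: "pair_match S m x y c c' e e' d d'" using p by (auto simp: E_def)
    have ag: "agree S Z d d'" "agree S Z d' d" using sl[of d d'] p agree_sym[OF sl[of d d']] by simp_all
    have m1: "mix d d' < n" "\<alpha> (mix d d') = \<alpha> d" "\<beta> (mix d d') = \<beta> d'"
      using mix[OF d(1) d(2) ag(1)] by auto
    have m2: "mix d' d < n" "\<alpha> (mix d' d) = \<alpha> d'" "\<beta> (mix d' d) = \<beta> d"
      using mix[OF d(2) d(1) ag(2)] by auto
    have SA: "S i (mix d d') = S i d" "S i (mix d' d) = S i d'" if "i \<in> A" for i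
      using al[OF m1(1) d(1) m1(2)] al[OF m2(1) d(2) m2(2)] that by (auto simp: agree_def)
    have SB: "S i (mix d d') = S i d'" "S i (mix d' d) = S i d" if "i \<in> B" for i
      using be[OF m1(1) d(2) m1(3)] be[OF m2(1) d(1) m2(3)] that by (auto simp: agree_def)
    have SZ: "S i (mix d d') = S i d" "S i (mix d' d) = S i d'" if "i \<in> Z" for i
      using al[OF m1(1) d(1) m1(2)] al[OF m2(1) d(2) m2(2)] that by (auto simp: agree_def)
    have rows: "i \<in> A \<or> i \<in> B \<or> i \<in> Z" if "i < m" for i using that Z by blast
    have "pair_match S m x y c c' e' e (mix d d') (mix d' d)"
      unfolding pair_match_def
    proof (intro conjI allI impI)
      fix i assume "i < m" "i \<noteq> x" "i \<noteq> y"
      then have "S i d = S i c \<and> S i d' = S i c' \<or> S i d = S i c' \<and> S i d' = S i c"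
        using pm by (simp add: pair_match_def)
      then show "S i (mix d d') = S i c \<and> S i (mix d' d) = S i c' \<or> S i (mix d d') = S i c' \<and> S i (mix d' d) = S i c"
        using rows[OF \<open>i < m\<close>] SA[of i] SB[of i] SZ[of i] by auto
    qed (use pm SA[OF x] SB[OF y] in \<open>auto simp: pair_match_def\<close>)
    then show "f p \<in> E e' e" using m1 m2 by (simp add: E_def f_def)
    have "agree S Z (mix d d') (mix d' d)" using SZ ag(1) by (simp add: agree_def)
    from mix[OF m1(1) m2(1) this] mix[OF m2(1) m1(1) agree_sym[OF this]]
    have "mix (mix d d') (mix d' d) = d" "mix (mix d' d) (mix d d') = d'"
      using m1 m2 d by (auto intro!: inj)
    then show "f (f p) = p" by (simp add: f_def)
  qed
  have "bij_betw f (E c c') (E c' c)"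
    by (rule bij_betw_byWitness[where f' = f]) (use fE in auto)
  then show "card {(d, d'). d < n \<and> d' < n \<and> pair_match S m x y c c' c c' d d'} =
     card {(d, d'). d < n \<and> d' < n \<and> pair_match S m x y c c' c' c d d'}"
    unfolding E_def by (rule bij_betw_same_card)
qed

text \<open>If the rows in \<open>A\<close> are constant on every slice, the sizes of the given factors fit any choice of
  some of these rows for the first factor.\<close>

lemma factored_constant:
  assumes F: "factored S m n Z A B \<alpha> \<beta>"
    and const: "\<And>c d. c < n \<Longrightarrow> d < n \<Longrightarrow> agree S Z c d \<Longrightarrow> agree S A c d" and A0: "A0 \<subseteq> A"
  defines "N \<equiv> \<lambda>\<gamma> c. card (\<gamma> ` {d. d < n \<and> agree S Z c d})"
  assumes c: "c < n"
  shows "N \<alpha> c * N \<beta> c = class_size S n Z c" "N \<beta> c dvd class_size S n (A0 \<union> Z) c"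
    "N \<alpha> c dvd class_size S n ({..<m} - A0) c"
proof -
  have Z: "Z \<subseteq> {..<m}" "A \<union> B = {..<m} - Z" "A \<inter> B = {}"
    and al: "\<And>c d. c < n \<Longrightarrow> d < n \<Longrightarrow> \<alpha> c = \<alpha> d \<Longrightarrow> agree S (A \<union> Z) c d"
    and be: "\<And>c d. c < n \<Longrightarrow> d < n \<Longrightarrow> \<beta> c = \<beta> d \<Longrightarrow> agree S (B \<union> Z) c d"
    and ex: "\<And>c d. c < n \<Longrightarrow> d < n \<Longrightarrow> agree S Z c d \<Longrightarrow> \<exists>e<n. \<alpha> e = \<alpha> c \<and> \<beta> e = \<beta> d"
    and inj: "\<And>c d. c < n \<Longrightarrow> d < n \<Longrightarrow> \<alpha> c = \<alpha> d \<Longrightarrow> \<beta> c = \<beta> d \<Longrightarrow> c = d"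
    using F unfolding factored_def by blast+
  define C where "C = {d. d < n \<and> agree S Z c d}"
  \<comment> \<open>Inside a slice, columns correspond to all combinations of an \<alpha>-coordinate
    and a \<beta>-coordinate.\<close>
  have prod: "card {d \<in> C. \<beta> d \<in> T} = N \<alpha> c * card T" if T: "T \<subseteq> \<beta> ` C" for T
  proof -
    have "bij_betw (\<lambda>d. (\<alpha> d, \<beta> d)) {d \<in> C. \<beta> d \<in> T} (\<alpha> ` C \<times> T)"
      unfolding bij_betw_def
    proof (intro conjI equalityI subsetI)
      show "inj_on (\<lambda>d. (\<alpha> d, \<beta> d)) {d \<in> C. \<beta> d \<in> T}"
        by (auto simp: inj_on_def C_def intro!: inj)
      fix p assume "p \<in> \<alpha> ` C \<times> T"
      then obtain d d' where p: "p = (\<alpha> d, \<beta> d')" "d \<in> C" "d' \<in> C" "\<beta> d' \<in> T" using T by blast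
      then have dn: "d < n" "d' < n" "agree S Z c d" "agree S Z c d'" by (auto simp: C_def)
      have "agree S Z d d'" using agree_trans[OF agree_sym[OF dn(3)] dn(4)] .
      from ex[OF dn(1,2) this] obtain e where e: "e < n" "\<alpha> e = \<alpha> d" "\<beta> e = \<beta> d'" by blast
      have "agree S Z d e" using al[OF dn(1) e(1) e(2)[symmetric]] by (simp add: agree_Un)
      then have "e \<in> C" using e(1) agree_trans[OF dn(3)] by (simp add: C_def)
      then show "p \<in> (\<lambda>d. (\<alpha> d, \<beta> d)) ` {d \<in> C. \<beta> d \<in> T}"
        using p e by (intro image_eqI[of _ _ e]) auto
    qed auto
    then have "card {d \<in> C. \<beta> d \<in> T} = card (\<alpha> ` C \<times> T)" by (rule bij_betw_same_card)
    then show ?thesis by (simp add: card_cartesian_product N_def C_def)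
  qed
  have "{d \<in> C. \<beta> d \<in> \<beta> ` C} = C" by auto
  then show 1: "N \<alpha> c * N \<beta> c = class_size S n Z c"
    using prod[OF subset_refl] by (simp add: N_def C_def)
  have A0c: "agree S A0 c d" if "d \<in> C" for d
    using that const[OF c, of d] agree_mono[OF _ A0] by (simp add: C_def)
  then have "{d. d < n \<and> agree S (A0 \<union> Z) c d} = C" by (auto simp: C_def agree_Un)
  then show "N \<beta> c dvd class_size S n (A0 \<union> Z) c"
    unfolding C_def by (simp flip: 1)
  \<comment> \<open>The \<beta>-coordinates of the columns that look like \<open>c\<close> on
    \<open>B\<close>. The pattern on \<open>B\<close> depends on the \<beta>-coordinate only, so
    this class of columns is the full preimage of \<open>T\<close> in the slice.\<close>
  define T where "T = \<beta> ` {d \<in> C. agree S B c d}"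
  have "agree S ({..<m} - A0) c d \<longleftrightarrow> agree S Z c d \<and> agree S B c d" if "d < n" for d
  proof -
    have "{..<m} - A0 = Z \<union> B \<union> (A - A0)" using Z A0 by auto
    then show ?thesis
      using const[OF c that] agree_mono[of S A c d "A - A0"] by (auto simp: agree_Un)
  qed
  then have "{d. d < n \<and> agree S ({..<m} - A0) c d} = {d \<in> C. agree S B c d}"
    by (auto simp: C_def)
  also have "\<dots> = {d \<in> C. \<beta> d \<in> T}"
  proof (intro equalityI subsetI)
    fix d assume "d \<in> {d \<in> C. \<beta> d \<in> T}"
    then obtain e where e: "d \<in> C" "e \<in> C" "agree S B c e" "\<beta> d = \<beta> e" by (auto simp: T_def)
    then have "agree S (B \<union> Z) e d" by (intro be) (auto simp: C_def)
    then show "d \<in> {d \<in> C. agree S B c d}" using e agree_trans by (auto simp: agree_Un)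
  qed (auto simp: T_def)
  finally show "N \<alpha> c dvd class_size S n ({..<m} - A0) c"
    using prod[of T] by (simp add: T_def image_mono)
qed

text \<open>The row \<open>r\<close> is chosen such that suitable sizes exist for its block and both
  are at least 2 somewhere when \<open>k \<ge> 2\<close>. If the rows of \<open>A\<close> are
  constant on every slice, any \<open>r\<close> in \<open>A\<close> works with the numbers of
  coordinates of the given factorisation; if those of \<open>B\<close> are, the roles of the factors
  are exchanged. Otherwise \<open>r\<close> is a non-constant row of \<open>A\<close> and the gcd
  weights are taken: the non-constant row in the block forces \<open>v1\<close> to be at least 2,
  and a non-constant row of \<open>B\<close>, which lies outside the block, does so for
  \<open>v2\<close>.\<close>

lemma factored_weights:
  assumes F: "factored S m n Z A B \<alpha> \<beta>" and ne: "A \<noteq> {}" "B \<noteq> {}"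
    and big: "k \<ge> 2 \<Longrightarrow> \<exists>c<n. \<exists>d<n. agree S Z c d \<and> \<alpha> c \<noteq> \<alpha> d"
      "k \<ge> 2 \<Longrightarrow> \<exists>c<n. \<exists>d<n. agree S Z c d \<and> \<beta> c \<noteq> \<beta> d"
  obtains r A0 v1 v2 where "r \<in> {..<m} - Z" "A0 = row_block S m n Z r" "A0 \<subseteq> {..<m} - Z" "{..<m} - Z - A0 \<noteq> {}"
    "\<And>c d. agree S Z c d \<Longrightarrow> v1 d = v1 c \<and> v2 d = v2 c"
    "\<And>c. c < n \<Longrightarrow> v1 c * v2 c = class_size S n Z c"
    "\<And>c. c < n \<Longrightarrow> v2 c dvd class_size S n (A0 \<union> Z) c"
    "\<And>c. c < n \<Longrightarrow> v1 c dvd class_size S n ({..<m} - A0) c"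
    "k \<ge> 2 \<Longrightarrow> \<exists>c<n. v1 c \<ge> 2" "k \<ge> 2 \<Longrightarrow> \<exists>c<n. v2 c \<ge> (2::nat)"
proof -
  have block: "row_block S m n Z r \<subseteq> A" "row_block S m n Z r \<subseteq> {..<m} - Z"
      "{..<m} - Z - row_block S m n Z r \<noteq> {}" "B \<subseteq> {..<m} - Z - row_block S m n Z r" "r \<in> {..<m} - Z"
    if F: "factored S m n Z A B \<alpha> \<beta>" and r: "r \<in> A" and "B \<noteq> {}" for A B r \<alpha> \<beta>
  proof -
    have AB: "A \<union> B = {..<m} - Z" "A \<inter> B = {}" using F unfolding factored_def by blast+
    then have B: "B = {..<m} - Z - A" by blast
    show sub: "row_block S m n Z r \<subseteq> A"
    proof (rule row_block_least[OF r])
      show "A \<subseteq> {..<m} - Z" using AB by blast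
      fix x y assume "x \<in> A" "y \<in> {..<m} - Z - A"
      then show "indep_rows S m n Z x y" unfolding B[symmetric] by (rule factored_indep[OF F])
    qed
    show "row_block S m n Z r \<subseteq> {..<m} - Z" "r \<in> {..<m} - Z" using sub AB r by blast+
    show sB: "B \<subseteq> {..<m} - Z - row_block S m n Z r" using sub AB by blast
    show "{..<m} - Z - row_block S m n Z r \<noteq> {}" using sB \<open>B \<noteq> {}\<close> by blast
  qed
  define N where "N \<gamma> c = card (\<gamma> ` {d. d < n \<and> agree S Z c d})" for \<gamma> :: "nat \<Rightarrow> nat" and c
  have Ncong: "N \<gamma> d = N \<gamma> c" if "agree S Z c d" for c d \<gamma>
  proof -
    have "agree S Z c e \<longleftrightarrow> agree S Z d e" for e using that agree_sym agree_trans by blast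
    then show ?thesis by (simp add: N_def)
  qed
  have Nbig: "\<exists>c<n. N \<gamma> c \<ge> 2" if ex: "\<exists>c<n. \<exists>d<n. agree S Z c d \<and> \<gamma> c \<noteq> \<gamma> d" for \<gamma>
  proof -
    obtain c d where cd: "c < n" "d < n" "agree S Z c d" "\<gamma> c \<noteq> \<gamma> d" using ex by blast
    then have "card {\<gamma> c, \<gamma> d} \<le> N \<gamma> c" unfolding N_def by (intro card_mono) auto
    with cd show ?thesis by auto
  qed
  consider (constA) "\<forall>c<n. \<forall>d<n. agree S Z c d \<longrightarrow> agree S A c d"
    | (constB) "\<forall>c<n. \<forall>d<n. agree S Z c d \<longrightarrow> agree S B c d"
    | (non) c d c' d' where "c < n" "d < n" "agree S Z c d" "\<not> agree S A c d"
        "c' < n" "d' < n" "agree S Z c' d'" "\<not> agree S B c' d'"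
    by blast
  then show thesis
  proof cases
    case constA
    obtain r where r: "r \<in> A" using ne by blast
    note b = block[OF F r ne(2)]
    note c = factored_constant[OF F constA[rule_format] b(1), folded N_def]
    show thesis
      by (rule that[OF b(5) refl b(2,3), of "N \<alpha>" "N \<beta>"]) (use Ncong c Nbig big in auto)
  next
    case constB
    obtain r where r: "r \<in> B" using ne by blast
    note F' = factored_swap[OF F]
    note b = block[OF F' r ne(1)]
    note c = factored_constant[OF F' constB[rule_format] b(1), folded N_def]
    show thesis
      by (rule that[OF b(5) refl b(2,3), of "N \<beta>" "N \<alpha>"]) (use Ncong c Nbig big in auto)
  next
    case non
    obtain x where x: "x \<in> A" "S x c \<noteq> S x d" using non(4) by (auto simp: agree_def)
    obtain y where y: "y \<in> B" "S y c' \<noteq> S y d'" using non(8) by (auto simp: agree_def)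
    note b = block[OF F x(1) ne(2)]
    have Z: "Z \<subseteq> {..<m}" using F by (simp add: factored_def)
    let ?A0 = "row_block S m n Z x"
    define v2 where "v2 c = Gcd (class_size S n (?A0 \<union> Z) ` {d. d < n \<and> agree S Z c d})" for c
    define v1 where "v1 c = class_size S n Z c div v2 c" for c
    have g1: "v1 d = v1 c \<and> v2 d = v2 c" if "agree S Z c d" for c d
      unfolding v1_def v2_def by (rule gcd_weights(1)[OF Z b(2) row_block_closed that])
    have g2: "v1 c * v2 c = class_size S n Z c" if "c < n" for c
      unfolding v1_def v2_def by (rule gcd_weights(2)[OF Z b(2) row_block_closed that])
    have g3: "v2 c dvd class_size S n (?A0 \<union> Z) c" if "c < n" for c
      unfolding v2_def by (rule gcd_weights(3)[OF Z b(2) row_block_closed that])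
    have g4: "v1 c dvd class_size S n ({..<m} - ?A0) c" if "c < n" for c
      unfolding v1_def v2_def by (rule gcd_weights(4)[OF Z b(2) row_block_closed that])
    have "v1 c \<ge> 2"
    proof (rule two_le_of_classes[OF non(3) _ _ non(1,2)])
      show "\<not> agree S (?A0 \<union> Z) c d" using x row_block_self[of x S m n Z] by (auto simp: agree_def)
      show "v1 c * v2 c = class_size S n Z c" by (rule g2[OF non(1)])
      show "v2 c dvd class_size S n (?A0 \<union> Z) c" by (rule g3[OF non(1)])
      show "v2 c dvd class_size S n (?A0 \<union> Z) d" using g3[OF non(2)] g1[OF non(3)] by simp
    qed simp
    moreover have "v2 c' \<ge> 2"
    proof (rule two_le_of_classes[OF non(7) _ _ non(5,6)])
      show "\<not> agree S ({..<m} - ?A0) c' d'" using y b(4) by (auto simp: agree_def)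
      show "Z \<subseteq> {..<m} - ?A0" using Z b(2) by blast
      show "v2 c' * v1 c' = class_size S n Z c'" using g2[OF non(5)] by (simp add: mult.commute)
      show "v1 c' dvd class_size S n ({..<m} - ?A0) c'" by (rule g4[OF non(5)])
      show "v1 c' dvd class_size S n ({..<m} - ?A0) d'" using g4[OF non(6)] g1[OF non(7)] by simp
    qed
    ultimately show thesis
      using non by (intro that[OF b(5) refl b(2,3), of v1 v2] g1 g2 g3 g4) auto
  qed
qed

section \<open>Guesses of 3k bounded numbers\<close>

lemma special_rows_ex_col:
  "special_rows k T xs \<Longrightarrow> j < k \<Longrightarrow> \<exists>c<dim_col T. marked k (\<lambda>t. T $$ (xs ! t, c)) j"
  unfolding special_rows_iff by (elim conjE) (erule allE, erule mp)

lemma special_rows_ex_marked: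
  "special_rows k T xs \<Longrightarrow> c < dim_col T \<Longrightarrow> \<exists>j<k. marked k (\<lambda>t. T $$ (xs ! t, c)) j"
  unfolding special_rows_iff by (elim conjE) (erule allE, erule mp)

lemma special_rows_distinct:
  assumes "special_rows k T xs"
  shows "distinct xs"
proof -
  have "xs ! s \<noteq> xs ! t" if "s < k - 1" "t < k - 1" "s \<noteq> t" for s t
  proof -
    have "Suc s < k" using that(1) by simp
    then obtain c where c: "marked k (\<lambda>t. T $$ (xs ! t, c)) (Suc s)"
      using assms unfolding special_rows_iff by blast
    then have "T $$ (xs ! s, c) = 1" "T $$ (xs ! t, c) = 0"
      using that by (simp_all add: marked_def)
    then show ?thesis by auto
  qed
  then show ?thesis using assms by (auto simp: special_rows_iff distinct_conv_nth)
qed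

text \<open>The guessed number for the slice of column \<open>c\<close>. It is written as a sum with
  a single relevant index because programs below compute with bounded sums.\<close>

definition weight :: "nat \<Rightarrow> (nat \<Rightarrow> nat \<Rightarrow> 'a::zero_neq_one) \<Rightarrow> (nat \<Rightarrow> nat) \<Rightarrow> nat \<Rightarrow> nat \<Rightarrow> nat" where
  "weight k S X off c = (\<Sum>j<k. if marked k (\<lambda>t. S (X t) c) j then X (off + j) else 0)"

text \<open>The guess \<open>X\<close> lists the special rows, the sizes of the slices of the two factors, and a row that
  belongs to the first factor.\<close>

definition guess_ok :: "nat \<Rightarrow> (nat \<Rightarrow> nat \<Rightarrow> 'a::zero_neq_one) \<Rightarrow> nat \<Rightarrow> nat \<Rightarrow> (nat \<Rightarrow> nat) \<Rightarrow> bool" where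
  "guess_ok k S m n X \<longleftrightarrow> X (3 * k - 1) < m \<and> X (3 * k - 1) \<notin> X ` {..<k - 1} \<and>
     (let A = row_block S m n (X ` {..<k - 1}) (X (3 * k - 1)) in
      splits k S m n X A (keep S n (A \<union> X ` {..<k - 1}) (weight k S X (2 * k - 1)))
        (keep S n ({..<m} - A) (weight k S X (k - 1))))"

lemma factored_imp_guess_ok:
  fixes S :: "nat \<Rightarrow> nat \<Rightarrow> 'a::zero_neq_one"
  assumes k: "k \<ge> 1" and F: "factored S m n (X0 ` {..<k - 1}) A B \<alpha> \<beta>" and ne: "A \<noteq> {}" "B \<noteq> {}"
    and big: "k \<ge> 2 \<Longrightarrow> \<exists>c<n. \<exists>d<n. agree S (X0 ` {..<k - 1}) c d \<and> \<alpha> c \<noteq> \<alpha> d"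
      "k \<ge> 2 \<Longrightarrow> \<exists>c<n. \<exists>d<n. agree S (X0 ` {..<k - 1}) c d \<and> \<beta> c \<noteq> \<beta> d"
    and mk: "\<forall>c<n. \<exists>j<k. marked k (\<lambda>t. S (X0 t) c) j" "\<forall>j<k. \<exists>c<n. marked k (\<lambda>t. S (X0 t) c) j"
  obtains X where "guess_ok k S m n X" "\<And>i. X i \<le> m + n"
proof -
  let ?Z = "X0 ` {..<k - 1}"
  obtain r A0 v1 v2 where r: "r \<in> {..<m} - ?Z" and A0: "A0 = row_block S m n ?Z r" "A0 \<subseteq> {..<m} - ?Z" "{..<m} - ?Z - A0 \<noteq> {}"
    and cong: "\<And>c d. agree S ?Z c d \<Longrightarrow> v1 d = v1 c \<and> v2 d = v2 c"
    and v: "\<And>c. c < n \<Longrightarrow> v1 c * v2 c = class_size S n ?Z c"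
    and d2: "\<And>c. c < n \<Longrightarrow> v2 c dvd class_size S n (A0 \<union> ?Z) c"
    and d1: "\<And>c. c < n \<Longrightarrow> v1 c dvd class_size S n ({..<m} - A0) c"
    and vbig: "k \<ge> 2 \<Longrightarrow> \<exists>c<n. v1 c \<ge> 2" "k \<ge> 2 \<Longrightarrow> \<exists>c<n. v2 c \<ge> 2"
    using factored_weights[OF F ne big] by blast
  \<comment> \<open>One column from each slice, at which the slice-wise constant functions
    \<open>v1\<close> and \<open>v2\<close> are read off.\<close>
  have "\<forall>j. \<exists>c. j < k \<longrightarrow> c < n \<and> marked k (\<lambda>t. S (X0 t) c) j" using mk(2) by blast
  from choice[OF this] obtain rep
    where rep: "\<And>j. j < k \<Longrightarrow> rep j < n \<and> marked k (\<lambda>t. S (X0 t) (rep j)) j"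
    by blast
  \<comment> \<open>Layout of a guess: \<open>k - 1\<close> special rows, the k values of
    \<open>v1\<close> from \<open>k - 1\<close> on, the k values of \<open>v2\<close> from
    \<open>2 * k - 1\<close> on, and \<open>r\<close> at \<open>3 * k - 1\<close>. Each value is at
    most \<open>m + n\<close>, as \<open>v1 c * v2 c\<close> is the size of a slice.\<close>
  define X where "X t = (if t < k - 1 then X0 t else if t < 2 * k - 1 then v1 (rep (t - (k - 1)))
    else if t < 3 * k - 1 then v2 (rep (t - (2 * k - 1))) else r)" for t
  have X0: "X t = X0 t" if "t < k - 1" for t using that by (simp add: X_def)
  then have Z: "X ` {..<k - 1} = ?Z" by auto
  have mX: "marked k (\<lambda>t. S (X t) c) j = marked k (\<lambda>t. S (X0 t) c) j" for c j
    by (rule marked_cong) (simp add: X0)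
  have "\<not> 3 * k - 1 < k - 1" "\<not> 3 * k - 1 < 2 * k - 1" "\<not> 3 * k - 1 < 3 * k - 1" using k by auto
  then have Xr: "X (3 * k - 1) = r" unfolding X_def by (simp only: if_False)
  have X1: "X (k - 1 + j) = v1 (rep j)" and X2: "X (2 * k - 1 + j) = v2 (rep j)" if "j < k" for j
    using that k by (auto simp: X_def)
  have vn: "v1 c \<le> n" "v2 c \<le> n" if "c < n" for c
  proof -
    have "v1 c * v2 c \<le> n" unfolding v[OF that] using card_mono[of "{..<n}" "{d. d < n \<and> agree S ?Z c d}"] by auto
    moreover have "0 < v1 c * v2 c" unfolding v[OF that] using that by (rule class_size_pos)
    then have "v1 c \<le> v1 c * v2 c" "v2 c \<le> v1 c * v2 c" by simp_all
    ultimately show "v1 c \<le> n" "v2 c \<le> n" by linarith+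
  qed
  have bound: "X t \<le> m + n" for t
  proof -
    consider "t < k - 1" | "\<not> t < k - 1" "t < 2 * k - 1" | "\<not> t < k - 1" "\<not> t < 2 * k - 1" "t < 3 * k - 1"
      | "\<not> t < k - 1" "\<not> t < 2 * k - 1" "\<not> t < 3 * k - 1" by blast
    then show ?thesis
    proof cases
      case 1
      then have "X0 t < m" using F by (auto simp: factored_def)
      with 1 show ?thesis by (simp add: X_def)
    next
      case 2
      then have "t - (k - 1) < k" by simp
      then have "v1 (rep (t - (k - 1))) \<le> n" using rep vn(1) by blast
      with 2 show ?thesis by (simp add: X_def)
    next
      case 3
      then have "t - (2 * k - 1) < k" by simp
      then have "v2 (rep (t - (2 * k - 1))) \<le> n" using rep vn(2) by blast
      with 3 show ?thesis by (simp add: X_def)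
    next
      case 4
      with r show ?thesis by (simp add: X_def)
    qed
  qed
  have w: "weight k S X off c = u c"
    if c: "c < n" and Xu: "\<And>j. j < k \<Longrightarrow> X (off + j) = u (rep j)"
      and u: "\<And>c d. agree S ?Z c d \<Longrightarrow> u d = u c" for c off u
  proof -
    obtain j where j: "j < k" "marked k (\<lambda>t. S (X0 t) c) j" using mk(1) c by blast
    have iff: "marked k (\<lambda>t. S (X t) c) i \<longleftrightarrow> i = j" if "i < k" for i
      unfolding mX
    proof
      assume "marked k (\<lambda>t. S (X0 t) c) i"
      then show "i = j" using j(2) that j(1) by (rule marked_unique)
    qed (use j(2) in simp)
    have "weight k S X off c = (\<Sum>i<k. if i = j then X (off + i) else 0)"
      unfolding weight_def by (rule sum.cong) (simp_all add: iff)
    also have "\<dots> = X (off + j)" using j(1) by (simp add: sum.delta)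
    also have "\<dots> = u (rep j)" by (rule Xu[OF j(1)])
    also have "\<dots> = u c"
    proof (rule u)
      have "\<forall>t<k - 1. S (X0 t) c = S (X0 t) (rep j)"
        using j(2) rep[OF j(1)] by (simp add: marked_def)
      then show "agree S ?Z c (rep j)" by (auto simp: agree_def)
    qed
    finally show ?thesis .
  qed
  have w1: "weight k S X (k - 1) c = v1 c" if "c < n" for c
    using that X1 cong[THEN conjunct1] by (rule w)
  have w2: "weight k S X (2 * k - 1) c = v2 c" if "c < n" for c
    using that X2 cong[THEN conjunct2] by (rule w)
  have "splits k S m n X A0 (keep S n (A0 \<union> X ` {..<k - 1}) (weight k S X (2 * k - 1)))
        (keep S n ({..<m} - A0) (weight k S X (k - 1)))"
  proof (rule splitsI; (unfold Z mX)?)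
    show "?Z \<subseteq> {..<m}" using F by (simp add: factored_def)
    show "A0 \<noteq> {}" using row_block_self A0(1) by blast
    show "A0 \<subseteq> {..<m} - ?Z" "{..<m} - ?Z - A0 \<noteq> {}" by (fact A0)+
    show "\<forall>c<n. \<exists>j<k. marked k (\<lambda>t. S (X0 t) c) j" "\<forall>j<k. \<exists>c<n. marked k (\<lambda>t. S (X0 t) c) j" by (fact mk)+
    show "indep_rows S m n ?Z x y" if "x \<in> A0" "y \<in> {..<m} - ?Z - A0" for x y
      using that unfolding A0(1) by (rule row_block_closed)
    show "weight k S X (k - 1) d = weight k S X (k - 1) c \<and> weight k S X (2 * k - 1) d = weight k S X (2 * k - 1) c"
      if "c < n" "d < n" "agree S ?Z c d" for c d
      using cong[OF that(3)] by (simp only: w1 w2 that)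
    show "weight k S X (k - 1) c * weight k S X (2 * k - 1) c = class_size S n ?Z c"
      "weight k S X (2 * k - 1) c dvd class_size S n (A0 \<union> ?Z) c"
      "weight k S X (k - 1) c dvd class_size S n ({..<m} - A0) c" if "c < n" for c
      unfolding w1[OF that] w2[OF that] by (rule v[OF that] d1[OF that] d2[OF that])+
    show "\<exists>c<n. 2 \<le> weight k S X (k - 1) c" if k2: "k \<ge> 2"
    proof -
      obtain c where "c < n" "2 \<le> v1 c" using vbig(1)[OF k2] by blast
      then show ?thesis by (intro exI[of _ c]) (simp only: w1 simp_thms)
    qed
    show "\<exists>c<n. 2 \<le> weight k S X (2 * k - 1) c" if k2: "k \<ge> 2"
    proof -
      obtain c where "c < n" "2 \<le> v2 c" using vbig(2)[OF k2] by blast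
      then show ?thesis by (intro exI[of _ c]) (simp only: w2 simp_thms)
    qed
  qed
  then have "guess_ok k S m n X"
    using r unfolding guess_ok_def Xr Z A0(1) by (simp add: Let_def)
  then show thesis using bound by (rule that)
qed

text \<open>The labels of rows and columns given by an isomorphism to the product supply the row
  sets \<open>A\<close>, \<open>B\<close>, the special rows and the coordinates \<alpha>, \<beta> of
  a \<open>factored\<close> matrix.\<close>

theorem k_factorisation_imp_guess_ok:
  fixes M :: "'a::zero_neq_one mat"
  defines "m \<equiv> dim_row M" and "n \<equiv> dim_col M"
  assumes S: "\<And>i c. i < m \<Longrightarrow> c < n \<Longrightarrow> S i c = M $$ (i, c)"
    and k: "k \<ge> 1" and fac: "k_factorisation k M M1 xs M2 ys"
  obtains X where "guess_ok k S m n X" "\<And>i. X i \<le> m + n"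
proof -
  have sr: "special_rows k M1 xs" "special_rows k M2 ys"
    and dims: "dim_row M1 < m" "dim_row M2 < m" "k \<ge> 2 \<Longrightarrow> dim_col M1 < n" "k \<ge> 2 \<Longrightarrow> dim_col M2 < n"
    and iso: "isomorphic_mat M (k_product k M1 xs M2 ys)"
    using fac unfolding k_factorisation_iff[OF k] m_def n_def by auto
  obtain \<rho> \<gamma> where r: "bij_betw \<rho> {..<m} (row_labels k M1 xs M2 ys)"
    and g: "bij_betw \<gamma> {..<n} (col_labels k M1 xs M2 ys)"
    and ent: "\<And>i c. i < m \<Longrightarrow> c < n \<Longrightarrow> S i c = label_entry M1 xs M2 (\<rho> i) (\<gamma> c)"
  proof -
    obtain \<rho> \<gamma> where *: "bij_betw \<rho> {..<m} (row_labels k M1 xs M2 ys)"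
      "bij_betw \<gamma> {..<n} (col_labels k M1 xs M2 ys)"
      "\<forall>i<m. \<forall>c<n. M $$ (i, c) = label_entry M1 xs M2 (\<rho> i) (\<gamma> c)"
      using iso unfolding isomorphic_k_product_iff[OF sr k] m_def n_def by blast
    show thesis by (rule that[OF *(1,2)]) (use *(3) S in simp)
  qed
  define \<alpha> \<beta> where "\<alpha> c = fst (\<gamma> c)" and "\<beta> c = snd (\<gamma> c)" for c
  have \<gamma>: "\<gamma> c = (\<alpha> c, \<beta> c)" for c by (simp add: \<alpha>_def \<beta>_def)
  define A B where "A = {i. i < m \<and> (\<exists>a. \<rho> i = Inl a)}" and "B = {i. i < m \<and> (\<exists>b. \<rho> i = Inr (Inl b))}"
  define X0 where "X0 t = inv_into {..<m} \<rho> (Inr (Inr t))" for t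
  have X0: "X0 t < m" "\<rho> (X0 t) = Inr (Inr t)" if "t < k - 1" for t
  proof -
    have l: "Inr (Inr t) \<in> row_labels k M1 xs M2 ys" using that by (auto simp: row_labels_def)
    show "\<rho> (X0 t) = Inr (Inr t)" unfolding X0_def by (rule bij_betw_inv_into_right[OF r l])
    show "X0 t < m" using bij_betwE[OF bij_betw_inv_into[OF r]] l unfolding X0_def by blast
  qed
  let ?Z = "X0 ` {..<k - 1}"
  have Z: "i \<in> ?Z \<longleftrightarrow> (\<exists>t. \<rho> i = Inr (Inr t))" if i: "i < m" for i
  proof
    assume "i \<in> ?Z" then show "\<exists>t. \<rho> i = Inr (Inr t)" using X0 by auto
  next
    assume "\<exists>t. \<rho> i = Inr (Inr t)"
    then obtain t where t: "\<rho> i = Inr (Inr t)" by blast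
    moreover have "\<rho> i \<in> row_labels k M1 xs M2 ys" using bij_betwE[OF r] i by simp
    ultimately have "t < k - 1" by (auto simp: row_labels_def)
    then have "\<rho> i = \<rho> (X0 t)" "X0 t < m" using X0 t by simp_all
    then have "i = X0 t" using bij_betw_imp_inj_on[OF r] i by (auto dest: inj_onD)
    then show "i \<in> ?Z" using \<open>t < k - 1\<close> by simp
  qed
  have CL: "\<alpha> c < dim_col M1 \<and> \<beta> c < dim_col M2 \<and> (\<forall>t<k - 1. M1 $$ (xs ! t, \<alpha> c) = M2 $$ (ys ! t, \<beta> c))"
    if "c < n" for c
    using bij_betwE[OF g, rule_format, of c] that by (simp add: col_labels_def \<gamma>)
  have SZ: "S (X0 t) c = M1 $$ (xs ! t, \<alpha> c)" if "t < k - 1" "c < n" for t c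
    using ent[OF X0(1)[OF that(1)] that(2)] by (simp add: X0(2)[OF that(1)] \<gamma>)
  have SZ2: "S (X0 t) c = M2 $$ (ys ! t, \<beta> c)" if "t < k - 1" "c < n" for t c
    using SZ[OF that] CL that by simp
  have agZ: "agree S ?Z c d \<longleftrightarrow> (\<forall>t<k - 1. S (X0 t) c = S (X0 t) d)" for c d
    by (auto simp: agree_def)
  have agA: "agree S A c d" if "c < n" "d < n" "\<alpha> c = \<alpha> d" for c d
    unfolding agree_def
  proof
    fix i assume "i \<in> A"
    then obtain a where i: "i < m" "\<rho> i = Inl a" by (auto simp: A_def)
    show "S i c = S i d" using ent[OF i(1) that(1)] ent[OF i(1) that(2)] that(3) by (simp add: i(2) \<gamma>)
  qed
  have agB: "agree S B c d" if "c < n" "d < n" "\<beta> c = \<beta> d" for c d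
    unfolding agree_def
  proof
    fix i assume "i \<in> B"
    then obtain a where i: "i < m" "\<rho> i = Inr (Inl a)" by (auto simp: B_def)
    show "S i c = S i d" using ent[OF i(1) that(1)] ent[OF i(1) that(2)] that(3) by (simp add: i(2) \<gamma>)
  qed
  have agZa: "agree S ?Z c d" if "c < n" "d < n" "\<alpha> c = \<alpha> d" for c d
    unfolding agZ using SZ[OF _ that(1)] SZ[OF _ that(2)] that(3) by simp
  have agZb: "agree S ?Z c d" if "c < n" "d < n" "\<beta> c = \<beta> d" for c d
    unfolding agZ using SZ2[OF _ that(1)] SZ2[OF _ that(2)] that(3) by simp
  have inj: "c = d" if "c < n" "d < n" "\<alpha> c = \<alpha> d" "\<beta> c = \<beta> d" for c d
    by (rule inj_onD[OF bij_betw_imp_inj_on[OF g]]) (use that in \<open>simp_all add: \<gamma>\<close>)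
  have mix: "\<exists>e<n. \<alpha> e = \<alpha> c \<and> \<beta> e = \<beta> d" if cd: "c < n" "d < n" "agree S ?Z c d" for c d
  proof -
    have "M1 $$ (xs ! t, \<alpha> c) = M2 $$ (ys ! t, \<beta> d)" if "t < k - 1" for t
      using cd(3)[unfolded agZ, rule_format, OF that] SZ[OF that cd(1)] SZ2[OF that cd(2)] by simp
    then have "(\<alpha> c, \<beta> d) \<in> col_labels k M1 xs M2 ys"
      using CL[OF cd(1)] CL[OF cd(2)] by (simp add: col_labels_def)
    then have "(\<alpha> c, \<beta> d) \<in> \<gamma> ` {..<n}" using g by (simp add: bij_betw_def)
    then obtain e where "e < n" "\<gamma> e = (\<alpha> c, \<beta> d)" by auto
    then show ?thesis by (auto simp: \<gamma>)
  qed
  have 1: "factored S m n ?Z A B \<alpha> \<beta>"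
    unfolding factored_def
  proof (intro conjI allI impI)
    show "?Z \<subseteq> {..<m}" using X0 by auto
    show "A \<inter> B = {}" by (auto simp: A_def B_def)
    show "A \<union> B = {..<m} - ?Z"
    proof (rule Set.set_eqI)
      fix i
      show "i \<in> A \<union> B \<longleftrightarrow> i \<in> {..<m} - ?Z"
      proof (cases "i < m")
        case True
        have "(\<exists>a. \<rho> i = Inl a) \<or> (\<exists>b. \<rho> i = Inr (Inl b)) \<longleftrightarrow> \<not> (\<exists>t. \<rho> i = Inr (Inr t))"
        proof (cases "\<rho> i")
          case (Inr y)
          then show ?thesis by (cases y) auto
        qed simp
        with True show ?thesis by (simp only: A_def B_def Un_iff mem_Collect_eq Diff_iff lessThan_iff Z simp_thms)
      next
        case False
        then show ?thesis by (simp add: A_def B_def)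
      qed
    qed
    fix c d assume cd: "c < n" "d < n"
    show "agree S (A \<union> ?Z) c d" if "\<alpha> c = \<alpha> d"
      unfolding agree_Un using agA[OF cd that] agZa[OF cd that] by (rule conjI)
    show "agree S (B \<union> ?Z) c d" if "\<beta> c = \<beta> d"
      unfolding agree_Un using agB[OF cd that] agZb[OF cd that] by (rule conjI)
    show "\<exists>e<n. \<alpha> e = \<alpha> c \<and> \<beta> e = \<beta> d" if "agree S ?Z c d"
      by (rule mix[OF cd that])
    show "c = d" if "\<alpha> c = \<alpha> d" "\<beta> c = \<beta> d"
      by (rule inj[OF cd that])
  qed
  \<comment> \<open>The number m of rows is the sum of the numbers of non-special rows of the two
    factors and \<open>k - 1\<close>. If one factor had no further rows, the other would have at
    least m rows.\<close>
  have 2: "A \<noteq> {}" "B \<noteq> {}"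
  proof -
    have cardRL: "m = card ({..<dim_row M1} - set xs) + (card ({..<dim_row M2} - set ys) + (k - 1))"
      using bij_betw_same_card[OF r] by (simp add: row_labels_def card_Plus)
    have le: "card ({..<dim_row T} - set zs) + (k - 1) \<le> dim_row T" if "special_rows k T zs" for T :: "'a mat" and zs
    proof -
      have "card (set zs) = k - 1" "set zs \<subseteq> {..<dim_row T}"
        using special_rows_distinct[OF that] that by (auto simp: special_rows_iff distinct_card)
      then show ?thesis using card_mono[of "{..<dim_row T}" "set zs"] by (simp add: card_Diff_subset)
    qed
    have "card ({..<dim_row M1} - set xs) \<noteq> 0" "card ({..<dim_row M2} - set ys) \<noteq> 0"
      using cardRL le[OF sr(1)] le[OF sr(2)] dims(1,2) by linarith+
    then have "{..<dim_row M1} - set xs \<noteq> {}" "{..<dim_row M2} - set ys \<noteq> {}"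
      by (metis card.empty)+
    then obtain a b where "Inl a \<in> row_labels k M1 xs M2 ys" "Inr (Inl b) \<in> row_labels k M1 xs M2 ys"
      by (auto simp: row_labels_def)
    then have "Inl a \<in> \<rho> ` {..<m}" "Inr (Inl b) \<in> \<rho> ` {..<m}" using r by (simp_all add: bij_betw_def)
    then obtain i i' where "i < m" "\<rho> i = Inl a" "i' < m" "\<rho> i' = Inr (Inl b)" by (auto simp: image_iff)
    then have "i \<in> A" "i' \<in> B" by (auto simp: A_def B_def)
    then show "A \<noteq> {}" "B \<noteq> {}" by auto
  qed
  \<comment> \<open>If columns of one slice always had the same \<alpha>, then \<beta> would be
    injective on all columns, as equal \<beta> puts two columns into one slice. The second factor
    would then have at least n columns.\<close>
  have 3: "\<exists>c<n. \<exists>d<n. agree S ?Z c d \<and> \<alpha> c \<noteq> \<alpha> d" if "k \<ge> 2"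
  proof (rule ccontr)
    assume *: "\<not> ?thesis"
    have "inj_on \<beta> {..<n}"
    proof (rule inj_onI)
      fix c d assume "c \<in> {..<n}" "d \<in> {..<n}" and eq: "\<beta> c = \<beta> d"
      then have cd: "c < n" "d < n" by simp_all
      have "\<alpha> c = \<alpha> d" using * cd agZb[OF cd eq] by blast
      then show "c = d" using eq by (rule inj[OF cd])
    qed
    moreover have "\<beta> ` {..<n} \<subseteq> {..<dim_col M2}" by (intro image_subsetI) (simp add: CL)
    ultimately have "card {..<n} \<le> card {..<dim_col M2}" by (intro card_inj_on_le) simp_all
    then show False using dims(4) that by simp
  qed
  have 4: "\<exists>c<n. \<exists>d<n. agree S ?Z c d \<and> \<beta> c \<noteq> \<beta> d" if "k \<ge> 2"
  proof (rule ccontr)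
    assume *: "\<not> ?thesis"
    have "inj_on \<alpha> {..<n}"
    proof (rule inj_onI)
      fix c d assume "c \<in> {..<n}" "d \<in> {..<n}" and eq: "\<alpha> c = \<alpha> d"
      then have cd: "c < n" "d < n" by simp_all
      have "\<beta> c = \<beta> d" using * cd agZa[OF cd eq] by blast
      with eq show "c = d" by (rule inj[OF cd])
    qed
    moreover have "\<alpha> ` {..<n} \<subseteq> {..<dim_col M1}" by (intro image_subsetI) (simp add: CL)
    ultimately have "card {..<n} \<le> card {..<dim_col M1}" by (intro card_inj_on_le) simp_all
    then show False using dims(3) that by simp
  qed
  have 5: "\<forall>c<n. \<exists>j<k. marked k (\<lambda>t. S (X0 t) c) j"
  proof (intro allI impI)
    fix c assume c: "c < n"
    obtain j where j: "j < k" "marked k (\<lambda>t. M1 $$ (xs ! t, \<alpha> c)) j"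
      using special_rows_ex_marked[OF sr(1) conjunct1[OF CL[OF c]]] by blast
    then have "marked k (\<lambda>t. S (X0 t) c) j" using SZ[OF _ c] by (simp add: marked_def)
    with j(1) show "\<exists>j<k. marked k (\<lambda>t. S (X0 t) c) j" by blast
  qed
  have 6: "\<forall>j<k. \<exists>c<n. marked k (\<lambda>t. S (X0 t) c) j"
  proof (intro allI impI)
    fix j assume j: "j < k"
    obtain a where a: "a < dim_col M1" "marked k (\<lambda>t. M1 $$ (xs ! t, a)) j"
      using special_rows_ex_col[OF sr(1) j] by blast
    obtain b where b: "b < dim_col M2" "marked k (\<lambda>t. M2 $$ (ys ! t, b)) j"
      using special_rows_ex_col[OF sr(2) j] by blast
    note ab = a b
    have "M1 $$ (xs ! t, a) = M2 $$ (ys ! t, b)" if "t < k - 1" for t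
      using that ab(2,4) by (simp add: marked_def)
    then have "(a, b) \<in> col_labels k M1 xs M2 ys" using ab(1,3) by (simp add: col_labels_def)
    then have "(a, b) \<in> \<gamma> ` {..<n}" using g by (simp add: bij_betw_def)
    then obtain c where c: "c < n" "\<gamma> c = (a, b)" by auto
    then have "marked k (\<lambda>t. S (X0 t) c) j" using SZ[OF _ c(1)] a(2) by (simp add: marked_def \<gamma>)
    with c(1) show "\<exists>c<n. marked k (\<lambda>t. S (X0 t) c) j" by blast
  qed
  show thesis
  proof (rule factored_imp_guess_ok[where S = S and ?X0.0 = X0 and A = A and B = B and \<alpha> = \<alpha> and \<beta> = \<beta>])
    fix X assume "guess_ok k S m n X" "\<And>i. X i \<le> m + n"
    then show thesis by (rule that)
  next
    show "\<exists>c<n. \<exists>d<n. agree S ?Z c d \<and> \<alpha> c \<noteq> \<alpha> d" if "k \<ge> 2" using that by (rule 3)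
    show "\<exists>c<n. \<exists>d<n. agree S ?Z c d \<and> \<beta> c \<noteq> \<beta> d" if "k \<ge> 2" using that by (rule 4)
  qed (rule k 1 2 5 6)+
qed

section \<open>Timed total correctness and a compiler for terms with bounded sums\<close>

text \<open>Total correctness with a time bound. Since \<open>exec\<close> is deterministic, the
  existential speaks about the only run.\<close>

definition runs :: "com \<Rightarrow> state \<Rightarrow> nat \<Rightarrow> (state \<Rightarrow> bool) \<Rightarrow> bool" where
  "runs c s T Q \<longleftrightarrow> (\<exists>t s'. exec c s t s' \<and> t \<le> T \<and> Q s')"

lemma runs_mono: "runs c s T Q \<Longrightarrow> T \<le> T' \<Longrightarrow> (\<And>s'. Q s' \<Longrightarrow> Q' s') \<Longrightarrow> runs c s T' Q'"
  unfolding runs_def by (meson order_trans)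

lemma runs_Skip: "Q s \<Longrightarrow> 1 \<le> T \<Longrightarrow> runs Skip s T Q"
  unfolding runs_def using exec.Skip by blast

lemma runs_AssignNVar:
  "Q (s\<lparr>nvar := (nvar s)(x := nval e s)\<rparr>) \<Longrightarrow> 1 \<le> T \<Longrightarrow> runs (AssignNVar x e) s T Q"
  unfolding runs_def using exec.AssignNVar by blast

lemma runs_AssignNArr:
  "Q (s\<lparr>narr := upd2 (narr s) a (nval e s) (nval f s) (nval g s)\<rparr>) \<Longrightarrow> 1 \<le> T \<Longrightarrow>
     runs (AssignNArr a e f g) s T Q"
  unfolding runs_def using exec.AssignNArr by blast

lemma runs_AssignRArr:
  "Q (s\<lparr>rarr := upd2 (rarr s) a (nval e s) (nval f s) (rval g s)\<rparr>) \<Longrightarrow> 1 \<le> T \<Longrightarrow>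
     runs (AssignRArr a e f g) s T Q"
  unfolding runs_def using exec.AssignRArr by blast

lemma runs_Seq:
  assumes "runs c s T1 (\<lambda>s'. runs d s' T2 Q)" "T1 + T2 \<le> T"
  shows "runs (Seq c d) s T Q"
proof -
  obtain t s' where 1: "exec c s t s'" "t \<le> T1" "runs d s' T2 Q" using assms(1) unfolding runs_def by blast
  then obtain u s'' where 2: "exec d s' u s''" "u \<le> T2" "Q s''" unfolding runs_def by blast
  have "exec (Seq c d) s (t + u) s''" using 1(1) 2(1) by (rule exec.Seq)
  then show ?thesis unfolding runs_def using 1(2) 2(2,3) assms(2) by (intro exI[of _ "t + u"] exI[of _ s'']) auto
qed

lemma runs_Seq':
  assumes "runs c s T1 Q1" "\<And>s'. Q1 s' \<Longrightarrow> runs d s' T2 Q" "T1 + T2 \<le> T"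
  shows "runs (Seq c d) s T Q"
  by (rule runs_Seq[OF runs_mono[OF assms(1) order_refl assms(2)] assms(3)])

lemma runs_Seq_AssignNVar:
  assumes "runs c (s\<lparr>nvar := (nvar s)(x := nval e s)\<rparr>) T' Q" "Suc T' \<le> T"
  shows "runs (Seq (AssignNVar x e) c) s T Q"
  using assms by (intro runs_Seq[where ?T1.0 = 1 and ?T2.0 = T'] runs_AssignNVar) auto

lemma runs_Cond:
  assumes "bval b s \<Longrightarrow> runs c s T1 Q" "\<not> bval b s \<Longrightarrow> runs d s T1 Q" "Suc T1 \<le> T"
  shows "runs (Cond b c d) s T Q"
proof (cases "bval b s")
  case True
  then obtain t s' where "exec c s t s'" "t \<le> T1" "Q s'" using assms(1) unfolding runs_def by blast
  then show ?thesis
    using exec.CondTrue[OF True] assms(3) unfolding runs_def by (intro exI[of _ "Suc t"] exI[of _ s']) auto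
next
  case False
  then obtain t s' where "exec d s t s'" "t \<le> T1" "Q s'" using assms(2) unfolding runs_def by blast
  then show ?thesis
    using exec.CondFalse[OF False] assms(3) unfolding runs_def by (intro exI[of _ "Suc t"] exI[of _ s']) auto
qed

text \<open>The invariant is indexed by the number of completed rounds and the guard holds exactly
  while this is below \<open>b\<close>. A round costs its body and one guard; the last failing guard
  accounts for the final 1.\<close>

lemma runs_While:
  assumes body: "\<And>i s. i < b \<Longrightarrow> I i s \<Longrightarrow> runs c s T (I (Suc i))"
    and guard: "\<And>i s. I i s \<Longrightarrow> bval g s \<longleftrightarrow> i < b"
    and init: "I i s" "i \<le> b"
  shows "runs (While g c) s ((b - i) * (T + 1) + 1) (I b)"
  using init
proof (induction "b - i" arbitrary: i s)
  case 0
  then have "i = b" "\<not> bval g s" using guard by auto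
  then show ?case unfolding runs_def using exec.WhileFalse[of g s c] 0 by auto
next
  case (Suc l)
  then have i: "i < b" "bval g s" using guard by auto
  obtain t s' where 1: "exec c s t s'" "t \<le> T" "I (Suc i) s'"
    using body[OF i(1) Suc.prems(1)] unfolding runs_def by blast
  have "runs (While g c) s' ((b - Suc i) * (T + 1) + 1) (I b)"
    using Suc 1(3) i by (intro Suc.hyps(1)) auto
  then obtain u s'' where 2: "exec (While g c) s' u s''" "u \<le> (b - Suc i) * (T + 1) + 1" "I b s''"
    unfolding runs_def by blast
  have "exec (While g c) s (Suc (t + u)) s''" by (rule exec.WhileTrue[OF i(2) 1(1) 2(1)])
  moreover have "b - i = Suc (b - Suc i)" using i by simp
  then have "Suc (t + u) \<le> (b - i) * (T + 1) + 1" using 1(2) 2(2) by simp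
  ultimately show ?case unfolding runs_def using 2(3) by blast
qed

text \<open>Programs with bounded sums and counting loops. Register \<open>reg d\<close> holds the value of a term
  compiled at depth \<open>d\<close>; deeper registers are scratch space.\<close>

definition reg :: "nat \<Rightarrow> string" where
  "reg d = replicate (Suc d) (CHR ''#'')"

definition user :: "string \<Rightarrow> bool" where
  "user x \<longleftrightarrow> x = [] \<or> hd x \<noteq> CHR ''#''"

lemma reg_eq_iff [simp]: "reg d = reg e \<longleftrightarrow> d = e"
  unfolding reg_def by (metis Suc_inject length_replicate)

lemma not_user_reg [simp]: "\<not> user (reg d)"
  by (simp add: reg_def user_def)

lemma user_not_reg [simp]: "user x \<Longrightarrow> x \<noteq> reg d" "user x \<Longrightarrow> reg d \<noteq> x"
  using not_user_reg by blast+

lemma user_mn [simp]: "user ''m''" "user ''n''"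
  by (simp_all add: user_def)

datatype bound = BConst nat | BRows | BCols | BSize

fun bexpr :: "bound \<Rightarrow> nexp" where
  "bexpr (BConst c) = NConst c"
| "bexpr BRows = NVar ''m''"
| "bexpr BCols = NVar ''n''"
| "bexpr BSize = NAdd (NAdd (NVar ''m'') (NVar ''n'')) (NConst 1)"

text \<open>All time bounds are polynomials in the single number \<open>m + n\<close>, which bounds
  both loop ranges m and n.\<close>

fun bpoly :: "bound \<Rightarrow> nat poly" where
  "bpoly (BConst c) = [:c:]"
| "bpoly BRows = [:0, 1:]"
| "bpoly BCols = [:0, 1:]"
| "bpoly BSize = [:1, 1:]"

datatype tm =
    TC nat
  | TV string
  | TA string tm tm
  | TAdd tm tm
  | TSub tm tm
  | TLess tm tm
  | TREq tm tm tm tm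
  | TRC bool tm tm
  | TIf tm tm tm
  | TSum string bound tm

abbreviation setv :: "state \<Rightarrow> string \<Rightarrow> nat \<Rightarrow> state" where
  "setv s x v \<equiv> s\<lparr>nvar := (nvar s)(x := v)\<rparr>"

fun teval :: "tm \<Rightarrow> state \<Rightarrow> nat" where
  "teval (TC c) s = c"
| "teval (TV x) s = nvar s x"
| "teval (TA a t u) s = narr s a (teval t s) (teval u s)"
| "teval (TAdd t u) s = teval t s + teval u s"
| "teval (TSub t u) s = teval t s - teval u s"
| "teval (TLess t u) s = (if teval t s < teval u s then 1 else 0)"
| "teval (TREq t u v w) s =
     (if rarr s ''S'' (teval t s) (teval u s) = rarr s ''S'' (teval v s) (teval w s) then 1 else 0)"
| "teval (TRC b t u) s = (if rarr s ''S'' (teval t s) (teval u s) = (if b then 1 else 0) then 1 else 0)"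
| "teval (TIf t u v) s = (if teval t s \<noteq> 0 then teval u s else teval v s)"
| "teval (TSum x e t) s = (\<Sum>i<nval (bexpr e) s. teval t (setv s x i))"

fun twf :: "tm \<Rightarrow> bool" where
  "twf (TC c) = True"
| "twf (TV x) = user x"
| "twf (TA a t u) = (twf t \<and> twf u)"
| "twf (TAdd t u) = (twf t \<and> twf u)"
| "twf (TSub t u) = (twf t \<and> twf u)"
| "twf (TLess t u) = (twf t \<and> twf u)"
| "twf (TREq t u v w) = (twf t \<and> twf u \<and> twf v \<and> twf w)"
| "twf (TRC b t u) = (twf t \<and> twf u)"
| "twf (TIf t u v) = (twf t \<and> twf u \<and> twf v)"
| "twf (TSum x e t) = (user x \<and> x \<noteq> ''m'' \<and> x \<noteq> ''n'' \<and> twf t)"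

abbreviation setr :: "nat \<Rightarrow> nexp \<Rightarrow> com" where
  "setr d e \<equiv> AssignNVar (reg d) e"

abbreviation RV :: "nat \<Rightarrow> nexp" where
  "RV d \<equiv> NVar (reg d)"

text \<open>The value ends in register d; intermediate results live in higher registers. A sum
  accumulates in d, keeps its bound in d + 1 and the old value of its variable in d + 2, and
  restores that value at the end, which makes evaluation free of side effects on user
  variables.\<close>

fun tcomp :: "nat \<Rightarrow> tm \<Rightarrow> com" where
  "tcomp d (TC c) = setr d (NConst c)"
| "tcomp d (TV x) = setr d (NVar x)"
| "tcomp d (TA a t u) = Seq (tcomp d t) (Seq (tcomp (d + 1) u) (setr d (NArr a (RV d) (RV (d + 1)))))"
| "tcomp d (TAdd t u) = Seq (tcomp d t) (Seq (tcomp (d + 1) u) (setr d (NAdd (RV d) (RV (d + 1)))))"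
| "tcomp d (TSub t u) = Seq (tcomp d t) (Seq (tcomp (d + 1) u) (setr d (NSub (RV d) (RV (d + 1)))))"
| "tcomp d (TLess t u) = Seq (tcomp d t) (Seq (tcomp (d + 1) u)
     (Cond (NLess (RV d) (RV (d + 1))) (setr d (NConst 1)) (setr d (NConst 0))))"
| "tcomp d (TREq t u v w) = Seq (tcomp d t) (Seq (tcomp (d + 1) u) (Seq (tcomp (d + 2) v) (Seq (tcomp (d + 3) w)
     (Cond (REq (RArr ''S'' (RV d) (RV (d + 1))) (RArr ''S'' (RV (d + 2)) (RV (d + 3))))
       (setr d (NConst 1)) (setr d (NConst 0))))))"
| "tcomp d (TRC b t u) = Seq (tcomp d t) (Seq (tcomp (d + 1) u)
     (Cond (REq (RArr ''S'' (RV d) (RV (d + 1))) (if b then ROne else RZero))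
       (setr d (NConst 1)) (setr d (NConst 0))))"
| "tcomp d (TIf t u v) = Seq (tcomp d t) (Cond (NLess (NConst 0) (RV d)) (tcomp d u) (tcomp d v))"
| "tcomp d (TSum x e t) = Seq (setr d (NConst 0)) (Seq (setr (d + 1) (bexpr e)) (Seq (setr (d + 2) (NVar x))
     (Seq (AssignNVar x (NConst 0)) (Seq
       (While (NLess (NVar x) (RV (d + 1)))
         (Seq (tcomp (d + 3) t) (Seq (setr d (NAdd (RV d) (RV (d + 3)))) (AssignNVar x (NAdd (NVar x) (NConst 1))))))
       (AssignNVar x (RV (d + 2)))))))"

text \<open>The times of both branches of a conditional are added, which bounds their maximum by a
  polynomial. A round of a sum costs 3 steps besides its body: the guard, the addition and the
  increment.\<close>

fun ttime :: "tm \<Rightarrow> nat poly" where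
  "ttime (TC c) = [:1:]"
| "ttime (TV x) = [:1:]"
| "ttime (TA a t u) = ttime t + ttime u + [:1:]"
| "ttime (TAdd t u) = ttime t + ttime u + [:1:]"
| "ttime (TSub t u) = ttime t + ttime u + [:1:]"
| "ttime (TLess t u) = ttime t + ttime u + [:2:]"
| "ttime (TREq t u v w) = ttime t + ttime u + ttime v + ttime w + [:2:]"
| "ttime (TRC b t u) = ttime t + ttime u + [:2:]"
| "ttime (TIf t u v) = ttime t + ttime u + ttime v + [:1:]"
| "ttime (TSum x e t) = bpoly e * (ttime t + [:3:]) + [:6:]"

text \<open>The two relations that make the compiler compositional: \<open>sim\<close> is equality
  up to registers, and \<open>low\<close> says that registers below the current depth, which hold
  pending intermediate results, have survived.\<close>

definition sim :: "state \<Rightarrow> state \<Rightarrow> bool" where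
  "sim s s0 \<longleftrightarrow> narr s = narr s0 \<and> rarr s = rarr s0 \<and> (\<forall>x. user x \<longrightarrow> nvar s x = nvar s0 x)"

definition low :: "nat \<Rightarrow> state \<Rightarrow> state \<Rightarrow> bool" where
  "low d s s' \<longleftrightarrow> (\<forall>i<d. nvar s' (reg i) = nvar s (reg i))"

lemma sim_setv_reg [simp]: "sim (setv s (reg d) v) s0 \<longleftrightarrow> sim s s0"
  by (auto simp: sim_def)

lemma sim_setv: "sim s s0 \<Longrightarrow> sim (setv s x v) (setv s0 x v)"
  by (auto simp: sim_def)

lemma sim_refl [simp]: "sim s s"
  by (simp add: sim_def)

lemma low_refl [simp]: "low d s s"
  by (simp add: low_def)

lemma low_setv_reg [simp]: "d \<le> e \<Longrightarrow> low d s (setv s' (reg e) v) \<longleftrightarrow> low d s s'"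
  by (auto simp: low_def)

lemma low_setv_user [simp]: "user x \<Longrightarrow> low d s (setv s' x v) \<longleftrightarrow> low d s s'"
  by (auto simp: low_def)

lemma low_trans: "low d s s' \<Longrightarrow> low e s' s'' \<Longrightarrow> d \<le> e \<Longrightarrow> low d s s''"
  by (auto simp: low_def)

lemma lowD: "low d s s' \<Longrightarrow> i < d \<Longrightarrow> nvar s' (reg i) = nvar s (reg i)"
  by (auto simp: low_def)

lemma nval_bexpr_sim: "sim s s0 \<Longrightarrow> nval (bexpr e) s = nval (bexpr e) s0"
  by (cases e) (auto simp: sim_def)

lemma nval_bexpr_cong:
  "nvar s ''m'' = nvar s' ''m'' \<Longrightarrow> nvar s ''n'' = nvar s' ''n'' \<Longrightarrow> nval (bexpr e) s = nval (bexpr e) s'"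
  by (cases e) auto

lemma nval_bexpr_le: "nval (bexpr e) s \<le> poly (bpoly e) (nvar s ''m'' + nvar s ''n'')"
  by (cases e) auto

definition computes :: "nat \<Rightarrow> com \<Rightarrow> state \<Rightarrow> nat \<Rightarrow> nat \<Rightarrow> bool" where
  "computes d c s0 T v \<longleftrightarrow> (\<forall>s. sim s s0 \<longrightarrow>
     runs c s T (\<lambda>s'. sim s' s0 \<and> low d s s' \<and> nvar s' (reg d) = v))"

lemma runs_Seq_computes:
  assumes "computes e c s0 T v" "sim s s0"
    and "\<And>s'. sim s' s0 \<Longrightarrow> low e s s' \<Longrightarrow> nvar s' (reg e) = v \<Longrightarrow> runs c' s' T2 Q"
    and "T + T2 \<le> T3"
  shows "runs (Seq c c') s T3 Q"
proof (rule runs_Seq[OF runs_mono assms(4)])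
  show "runs c s T (\<lambda>s'. sim s' s0 \<and> low e s s' \<and> nvar s' (reg e) = v)"
    using assms(1,2) unfolding computes_def by blast
qed (use assms(3) in auto)

lemma runs_Seq2_computes:
  assumes c: "computes d c s0 T v" "computes (d + 1) c' s0 T' v'" and s: "sim s s0"
    and Q: "\<And>s'. sim s' s0 \<Longrightarrow> low d s s' \<Longrightarrow> nvar s' (reg d) = v \<Longrightarrow> nvar s' (reg (d + 1)) = v' \<Longrightarrow>
      runs c'' s' T'' Q"
    and T: "T + T' + T'' \<le> T1"
  shows "runs (Seq c (Seq c' c'')) s T1 Q"
proof (rule runs_Seq_computes[OF c(1) s])
  fix s1 assume s1: "sim s1 s0" "low d s s1" "nvar s1 (reg d) = v"
  show "runs (Seq c' c'') s1 (T' + T'') Q"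
  proof (rule runs_Seq_computes[OF c(2) s1(1)])
    fix s2 assume s2: "sim s2 s0" "low (d + 1) s1 s2" "nvar s2 (reg (d + 1)) = v'"
    have "low d s s2" using s1(2) s2(2) by (rule low_trans) simp
    moreover have "nvar s2 (reg d) = v" using lowD[OF s2(2), of d] s1(3) by simp
    ultimately show "runs c'' s2 T'' Q" using s2 by (intro Q)
  qed simp
qed (use T in simp)

lemma runs_Seq4_computes:
  assumes c: "computes d c1 s0 T1 v1" "computes (d + 1) c2 s0 T2 v2"
      "computes (d + 2) c3 s0 T3 v3" "computes (d + 3) c4 s0 T4 v4" and s: "sim s s0"
    and Q: "\<And>s'. sim s' s0 \<Longrightarrow> low d s s' \<Longrightarrow> nvar s' (reg d) = v1 \<Longrightarrow> nvar s' (reg (d + 1)) = v2 \<Longrightarrow>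
      nvar s' (reg (d + 2)) = v3 \<Longrightarrow> nvar s' (reg (d + 3)) = v4 \<Longrightarrow> runs c' s' T' Q"
    and T: "T1 + T2 + T3 + T4 + T' \<le> T"
  shows "runs (Seq c1 (Seq c2 (Seq c3 (Seq c4 c')))) s T Q"
proof (rule runs_Seq2_computes[OF c(1,2) s])
  fix s1 assume s1: "sim s1 s0" "low d s s1" "nvar s1 (reg d) = v1" "nvar s1 (reg (d + 1)) = v2"
  have c4: "computes (d + 2 + 1) c4 s0 T4 v4" using c(4) by (simp add: numeral_3_eq_3)
  show "runs (Seq c3 (Seq c4 c')) s1 (T3 + T4 + T') Q"
  proof (rule runs_Seq2_computes[OF c(3) c4 s1(1)])
    fix s2 assume s2: "sim s2 s0" "low (d + 2) s1 s2" "nvar s2 (reg (d + 2)) = v3" "nvar s2 (reg (d + 2 + 1)) = v4"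
    have "low d s s2" using s1(2) s2(2) by (rule low_trans) simp
    moreover have "nvar s2 (reg d) = v1" "nvar s2 (reg (d + 1)) = v2"
      using lowD[OF s2(2), of d] lowD[OF s2(2), of "d + 1"] s1(3,4) by simp_all
    moreover have "nvar s2 (reg (d + 3)) = v4" using s2(4) by (simp add: numeral_3_eq_3)
    ultimately show "runs c' s2 T' Q" using s2 by (intro Q)
  qed simp
qed (use T in simp)

lemma sim_rarr: "sim s s0 \<Longrightarrow> rarr s = rarr s0" and sim_narr: "sim s s0 \<Longrightarrow> narr s = narr s0"
  and sim_nvar: "sim s s0 \<Longrightarrow> user x \<Longrightarrow> nvar s x = nvar s0 x"
  by (auto simp: sim_def)

lemma tcomp_correct:
  "twf t \<Longrightarrow> nvar s0 ''m'' + nvar s0 ''n'' = N \<Longrightarrow> computes d (tcomp d t) s0 (poly (ttime t) N) (teval t s0)"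
proof (induction t arbitrary: d s0)
  case (TC c)
  show ?case unfolding computes_def by (auto intro!: runs_AssignNVar)
next
  case (TV x)
  then show ?case unfolding computes_def by (auto intro!: runs_AssignNVar simp: sim_def)
next
  case (TA a t u)
  have 1: "computes d (tcomp d t) s0 (poly (ttime t) N) (teval t s0)"
    "computes (d + 1) (tcomp (d + 1) u) s0 (poly (ttime u) N) (teval u s0)"
    using TA by auto
  show ?case unfolding computes_def tcomp.simps
    apply (intro allI impI)
    apply (rule runs_Seq2_computes[OF 1], assumption)
     apply (rule runs_AssignNVar)
      apply (auto simp: sim_narr)
    done
next
  case (TAdd t u)
  have 1: "computes d (tcomp d t) s0 (poly (ttime t) N) (teval t s0)"
    "computes (d + 1) (tcomp (d + 1) u) s0 (poly (ttime u) N) (teval u s0)"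
    using TAdd by auto
  show ?case unfolding computes_def tcomp.simps
    apply (intro allI impI)
    apply (rule runs_Seq2_computes[OF 1], assumption)
     apply (rule runs_AssignNVar)
      apply (auto simp: sim_narr)
    done
next
  case (TSub t u)
  have 1: "computes d (tcomp d t) s0 (poly (ttime t) N) (teval t s0)"
    "computes (d + 1) (tcomp (d + 1) u) s0 (poly (ttime u) N) (teval u s0)"
    using TSub by auto
  show ?case unfolding computes_def tcomp.simps
    apply (intro allI impI)
    apply (rule runs_Seq2_computes[OF 1], assumption)
     apply (rule runs_AssignNVar)
      apply (auto simp: sim_narr)
    done
next
  case (TLess t u)
  have 1: "computes d (tcomp d t) s0 (poly (ttime t) N) (teval t s0)"
    "computes (d + 1) (tcomp (d + 1) u) s0 (poly (ttime u) N) (teval u s0)"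
    using TLess by auto
  show ?case unfolding computes_def tcomp.simps
    apply (intro allI impI)
    apply (rule runs_Seq2_computes[OF 1], assumption)
     apply (rule runs_Cond[where ?T1.0 = 1]; (rule runs_AssignNVar)?)
         apply auto
    done
next
  case (TREq t u v w)
  have 1: "computes d (tcomp d t) s0 (poly (ttime t) N) (teval t s0)"
    "computes (d + 1) (tcomp (d + 1) u) s0 (poly (ttime u) N) (teval u s0)"
    "computes (d + 2) (tcomp (d + 2) v) s0 (poly (ttime v) N) (teval v s0)"
    "computes (d + 3) (tcomp (d + 3) w) s0 (poly (ttime w) N) (teval w s0)"
    using TREq by auto
  show ?case unfolding computes_def tcomp.simps
    apply (intro allI impI)
    apply (rule runs_Seq4_computes[OF 1], assumption)
     apply (rule runs_Cond[where ?T1.0 = 1]; (rule runs_AssignNVar)?)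
         apply (auto simp: sim_rarr)
    done
next
  case (TRC b t u)
  have 1: "computes d (tcomp d t) s0 (poly (ttime t) N) (teval t s0)"
    "computes (d + 1) (tcomp (d + 1) u) s0 (poly (ttime u) N) (teval u s0)"
    using TRC by auto
  show ?case unfolding computes_def tcomp.simps
    apply (intro allI impI)
    apply (rule runs_Seq2_computes[OF 1], assumption)
     apply (rule runs_Cond[where ?T1.0 = 1]; (rule runs_AssignNVar)?)
         apply (auto simp: sim_rarr)
    done
next
  case (TIf t u v)
  have 1: "computes d (tcomp d t) s0 (poly (ttime t) N) (teval t s0)"
    "computes d (tcomp d u) s0 (poly (ttime u) N) (teval u s0)"
    "computes d (tcomp d v) s0 (poly (ttime v) N) (teval v s0)"
    using TIf by auto
  show ?case unfolding computes_def tcomp.simps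
  proof (intro allI impI, rule runs_Seq_computes[OF 1(1)], assumption)
    fix s s' assume s: "sim s' s0" "low d s s'" "nvar s' (reg d) = teval t s0"
    show "runs (Cond (NLess (NConst 0) (RV d)) (tcomp d u) (tcomp d v)) s'
        (Suc (poly (ttime u) N + poly (ttime v) N))
        (\<lambda>s'. sim s' s0 \<and> low d s s' \<and> nvar s' (reg d) = teval (TIf t u v) s0)"
    proof (rule runs_Cond)
      assume "bval (NLess (NConst 0) (RV d)) s'"
      with s 1(2) show "runs (tcomp d u) s' (poly (ttime u) N + poly (ttime v) N)
          (\<lambda>s'. sim s' s0 \<and> low d s s' \<and> nvar s' (reg d) = teval (TIf t u v) s0)"
        unfolding computes_def by (auto intro: low_trans elim!: runs_mono)
    next
      assume "\<not> bval (NLess (NConst 0) (RV d)) s'"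
      with s 1(3) show "runs (tcomp d v) s' (poly (ttime u) N + poly (ttime v) N)
          (\<lambda>s'. sim s' s0 \<and> low d s s' \<and> nvar s' (reg d) = teval (TIf t u v) s0)"
        unfolding computes_def by (auto intro: low_trans elim!: runs_mono)
    qed simp
  qed simp
next
  case (TSum x e t)
  have x: "user x" "x \<noteq> ''m''" "x \<noteq> ''n''" using TSum.prems by auto
  have IH: "computes (d + 3) (tcomp (d + 3) t) (setv s0 x i) (poly (ttime t) N) (teval t (setv s0 x i))" for i
    using TSum.prems by (intro TSum.IH) auto
  define b where "b = nval (bexpr e) s0"
  let ?T = "poly (ttime t) N + 2"
  \<comment> \<open>The user variable \<open>x\<close> is the loop counter, so after i rounds the
    state resembles \<open>setv s0 x i\<close>, the state in which the next summand is
    evaluated.\<close>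
  define I where "I s i s' \<longleftrightarrow> sim s' (setv s0 x i) \<and> low d s s' \<and>
    nvar s' (reg d) = (\<Sum>j<i. teval t (setv s0 x j)) \<and> nvar s' (reg (d + 1)) = b \<and>
    nvar s' (reg (d + 2)) = nvar s0 x" for s i s'
  have body: "runs (Seq (tcomp (d + 3) t) (Seq (setr d (NAdd (RV d) (RV (d + 3))))
      (AssignNVar x (NAdd (NVar x) (NConst 1))))) s' ?T (I s (Suc i))" if I: "I s i s'" for s i s'
  proof (rule runs_Seq_computes[OF IH[of i]])
    show "sim s' (setv s0 x i)" using I by (simp add: I_def)
    fix s'' assume s'': "sim s'' (setv s0 x i)" "low (d + 3) s' s''" "nvar s'' (reg (d + 3)) = teval t (setv s0 x i)"
    have l: "low d s s''" using I s''(2) low_trans[of d s s' "d + 3" s''] by (simp add: I_def)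
    have xi: "nvar s'' x = i" using s''(1) x by (simp add: sim_def)
    have r: "nvar s'' (reg d) = nvar s' (reg d)" "nvar s'' (reg (d + 1)) = nvar s' (reg (d + 1))"
      "nvar s'' (reg (d + 2)) = nvar s' (reg (d + 2))"
      using s''(2) by (auto simp: low_def)
    let ?t = "setv (setv s'' (reg d) (nvar s'' (reg d) + nvar s'' (reg (d + 3)))) x (i + 1)"
    have "I s (Suc i) ?t"
      unfolding I_def
    proof (intro conjI)
      show "sim ?t (setv s0 x (Suc i))" using s''(1) by (auto simp: sim_def)
      show "low d s ?t" using l x by (auto simp: low_def)
      show "nvar ?t (reg d) = (\<Sum>j<Suc i. teval t (setv s0 x j))"
        using I s''(3) r x by (simp add: I_def)
      show "nvar ?t (reg (d + 1)) = b" "nvar ?t (reg (d + 2)) = nvar s0 x"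
        using I r x by (simp_all add: I_def)
    qed
    then show "runs (Seq (setr d (NAdd (RV d) (RV (d + 3)))) (AssignNVar x (NAdd (NVar x) (NConst 1)))) s'' 2 (I s (Suc i))"
      using xi x by (intro runs_Seq_AssignNVar[where T' = 1] runs_AssignNVar) simp_all
  qed simp
  show ?case unfolding computes_def tcomp.simps
  proof (intro allI impI)
    fix s assume s: "sim s s0"
    let ?s1 = "setv (setv (setv (setv s (reg d) 0) (reg (d + 1)) b) (reg (d + 2)) (nvar s0 x)) x 0"
    have I0: "I s 0 ?s1" using s x by (auto simp: I_def sim_def low_def)
    have loop: "runs (While (NLess (NVar x) (RV (d + 1))) (Seq (tcomp (d + 3) t) (Seq (setr d (NAdd (RV d) (RV (d + 3))))
      (AssignNVar x (NAdd (NVar x) (NConst 1)))))) ?s1 ((b - 0) * (?T + 1) + 1) (I s b)"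
      by (rule runs_While[where I = "I s", OF body _ I0]) (use x in \<open>auto simp: I_def sim_def\<close>)
    have last: "runs (AssignNVar x (RV (d + 2))) s' 1
        (\<lambda>s'. sim s' s0 \<and> low d s s' \<and> nvar s' (reg d) = teval (TSum x e t) s0)" if "I s b s'" for s'
      using that x by (intro runs_AssignNVar) (auto simp: I_def sim_def b_def low_def)
    have b: "nval (bexpr e) (setv s (reg d) 0) = b"
      using s unfolding b_def by (intro nval_bexpr_sim) simp
    have "b \<le> poly (bpoly e) N" unfolding b_def TSum.prems(2)[symmetric] by (rule nval_bexpr_le)
    then have T: "b * (?T + 1) \<le> poly (bpoly e) N * (?T + 1)" by (rule mult_le_mono1)
    show "runs (Seq (setr d (NConst 0)) (Seq (setr (d + 1) (bexpr e)) (Seq (setr (d + 2) (NVar x))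
     (Seq (AssignNVar x (NConst 0)) (Seq
       (While (NLess (NVar x) (RV (d + 1)))
         (Seq (tcomp (d + 3) t) (Seq (setr d (NAdd (RV d) (RV (d + 3)))) (AssignNVar x (NAdd (NVar x) (NConst 1))))))
       (AssignNVar x (RV (d + 2)))))))) s (poly (ttime (TSum x e t)) N)
        (\<lambda>s'. sim s' s0 \<and> low d s s' \<and> nvar s' (reg d) = teval (TSum x e t) s0)"
    proof (rule runs_mono)
      have x0: "nvar (setv (setv s (reg d) 0) (reg (d + 1)) b) x = nvar s0 x"
        using s x by (simp add: sim_def)
      show "runs (Seq (setr d (NConst 0)) (Seq (setr (d + 1) (bexpr e)) (Seq (setr (d + 2) (NVar x))
     (Seq (AssignNVar x (NConst 0)) (Seq
       (While (NLess (NVar x) (RV (d + 1)))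
         (Seq (tcomp (d + 3) t) (Seq (setr d (NAdd (RV d) (RV (d + 3)))) (AssignNVar x (NAdd (NVar x) (NConst 1))))))
       (AssignNVar x (RV (d + 2)))))))) s (1 + (1 + (1 + (1 + ((b * (?T + 1) + 1) + 1)))))
        (\<lambda>s'. sim s' s0 \<and> low d s s' \<and> nvar s' (reg d) = teval (TSum x e t) s0)"
        apply (rule runs_Seq_AssignNVar[where T' = "1 + (1 + (1 + ((b * (?T + 1) + 1) + 1)))"])
         apply (rule runs_Seq_AssignNVar[where T' = "1 + (1 + ((b * (?T + 1) + 1) + 1))"])
          apply (rule runs_Seq_AssignNVar[where T' = "1 + ((b * (?T + 1) + 1) + 1)"])
           apply (rule runs_Seq_AssignNVar[where T' = "(b * (?T + 1) + 1) + 1"])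
            prefer 2 apply simp
           prefer 2 apply simp
          prefer 2 apply simp
         prefer 2 apply simp
        apply (simp only: nval.simps b x0)
        apply (rule runs_Seq[OF runs_mono[OF loop] order_refl])
         apply simp
        apply (rule last, assumption)
        done
      show "1 + (1 + (1 + (1 + ((b * (?T + 1) + 1) + 1)))) \<le> poly (ttime (TSum x e t)) N"
        using T by (simp add: algebra_simps)
    qed
  qed
qed

section \<open>Commands with counting loops\<close>

datatype hcom =
    HSetV string tm
  | HSetA string tm tm tm
  | HSetR string tm tm tm tm
  | HSeq hcom hcom
  | HIf tm hcom
  | HFor string bound hcom

primrec iter :: "(nat \<Rightarrow> 'a \<Rightarrow> 'a) \<Rightarrow> nat \<Rightarrow> 'a \<Rightarrow> 'a" where
  "iter f 0 s = s"
| "iter f (Suc n) s = f n (iter f n s)"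

primrec hsem :: "hcom \<Rightarrow> state \<Rightarrow> state" where
  "hsem (HSetV x t) = (\<lambda>s. setv s x (teval t s))"
| "hsem (HSetA a t u v) = (\<lambda>s. s\<lparr>narr := upd2 (narr s) a (teval t s) (teval u s) (teval v s)\<rparr>)"
| "hsem (HSetR a t u v w) =
     (\<lambda>s. s\<lparr>rarr := upd2 (rarr s) a (teval t s) (teval u s) (rarr s ''S'' (teval v s) (teval w s))\<rparr>)"
| "hsem (HSeq c c') = (\<lambda>s. hsem c' (hsem c s))"
| "hsem (HIf t c) = (\<lambda>s. if teval t s \<noteq> 0 then hsem c s else s)"
| "hsem (HFor x e c) = (\<lambda>s. iter (\<lambda>i s. hsem c (setv s x i)) (nval (bexpr e) s) s)"

fun hwf :: "hcom \<Rightarrow> bool" where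
  "hwf (HSetV x t) = (user x \<and> x \<noteq> ''m'' \<and> x \<noteq> ''n'' \<and> twf t)"
| "hwf (HSetA a t u v) = (twf t \<and> twf u \<and> twf v)"
| "hwf (HSetR a t u v w) = (twf t \<and> twf u \<and> twf v \<and> twf w)"
| "hwf (HSeq c c') = (hwf c \<and> hwf c')"
| "hwf (HIf t c) = (twf t \<and> hwf c)"
| "hwf (HFor x e c) = (user x \<and> x \<noteq> ''m'' \<and> x \<noteq> ''n'' \<and> hwf c)"

text \<open>A loop counts in register d and copies the counter into \<open>x\<close> at the start of
  each round, so the body may overwrite \<open>x\<close>; the bound is evaluated once. The constant
  evaluated into register d + 3 pads the assignment to a natural array to four terms, so that
  \<open>runs_Seq4_computes\<close> serves both kinds of array assignment.\<close>

fun hcomp :: "nat \<Rightarrow> hcom \<Rightarrow> com" where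
  "hcomp d (HSetV x t) = Seq (tcomp d t) (AssignNVar x (RV d))"
| "hcomp d (HSetA a t u v) = Seq (tcomp d t) (Seq (tcomp (d + 1) u) (Seq (tcomp (d + 2) v)
     (Seq (tcomp (d + 3) (TC 0)) (AssignNArr a (RV d) (RV (d + 1)) (RV (d + 2))))))"
| "hcomp d (HSetR a t u v w) = Seq (tcomp d t) (Seq (tcomp (d + 1) u) (Seq (tcomp (d + 2) v)
     (Seq (tcomp (d + 3) w) (AssignRArr a (RV d) (RV (d + 1)) (RArr ''S'' (RV (d + 2)) (RV (d + 3)))))))"
| "hcomp d (HSeq c c') = Seq (hcomp d c) (hcomp d c')"
| "hcomp d (HIf t c) = Seq (tcomp d t) (Cond (NLess (NConst 0) (RV d)) (hcomp d c) Skip)"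
| "hcomp d (HFor x e c) = Seq (setr d (NConst 0)) (Seq (setr (d + 1) (bexpr e))
     (While (NLess (RV d) (RV (d + 1)))
       (Seq (AssignNVar x (RV d)) (Seq (hcomp (d + 2) c) (setr d (NAdd (RV d) (NConst 1)))))))"

fun htime :: "hcom \<Rightarrow> nat poly" where
  "htime (HSetV x t) = ttime t + [:1:]"
| "htime (HSetA a t u v) = ttime t + ttime u + ttime v + [:2:]"
| "htime (HSetR a t u v w) = ttime t + ttime u + ttime v + ttime w + [:1:]"
| "htime (HSeq c c') = htime c + htime c'"
| "htime (HIf t c) = ttime t + htime c + [:2:]"
| "htime (HFor x e c) = bpoly e * (htime c + [:3:]) + [:3:]"

text \<open>As m and n keep their values, the time polynomials of consecutive commands and of all
  rounds of a loop are evaluated at the same number.\<close>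

lemma hsem_mn:
  "hwf c \<Longrightarrow> nvar (hsem c s) ''m'' = nvar s ''m'' \<and> nvar (hsem c s) ''n'' = nvar s ''n''"
proof (induction c arbitrary: s)
  case (HFor x e c)
  have "nvar (iter (\<lambda>i s. hsem c (setv s x i)) b s) ''m'' = nvar s ''m'' \<and>
      nvar (iter (\<lambda>i s. hsem c (setv s x i)) b s) ''n'' = nvar s ''n''" for b
    using HFor by (induction b) auto
  then show ?case by simp
qed auto

lemma hcomp_correct:
  "hwf c \<Longrightarrow> nvar s0 ''m'' + nvar s0 ''n'' = N \<Longrightarrow> sim s s0 \<Longrightarrow>
     runs (hcomp d c) s (poly (htime c) N) (\<lambda>s'. sim s' (hsem c s0) \<and> low d s s')"
proof (induction c arbitrary: d s s0)
  case (HSetV x t)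
  have 1: "computes d (tcomp d t) s0 (poly (ttime t) N) (teval t s0)"
    using HSetV.prems by (intro tcomp_correct) auto
  show ?case unfolding hcomp.simps
  proof (rule runs_Seq_computes[OF 1 HSetV.prems(3)])
    fix s' assume s': "sim s' s0" "low d s s'" "nvar s' (reg d) = teval t s0"
    then show "runs (AssignNVar x (RV d)) s' 1 (\<lambda>s'. sim s' (hsem (HSetV x t) s0) \<and> low d s s')"
      using HSetV.prems(1) by (intro runs_AssignNVar) (auto intro: sim_setv)
  qed simp
next
  case (HSetA a t u v)
  have 1: "computes d (tcomp d t) s0 (poly (ttime t) N) (teval t s0)"
    "computes (d + 1) (tcomp (d + 1) u) s0 (poly (ttime u) N) (teval u s0)"
    "computes (d + 2) (tcomp (d + 2) v) s0 (poly (ttime v) N) (teval v s0)"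
    "computes (d + 3) (tcomp (d + 3) (TC 0)) s0 (poly (ttime (TC 0)) N) (teval (TC 0) s0)"
    using HSetA.prems by (intro tcomp_correct; simp)+
  show ?case unfolding hcomp.simps
  proof (rule runs_Seq4_computes[OF 1 HSetA.prems(3)])
    fix s' assume s': "sim s' s0" "low d s s'" "nvar s' (reg d) = teval t s0"
      "nvar s' (reg (d + 1)) = teval u s0" "nvar s' (reg (d + 2)) = teval v s0"
    then show "runs (AssignNArr a (RV d) (RV (d + 1)) (RV (d + 2))) s' 1
        (\<lambda>s'. sim s' (hsem (HSetA a t u v) s0) \<and> low d s s')"
      by (intro runs_AssignNArr) (auto simp: sim_def low_def)
  qed simp
next
  case (HSetR a t u v w)
  have 1: "computes d (tcomp d t) s0 (poly (ttime t) N) (teval t s0)"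
    "computes (d + 1) (tcomp (d + 1) u) s0 (poly (ttime u) N) (teval u s0)"
    "computes (d + 2) (tcomp (d + 2) v) s0 (poly (ttime v) N) (teval v s0)"
    "computes (d + 3) (tcomp (d + 3) w) s0 (poly (ttime w) N) (teval w s0)"
    using HSetR.prems by (intro tcomp_correct; simp)+
  show ?case unfolding hcomp.simps
  proof (rule runs_Seq4_computes[OF 1 HSetR.prems(3)])
    fix s' assume s': "sim s' s0" "low d s s'" "nvar s' (reg d) = teval t s0"
      "nvar s' (reg (d + 1)) = teval u s0" "nvar s' (reg (d + 2)) = teval v s0" "nvar s' (reg (d + 3)) = teval w s0"
    then show "runs (AssignRArr a (RV d) (RV (d + 1)) (RArr ''S'' (RV (d + 2)) (RV (d + 3)))) s' 1
        (\<lambda>s'. sim s' (hsem (HSetR a t u v w) s0) \<and> low d s s')"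
      by (intro runs_AssignRArr) (auto simp: sim_def low_def)
  qed simp
next
  case (HSeq c c')
  have mn: "nvar (hsem c s0) ''m'' + nvar (hsem c s0) ''n'' = N"
    using HSeq.prems hsem_mn[of c s0] by simp
  show ?case unfolding hcomp.simps
  proof (rule runs_Seq[OF runs_mono])
    show "runs (hcomp d c) s (poly (htime c) N) (\<lambda>s'. sim s' (hsem c s0) \<and> low d s s')"
      using HSeq.prems by (intro HSeq.IH(1)) auto
    fix s' assume s': "sim s' (hsem c s0) \<and> low d s s'"
    have "runs (hcomp d c') s' (poly (htime c') N) (\<lambda>s''. sim s'' (hsem c' (hsem c s0)) \<and> low d s' s'')"
      using HSeq.prems mn s' by (intro HSeq.IH(2)) auto
    then show "runs (hcomp d c') s' (poly (htime c') N) (\<lambda>s''. sim s'' (hsem (HSeq c c') s0) \<and> low d s s'')"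
      by (rule runs_mono) (use s' low_trans[of d s s' d] in auto)
  qed auto
next
  case (HIf t c)
  have 1: "computes d (tcomp d t) s0 (poly (ttime t) N) (teval t s0)"
    using HIf.prems by (intro tcomp_correct) auto
  show ?case unfolding hcomp.simps
  proof (rule runs_Seq_computes[OF 1 HIf.prems(3)])
    fix s' assume s': "sim s' s0" "low d s s'" "nvar s' (reg d) = teval t s0"
    show "runs (Cond (NLess (NConst 0) (RV d)) (hcomp d c) Skip) s' (Suc (poly (htime c) N + 1))
        (\<lambda>s'. sim s' (hsem (HIf t c) s0) \<and> low d s s')"
    proof (rule runs_Cond)
      assume "bval (NLess (NConst 0) (RV d)) s'"
      then have "hsem (HIf t c) s0 = hsem c s0" using s' by simp
      moreover have "runs (hcomp d c) s' (poly (htime c) N) (\<lambda>s''. sim s'' (hsem c s0) \<and> low d s' s'')"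
        using HIf.prems s' by (intro HIf.IH) auto
      ultimately show "runs (hcomp d c) s' (poly (htime c) N + 1) (\<lambda>s'. sim s' (hsem (HIf t c) s0) \<and> low d s s')"
        using s' low_trans[of d s s' d] by (auto elim!: runs_mono)
    next
      assume "\<not> bval (NLess (NConst 0) (RV d)) s'"
      then show "runs Skip s' (poly (htime c) N + 1) (\<lambda>s'. sim s' (hsem (HIf t c) s0) \<and> low d s s')"
        using s' by (intro runs_Skip) auto
    qed simp
  qed simp
next
  case (HFor x e c)
  have x: "user x" "x \<noteq> ''m''" "x \<noteq> ''n''" "hwf c" using HFor.prems by auto
  define f where "f i s = hsem c (setv s x i)" for i s
  define b where "b = nval (bexpr e) s0"
  let ?T = "poly (htime c) N + 2"
  have mn: "nvar (iter f i s0) ''m'' = nvar s0 ''m'' \<and> nvar (iter f i s0) ''n'' = nvar s0 ''n''" for i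
    using x hsem_mn[OF x(4)] by (induction i) (auto simp: f_def)
  define I where "I i s' \<longleftrightarrow> sim s' (iter f i s0) \<and> low d s s' \<and> nvar s' (reg d) = i \<and> nvar s' (reg (d + 1)) = b" for i s'
  have body: "runs (Seq (AssignNVar x (RV d)) (Seq (hcomp (d + 2) c) (setr d (NAdd (RV d) (NConst 1))))) s' ?T (I (Suc i))"
    if I: "I i s'" for i s'
  proof (rule runs_Seq_AssignNVar[where T' = "poly (htime c) N + 1"])
    let ?s = "setv s' x (nval (RV d) s')"
    have i: "nval (RV d) s' = i" using I by (simp add: I_def)
    have "runs (hcomp (d + 2) c) ?s (poly (htime c) N) (\<lambda>s''. sim s'' (hsem c (setv (iter f i s0) x i)) \<and> low (d + 2) ?s s'')"
      unfolding i using x mn[of i] I HFor.prems(2) by (intro HFor.IH sim_setv) (auto simp: I_def)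
    then show "runs (Seq (hcomp (d + 2) c) (setr d (NAdd (RV d) (NConst 1)))) ?s (poly (htime c) N + 1) (I (Suc i))"
    proof (rule runs_Seq')
      fix s'' assume s'': "sim s'' (hsem c (setv (iter f i s0) x i)) \<and> low (d + 2) ?s s''"
      have "low d s s''"
        using I s'' low_trans[of d s ?s "d + 2" s''] x by (simp add: I_def)
      moreover have "nvar s'' (reg d) = i" "nvar s'' (reg (d + 1)) = b"
        using I s'' x by (auto simp: I_def low_def)
      ultimately show "runs (setr d (NAdd (RV d) (NConst 1))) s'' 1 (I (Suc i))"
        using s'' by (intro runs_AssignNVar) (auto simp: I_def f_def)
    qed simp
  qed simp
  let ?s1 = "setv (setv s (reg d) 0) (reg (d + 1)) b"
  have I0: "I 0 ?s1" using HFor.prems(3) by (auto simp: I_def sim_def low_def)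
  have loop: "runs (While (NLess (RV d) (RV (d + 1))) (Seq (AssignNVar x (RV d)) (Seq (hcomp (d + 2) c)
      (setr d (NAdd (RV d) (NConst 1)))))) ?s1 ((b - 0) * (?T + 1) + 1) (I b)"
    by (rule runs_While[where I = I, OF body _ I0]) (auto simp: I_def)
  have b: "nval (bexpr e) (setv s (reg d) 0) = b"
    using HFor.prems(3) unfolding b_def by (intro nval_bexpr_sim) simp
  have "b \<le> poly (bpoly e) N" unfolding b_def HFor.prems(2)[symmetric] by (rule nval_bexpr_le)
  then have T: "b * (?T + 1) \<le> poly (bpoly e) N * (?T + 1)" by (rule mult_le_mono1)
  show ?case unfolding hcomp.simps
  proof (rule runs_Seq_AssignNVar[where T' = "Suc (b * (?T + 1) + 1)"])
    have "runs (While (NLess (RV d) (RV (d + 1))) (Seq (AssignNVar x (RV d)) (Seq (hcomp (d + 2) c)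
      (setr d (NAdd (RV d) (NConst 1)))))) ?s1 (b * (?T + 1) + 1) (\<lambda>s'. sim s' (hsem (HFor x e c) s0) \<and> low d s s')"
      by (rule runs_mono[OF loop]) (auto simp: I_def b_def f_def[abs_def])
    then show "runs (Seq (setr (d + 1) (bexpr e)) (While (NLess (RV d) (RV (d + 1))) (Seq (AssignNVar x (RV d))
        (Seq (hcomp (d + 2) c) (setr d (NAdd (RV d) (NConst 1))))))) (setv s (reg d) (nval (NConst 0) s))
        (Suc (b * (?T + 1) + 1)) (\<lambda>s'. sim s' (hsem (HFor x e c) s0) \<and> low d s s')"
      by (intro runs_Seq_AssignNVar[where T' = "b * (?T + 1) + 1"]) (simp_all only: nval.simps b order_refl)
    show "Suc (Suc (b * (?T + 1) + 1)) \<le> poly (htime (HFor x e c)) N"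
      using T by (simp add: algebra_simps)
  qed
qed

section \<open>The test of a guess as a term\<close>

abbreviation S_of :: "state \<Rightarrow> nat \<Rightarrow> nat \<Rightarrow> real" where "S_of s \<equiv> rarr s ''S''"
abbreviation m_of :: "state \<Rightarrow> nat" where "m_of s \<equiv> nvar s ''m''"
abbreviation n_of :: "state \<Rightarrow> nat" where "n_of s \<equiv> nvar s ''n''"

definition X_of :: "state \<Rightarrow> nat \<Rightarrow> nat" where "X_of s t = narr s ''X'' t 0"
definition A_of :: "state \<Rightarrow> nat set" where "A_of s = {i. i < m_of s \<and> narr s ''A'' i 0 \<noteq> 0}"
abbreviation Z_of :: "nat \<Rightarrow> state \<Rightarrow> nat set" where "Z_of k s \<equiv> X_of s ` {..<k - 1}"

abbreviation holds :: "tm \<Rightarrow> state \<Rightarrow> bool" where "holds t s \<equiv> 0 < teval t s"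

abbreviation same_input :: "state \<Rightarrow> state \<Rightarrow> bool" where
  "same_input s' s \<equiv> S_of s' = S_of s \<and> m_of s' = m_of s \<and> n_of s' = n_of s \<and> X_of s' = X_of s"

lemma X_of_nvar_update [simp]: "X_of (s\<lparr>nvar := f\<rparr>) = X_of s"
  by (simp add: X_of_def fun_eq_iff)

lemma A_of_nvar_update [simp]: "f ''m'' = m_of s \<Longrightarrow> A_of (s\<lparr>nvar := f\<rparr>) = A_of s"
  by (simp add: A_of_def)

lemma pos_if [simp]: "0 < (if P then Suc 0 else 0) \<longleftrightarrow> P"
  by simp

definition tTrue where "tTrue = TC 1"
definition tNot where "tNot t = TIf t (TC 0) (TC 1)"
definition tAnd where "tAnd t u = TIf t u (TC 0)"
definition tOr where "tOr t u = TIf t (TC 1) u"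
definition tImp where "tImp t u = TIf t u (TC 1)"
definition tEq where "tEq t u = TIf (TLess t u) (TC 0) (TIf (TLess u t) (TC 0) (TC 1))"
definition tAll where "tAll x e t = tNot (TSum x e (tNot t))"
text \<open>A sum of natural numbers is positive exactly when some summand is.\<close>

definition tEx :: "string \<Rightarrow> bound \<Rightarrow> tm \<Rightarrow> tm" where "tEx x e t = TSum x e t"
definition tCount where "tCount x e t = TSum x e (TIf t (TC 1) (TC 0))"

lemmas t_defs = tNot_def tAnd_def tOr_def tImp_def tEq_def tAll_def tEx_def tCount_def

lemma holds_simps [simp]:
  "holds tTrue s"
  "holds (tNot t) s \<longleftrightarrow> \<not> holds t s"
  "holds (tAnd t u) s \<longleftrightarrow> holds t s \<and> holds u s"
  "holds (tOr t u) s \<longleftrightarrow> holds t s \<or> holds u s"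
  "holds (tImp t u) s \<longleftrightarrow> (holds t s \<longrightarrow> holds u s)"
  "holds (tEq t u) s \<longleftrightarrow> teval t s = teval u s"
  "holds (TLess t u) s \<longleftrightarrow> teval t s < teval u s"
  by (auto simp: t_defs tTrue_def)

lemma holds_tEx [simp]: "holds (tEx x e t) s \<longleftrightarrow> (\<exists>i<nval (bexpr e) s. holds t (setv s x i))"
  unfolding tEx_def teval.simps neq0_conv[symmetric] by (simp only: sum_eq_0_iff finite_lessThan) auto

lemma holds_tAll [simp]: "holds (tAll x e t) s \<longleftrightarrow> (\<forall>i<nval (bexpr e) s. holds t (setv s x i))"
  by (auto simp: tAll_def tNot_def)

lemma holds_TR [simp]:
  "holds (TREq t u v w) s \<longleftrightarrow> S_of s (teval t s) (teval u s) = S_of s (teval v s) (teval w s)"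
  "holds (TRC b t u) s \<longleftrightarrow> S_of s (teval t s) (teval u s) = (if b then 1 else 0)"
  by auto

lemma teval_tCount [simp]: "teval (tCount x e t) s = card {i. i < nval (bexpr e) s \<and> holds t (setv s x i)}"
proof -
  have "teval (tCount x e t) s = (\<Sum>i<nval (bexpr e) s. if holds t (setv s x i) then 1 else 0)"
    by (simp add: tCount_def cong: if_cong)
  also have "\<dots> = card ({..<nval (bexpr e) s} \<inter> {i. holds t (setv s x i)})"
    by (simp add: sum.If_cases)
  also have "{..<nval (bexpr e) s} \<inter> {i. holds t (setv s x i)} = {i. i < nval (bexpr e) s \<and> holds t (setv s x i)}"
    by auto
  finally show ?thesis .
qed

lemma sum_if_const:
  fixes n :: nat
  shows "(\<Sum>i<n. if P i then c else 0) = card {i. i < n \<and> P i} * (c::nat)"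
proof -
  have "{..<n} \<inter> {i. P i} = {i. i < n \<and> P i}" by auto
  then show ?thesis by (simp add: sum.If_cases)
qed

definition tX where "tX t = TA ''X'' t (TC 0)"
definition tA where "tA x = TA ''A'' (TV x) (TC 0)"
text \<open>Bound variables have fixed names. The inequalities between variable names in the lemmas
  below exclude capture.\<close>

definition tSpec where "tSpec k x = tEx ''t'' (BConst (k - 1)) (tEq (tX (TV ''t'')) (TV x))"

lemma teval_tX [simp]: "teval (tX t) s = X_of s (teval t s)"
  by (simp add: tX_def X_of_def)

lemma holds_tA: "nvar s x < m_of s \<Longrightarrow> holds (tA x) s \<longleftrightarrow> nvar s x \<in> A_of s"
  by (simp add: tA_def A_of_def)

lemma holds_tSpec [simp]: "x \<noteq> ''t'' \<Longrightarrow> holds (tSpec k x) s \<longleftrightarrow> nvar s x \<in> Z_of k s"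
  by (auto simp: tSpec_def intro!: image_eqI[OF sym])

definition tAgree where
  "tAgree cond c d = tAll ''i'' BRows (tImp cond (TREq (TV ''i'') (TV c) (TV ''i'') (TV d)))"

lemma holds_tAgree:
  assumes "c \<noteq> ''i''" "d \<noteq> ''i''" "\<And>i. i < m_of s \<Longrightarrow> holds cond (setv s ''i'' i) \<longleftrightarrow> i \<in> R" "R \<subseteq> {..<m_of s}"
  shows "holds (tAgree cond c d) s \<longleftrightarrow> agree (S_of s) R (nvar s c) (nvar s d)"
  using assms by (auto simp: tAgree_def agree_def)

definition tZ where "tZ k = tSpec k ''i''"
definition tRA where "tRA k = tOr (tA ''i'') (tSpec k ''i'')"
definition tRB where "tRB = tNot (tA ''i'')"

lemma holds_agree [simp]:
  assumes "c \<noteq> ''i''" "d \<noteq> ''i''"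
  shows "holds (tAgree tTrue c d) s \<longleftrightarrow> agree (S_of s) {..<m_of s} (nvar s c) (nvar s d)"
    and "holds (tAgree tRB c d) s \<longleftrightarrow> agree (S_of s) ({..<m_of s} - A_of s) (nvar s c) (nvar s d)"
    and "Z_of k s \<subseteq> {..<m_of s} \<Longrightarrow>
      holds (tAgree (tZ k) c d) s \<longleftrightarrow> agree (S_of s) (Z_of k s) (nvar s c) (nvar s d)"
    and "Z_of k s \<subseteq> {..<m_of s} \<Longrightarrow>
      holds (tAgree (tRA k) c d) s \<longleftrightarrow> agree (S_of s) (A_of s \<union> Z_of k s) (nvar s c) (nvar s d)"
proof -
  show "holds (tAgree tTrue c d) s \<longleftrightarrow> agree (S_of s) {..<m_of s} (nvar s c) (nvar s d)"
    by (rule holds_tAgree[OF assms]) auto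
  show "holds (tAgree tRB c d) s \<longleftrightarrow> agree (S_of s) ({..<m_of s} - A_of s) (nvar s c) (nvar s d)"
    by (rule holds_tAgree[OF assms]) (auto simp: tRB_def holds_tA)
  assume Z: "Z_of k s \<subseteq> {..<m_of s}"
  show "holds (tAgree (tZ k) c d) s \<longleftrightarrow> agree (S_of s) (Z_of k s) (nvar s c) (nvar s d)"
    by (rule holds_tAgree[OF assms _ Z]) (simp add: tZ_def)
  show "holds (tAgree (tRA k) c d) s \<longleftrightarrow> agree (S_of s) (A_of s \<union> Z_of k s) (nvar s c) (nvar s d)"
    by (rule holds_tAgree[OF assms]) (use Z in \<open>auto simp: tRA_def holds_tA A_of_def\<close>)
qed

definition tSame where
  "tSame x c d = TREq (TV x) (TV c) (TV x) (TV d)"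

lemma holds_tSame [simp]: "holds (tSame x c d) s \<longleftrightarrow> S_of s (nvar s x) (nvar s c) = S_of s (nvar s x) (nvar s d)"
  by (simp add: tSame_def)

text \<open>Program form of \<open>pair_match\<close>: the variables ''c'', ''e'' hold its columns
  \<open>c\<close>, \<open>c'\<close>, and ''d'', ''f'' hold \<open>d\<close>, \<open>d'\<close>;
  the entries of row y are taken from \<open>u\<close>, \<open>u'\<close>.\<close>

definition tMatch where
  "tMatch u u' = tAnd (tSame ''x'' ''d'' ''c'') (tAnd (tSame ''x'' ''f'' ''e'') (tAnd (tSame ''y'' ''d'' u) (tAnd (tSame ''y'' ''f'' u')
     (tAll ''i'' BRows (tImp (tNot (tEq (TV ''i'') (TV ''x''))) (tImp (tNot (tEq (TV ''i'') (TV ''y'')))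
       (tOr (tAnd (tSame ''i'' ''d'' ''c'') (tSame ''i'' ''f'' ''e'')) (tAnd (tSame ''i'' ''d'' ''e'') (tSame ''i'' ''f'' ''c'')))))))))"

definition tIndep where
  "tIndep k = tAll ''c'' BCols (tAll ''e'' BCols (tImp (tAgree (tZ k) ''c'' ''e'')
     (tEq (TSum ''d'' BCols (tCount ''f'' BCols (tMatch ''c'' ''e''))) (TSum ''d'' BCols (tCount ''f'' BCols (tMatch ''e'' ''c''))))))"

lemma sum_card_pairs:
  fixes n :: nat
  shows "(\<Sum>d<n. card {f. f < n \<and> P d f}) = card {(d, f). d < n \<and> f < n \<and> P d f}"
proof -
  have "{(d, f). d < n \<and> f < n \<and> P d f} = (SIGMA d:{..<n}. {f. f < n \<and> P d f})" by auto
  then show ?thesis by (simp add: card_SigmaI)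
qed

lemma holds_tIndep:
  assumes "Z_of k s \<subseteq> {..<m_of s}"
  shows "holds (tIndep k) s \<longleftrightarrow> indep_rows (S_of s) (m_of s) (n_of s) (Z_of k s) (nvar s ''x'') (nvar s ''y'')"
  using assms by (simp add: tIndep_def tMatch_def indep_rows_def pair_match_def sum_card_pairs)

definition tMark where
  "tMark k c = tAll ''t'' (BConst (k - 1)) (TIf (tEq (TAdd (TV ''t'') (TC 1)) (TV ''j''))
     (TRC True (tX (TV ''t'')) (TV c)) (TRC False (tX (TV ''t'')) (TV c)))"

lemma holds_TIf: "holds (TIf t u v) s \<longleftrightarrow> (if holds t s then holds u s else holds v s)"
  by simp

lemma holds_tMark [simp]:
  "c \<noteq> ''t'' \<Longrightarrow> holds (tMark k c) s \<longleftrightarrow> marked k (\<lambda>t. S_of s (X_of s t) (nvar s c)) (nvar s ''j'')"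
proof -
  assume c: "c \<noteq> ''t''"
  have "holds (TIf (tEq (TAdd (TV ''t'') (TC 1)) (TV ''j'')) (TRC True (tX (TV ''t'')) (TV c))
      (TRC False (tX (TV ''t'')) (TV c))) (setv s ''t'' t) \<longleftrightarrow>
      S_of s (X_of s t) (nvar s c) = (if Suc t = nvar s ''j'' then 1 else 0)" for t
    unfolding holds_TIf using c by simp
  then show ?thesis unfolding tMark_def marked_def holds_tAll by simp
qed

definition tWeight where
  "tWeight k off c = TSum ''j'' (BConst k) (TIf (tMark k c) (tX (TAdd (TC off) (TV ''j''))) (TC 0))"

lemma teval_tWeight [simp]:
  "c \<noteq> ''t'' \<Longrightarrow> c \<noteq> ''j'' \<Longrightarrow> teval (tWeight k off c) s = weight k (S_of s) (X_of s) off (nvar s c)"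
  by (simp add: tWeight_def weight_def cong: if_cong)

text \<open>Programs cannot multiply, so the product of a rank and a weight in \<open>keep\<close>
  is computed by adding the weight once for each earlier column of the class.\<close>

definition tKeep where
  "tKeep k cond off c = TLess
     (TSum ''d'' BCols (TIf (tAnd (TLess (TV ''d'') (TV c)) (tAgree cond c ''d'')) (tWeight k off c) (TC 0)))
     (tCount ''d'' BCols (tAgree cond c ''d''))"

lemma holds_tKeep:
  assumes c: "c \<notin> {''t'', ''j'', ''d'', ''i''}"
    and "\<And>i. holds (tAgree cond c ''d'') (setv s ''d'' i) \<longleftrightarrow> agree (S_of s) R (nvar s c) i"
  shows "holds (tKeep k cond off c) s \<longleftrightarrow>
    keep (S_of s) (n_of s) R (weight k (S_of s) (X_of s) off) (nvar s c)"
proof -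
  have "teval (TSum ''d'' BCols (TIf (tAnd (TLess (TV ''d'') (TV c)) (tAgree cond c ''d'')) (tWeight k off c) (TC 0))) s =
      (\<Sum>d<n_of s. if d < nvar s c \<and> agree (S_of s) R (nvar s c) d
         then weight k (S_of s) (X_of s) off (nvar s c) else 0)"
    using c assms(2) by (simp cong: if_cong)
  also have "\<dots> = card {d. d < n_of s \<and> d < nvar s c \<and> agree (S_of s) R (nvar s c) d} *
      weight k (S_of s) (X_of s) off (nvar s c)"
    by (rule sum_if_const)
  finally show ?thesis using c assms(2) by (simp add: tKeep_def keep_def del: teval.simps(10))
qed

definition tKeep1 where "tKeep1 k c = tKeep k (tRA k) (2 * k - 1) c"
definition tKeep2 where "tKeep2 k c = tKeep k tRB (k - 1) c"

definition K1_of where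
  "K1_of k s = keep (S_of s) (n_of s) (A_of s \<union> Z_of k s) (weight k (S_of s) (X_of s) (2 * k - 1))"
definition K2_of where
  "K2_of k s = keep (S_of s) (n_of s) ({..<m_of s} - A_of s) (weight k (S_of s) (X_of s) (k - 1))"

lemma K_of_nvar_update [simp]:
  "f ''m'' = m_of s \<Longrightarrow> f ''n'' = n_of s \<Longrightarrow> K1_of k (s\<lparr>nvar := f\<rparr>) = K1_of k s"
  "f ''m'' = m_of s \<Longrightarrow> f ''n'' = n_of s \<Longrightarrow> K2_of k (s\<lparr>nvar := f\<rparr>) = K2_of k s"
  by (simp_all add: K1_of_def K2_of_def)

lemma holds_tKeep12 [simp]:
  assumes c: "c \<notin> {''t'', ''j'', ''d'', ''i''}"
  shows "Z_of k s \<subseteq> {..<m_of s} \<Longrightarrow> holds (tKeep1 k c) s \<longleftrightarrow> K1_of k s (nvar s c)"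
    and "holds (tKeep2 k c) s \<longleftrightarrow> K2_of k s (nvar s c)"
  unfolding tKeep1_def tKeep2_def K1_of_def K2_of_def
  by (rule holds_tKeep[OF c]; use c in simp)+

text \<open>The product of the two kept counts in \<open>splits\<close>, again as a sum: the second
  count is added once for each column counted by the first.\<close>

definition tProd where
  "tProd k cond1 cond2 = TSum ''a'' BCols (TIf (tAnd (tKeep1 k ''a'') (tAgree cond1 ''c'' ''a''))
     (tCount ''b'' BCols (tAnd (tKeep2 k ''b'') (tAgree cond2 ''c'' ''b''))) (TC 0))"

definition tCheck where
  "tCheck k = tAnd (tAll ''t'' (BConst (k - 1)) (TLess (tX (TV ''t'')) (TV ''m'')))
    (tAnd (TLess (tX (TC (3 * k - 1))) (TV ''m''))
    (tAnd (tAll ''t'' (BConst (k - 1)) (tNot (tEq (tX (TV ''t'')) (tX (TC (3 * k - 1))))))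
    (tAnd (tEx ''y'' BRows (tAnd (tNot (tA ''y'')) (tNot (tSpec k ''y''))))
    (tAnd (tAll ''c'' BCols (tEx ''j'' (BConst k) (tMark k ''c'')))
    (tAnd (tAll ''j'' (BConst k) (tEx ''c'' BCols (tMark k ''c'')))
    (tAnd (tAll ''c'' BCols (tEq (tCount ''e'' BCols (tAgree tTrue ''c'' ''e'')) (tProd k (tRA k) tRB)))
    (tAnd (tAll ''c'' BCols (tEq (tCount ''e'' BCols (tAgree (tZ k) ''c'' ''e'')) (tProd k (tZ k) (tZ k))))
    (if k \<ge> 2 then tAnd (TLess (tCount ''a'' BCols (tKeep1 k ''a'')) (TV ''n''))
       (TLess (tCount ''a'' BCols (tKeep2 k ''a'')) (TV ''n'')) else TC 1))))))))"

text \<open>The array ''A'' is known to hold the block only for guesses with admissible rows. For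
  other guesses both sides are false already because of the range conditions on the guess.\<close>

lemma holds_tCheck:
  assumes A: "Z_of k s \<subseteq> {..<m_of s} \<Longrightarrow> X_of s (3 * k - 1) < m_of s \<Longrightarrow> X_of s (3 * k - 1) \<notin> Z_of k s \<Longrightarrow>
      A_of s = row_block (S_of s) (m_of s) (n_of s) (Z_of k s) (X_of s (3 * k - 1)) \<and>
      A_of s \<subseteq> {..<m_of s} - Z_of k s"
  shows "holds (tCheck k) s \<longleftrightarrow> guess_ok k (S_of s) (m_of s) (n_of s) (X_of s)"
proof (cases "Z_of k s \<subseteq> {..<m_of s} \<and> X_of s (3 * k - 1) < m_of s \<and> X_of s (3 * k - 1) \<notin> Z_of k s")
  case False
  then have "\<not> guess_ok k (S_of s) (m_of s) (n_of s) (X_of s)"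
    by (auto simp: guess_ok_def splits_def Let_def)
  moreover have "\<not> holds (tCheck k) s" using False by (auto simp: tCheck_def)
  ultimately show ?thesis by simp
next
  case True
  then have Z: "Z_of k s \<subseteq> {..<m_of s}" and r: "X_of s (3 * k - 1) < m_of s" "X_of s (3 * k - 1) \<notin> Z_of k s" by blast+
  have A': "A_of s = row_block (S_of s) (m_of s) (n_of s) (Z_of k s) (X_of s (3 * k - 1))"
    "A_of s \<subseteq> {..<m_of s} - Z_of k s" "A_of s \<noteq> {}"
    using A[OF Z r] row_block_self[of "X_of s (3 * k - 1)" "S_of s" "m_of s" "n_of s" "Z_of k s"] by auto
  have Zc: "(\<forall>t<k - 1. X_of s t < m_of s) \<longleftrightarrow> True" "(\<forall>t<k - 1. X_of s t \<noteq> X_of s (3 * k - 1)) \<longleftrightarrow> True"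
  proof -
    have mem: "X_of s t \<in> Z_of k s" if "t < k - 1" for t using that by (intro imageI) simp
    show "(\<forall>t<k - 1. X_of s t < m_of s) \<longleftrightarrow> True" using mem Z by blast
    show "(\<forall>t<k - 1. X_of s t \<noteq> X_of s (3 * k - 1)) \<longleftrightarrow> True" using mem r(2) by metis
  qed
  have B: "(\<exists>i<m_of s. narr s ''A'' i 0 = 0 \<and> i \<notin> Z_of k s) \<longleftrightarrow> {..<m_of s} - Z_of k s - A_of s \<noteq> {}"
    by (auto simp: A_of_def)
  have "guess_ok k (S_of s) (m_of s) (n_of s) (X_of s) \<longleftrightarrow>
      splits k (S_of s) (m_of s) (n_of s) (X_of s) (A_of s) (K1_of k s) (K2_of k s)"
    unfolding guess_ok_def K1_of_def K2_of_def A'(1)[symmetric] Let_def using r by simp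
  also have "\<dots> \<longleftrightarrow> holds (tCheck k) s"
    unfolding splits_def tCheck_def using Z r Zc B A'(2,3)
    by (simp add: tProd_def tA_def sum_if_const conj_assoc cong: if_cong)
  finally show ?thesis by simp
qed

section \<open>Computing the block of a row\<close>

lemma iter_invariant:
  assumes "I 0 s" "\<And>i s. i < n \<Longrightarrow> I i s \<Longrightarrow> I (Suc i) (f i s)"
  shows "I n (iter f n s)"
proof -
  have "i \<le> n \<Longrightarrow> I i (iter f i s)" for i
    by (induction i) (use assms in auto)
  then show ?thesis by simp
qed

lemma hsem_HFor:
  assumes "I 0 s" "\<And>i s'. i < nval (bexpr e) s \<Longrightarrow> I i s' \<Longrightarrow> I (Suc i) (hsem c (setv s' x i))"
  shows "I (nval (bexpr e) s) (hsem (HFor x e c) s)"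
  unfolding hsem.simps using assms by (rule iter_invariant)

definition cInit where
  "cInit k = HFor ''y'' BRows (HSetA ''A'' (TV ''y'') (TC 0) (tEq (TV ''y'') (tX (TC (3 * k - 1)))))"

definition cStep where
  "cStep k = HSetA ''A'' (TV ''y'') (TC 0) (tOr (tA ''y'')
     (tAnd (tNot (tSpec k ''y'')) (tEx ''x'' BRows (tAnd (tA ''x'') (tNot (tIndep k))))))"

definition cClose where
  "cClose k = HFor ''q'' BRows (HFor ''y'' BRows (cStep k))"

lemma X_of_narr_A [simp]: "X_of (s\<lparr>narr := upd2 (narr s) ''A'' i j v\<rparr>) = X_of s"
  by (simp add: X_of_def fun_eq_iff upd2_def)

lemma X_of_nvar_narr_A [simp]: "X_of (s\<lparr>nvar := f, narr := upd2 (narr s) ''A'' i j v\<rparr>) = X_of s"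
  by (simp add: X_of_def fun_eq_iff upd2_def)

lemma A_of_update: "i < m_of s \<Longrightarrow>
    A_of (s\<lparr>narr := upd2 (narr s) ''A'' i 0 v\<rparr>) = (if v = 0 then A_of s - {i} else insert i (A_of s))"
  by (auto simp: A_of_def upd2_def)

definition same_env :: "state \<Rightarrow> state \<Rightarrow> bool" where
  "same_env s s' \<longleftrightarrow> rarr s' = rarr s \<and> m_of s' = m_of s \<and> n_of s' = n_of s \<and> X_of s' = X_of s \<and>
     nvar s' ''accept'' = nvar s ''accept''"

lemma cInit: "same_env s (hsem (cInit k) s)"
  "X_of s (3 * k - 1) < m_of s \<Longrightarrow> A_of (hsem (cInit k) s) = {X_of s (3 * k - 1)}"
proof -
  define I where "I i s' \<longleftrightarrow> same_env s s' \<and> A_of s' \<inter> {..<i} = {..<i} \<inter> {X_of s (3 * k - 1)}" for i s'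
  have "I (nval (bexpr BRows) s) (hsem (cInit k) s)"
    unfolding cInit_def
  proof (rule hsem_HFor)
    show "I 0 s" by (simp add: I_def same_env_def)
    fix i s' assume i: "i < nval (bexpr BRows) s" and I: "I i s'"
    let ?s = "hsem (HSetA ''A'' (TV ''y'') (TC 0) (tEq (TV ''y'') (tX (TC (3 * k - 1))))) (setv s' ''y'' i)"
    have im: "i < m_of s'" using i I by (simp add: I_def same_env_def)
    have "same_env s ?s" using I by (simp add: I_def same_env_def)
    moreover have "A_of ?s = (if i = X_of s (3 * k - 1) then insert i (A_of s') else A_of s' - {i})"
      using A_of_update[of i "setv s' ''y'' i"] im I by (auto simp: I_def same_env_def tEq_def)
    ultimately show "I (Suc i) ?s" using I unfolding I_def lessThan_Suc by auto
  qed
  moreover have "A_of (hsem (cInit k) s) \<subseteq> {..<m_of (hsem (cInit k) s)}" by (auto simp: A_of_def)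
  ultimately show "same_env s (hsem (cInit k) s)"
    "X_of s (3 * k - 1) < m_of s \<Longrightarrow> A_of (hsem (cInit k) s) = {X_of s (3 * k - 1)}"
    unfolding I_def by (auto simp: same_env_def)
qed

lemma cStep_env: "same_env s (hsem (cStep k) s)"
  by (simp add: cStep_def same_env_def)

text \<open>Stated for every guess, including those with rows out of range, because the closure runs
  before the guess is checked.\<close>

lemma cClose_env: "same_env s (hsem (cClose k) s)"
proof -
  have inner: "same_env t (hsem (HFor ''y'' BRows (cStep k)) t)" for t
  proof (rule hsem_HFor[where I = "\<lambda>_. same_env t"])
    fix i t' assume "same_env t t'"
    then show "same_env t (hsem (cStep k) (setv t' ''y'' i))"
      using cStep_env[of "setv t' ''y'' i" k] by (simp add: same_env_def)
  qed (simp add: same_env_def)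
  show ?thesis unfolding cClose_def
  proof (rule hsem_HFor[where I = "\<lambda>_. same_env s"])
    fix i t assume "same_env s t"
    then show "same_env s (hsem (HFor ''y'' BRows (cStep k)) (setv t ''q'' i))"
      using inner[of "setv t ''q'' i"] by (simp add: same_env_def del: hsem.simps)
  qed (simp add: same_env_def)
qed

lemma cStep:
  fixes k :: nat
  assumes Z: "Z_of k s \<subseteq> {..<m_of s}" and y: "nvar s ''y'' < m_of s"
  defines "y \<equiv> nvar s ''y''"
  shows "same_env s (hsem (cStep k) s)"
    "A_of (hsem (cStep k) s) = (if y \<notin> Z_of k s \<and>
       (\<exists>x\<in>A_of s. \<not> indep_rows (S_of s) (m_of s) (n_of s) (Z_of k s) x y) then insert y (A_of s) else A_of s)"
proof -
  let ?t = "tOr (tA ''y'') (tAnd (tNot (tSpec k ''y'')) (tEx ''x'' BRows (tAnd (tA ''x'') (tNot (tIndep k)))))"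
  have H: "hsem (cStep k) s = s\<lparr>narr := upd2 (narr s) ''A'' y 0 (teval ?t s)\<rparr>"
    by (simp add: cStep_def y_def)
  have T: "holds ?t s \<longleftrightarrow> y \<in> A_of s \<or> y \<notin> Z_of k s \<and>
      (\<exists>x\<in>A_of s. \<not> indep_rows (S_of s) (m_of s) (n_of s) (Z_of k s) x y)"
  proof -
    have "holds (tIndep k) (setv s ''x'' i) \<longleftrightarrow> indep_rows (S_of s) (m_of s) (n_of s) (Z_of k s) i y" for i
      using holds_tIndep[of "setv s ''x'' i" k] Z by (simp add: y_def)
    moreover have "holds (tA ''x'') (setv s ''x'' i) \<longleftrightarrow> i \<in> A_of s" if "i < m_of s" for i
      using holds_tA[of "setv s ''x'' i" "''x''"] that by simp
    ultimately have "(\<exists>i<m_of s. holds (tA ''x'') (setv s ''x'' i) \<and> \<not> holds (tIndep k) (setv s ''x'' i)) \<longleftrightarrow>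
        (\<exists>x\<in>A_of s. \<not> indep_rows (S_of s) (m_of s) (n_of s) (Z_of k s) x y)"
      by (auto simp: A_of_def)
    then show ?thesis using holds_tA[OF y] by (simp add: y_def)
  qed
  show "same_env s (hsem (cStep k) s)" unfolding H by (simp add: same_env_def)
  have U: "A_of (hsem (cStep k) s) = (if teval ?t s = 0 then A_of s - {y} else insert y (A_of s))"
    unfolding H using y by (intro A_of_update) (simp add: y_def)
  show "A_of (hsem (cStep k) s) = (if y \<notin> Z_of k s \<and>
       (\<exists>x\<in>A_of s. \<not> indep_rows (S_of s) (m_of s) (n_of s) (Z_of k s) x y) then insert y (A_of s) else A_of s)"
    (is "_ = (if ?c then _ else _)")
  proof (cases "holds ?t s")
    case True
    then have "A_of (hsem (cStep k) s) = insert y (A_of s)" unfolding U by (simp only: neq0_conv[symmetric] if_not_P if_False)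
    moreover have "y \<in> A_of s" if "\<not> ?c" using T True that by blast
    ultimately show ?thesis by (auto simp only: split: if_splits)
  next
    case False
    then have "A_of (hsem (cStep k) s) = A_of s - {y}" unfolding U by (simp only: neq0_conv[symmetric] not_not if_True refl)
    moreover have "y \<notin> A_of s" and c: "\<not> ?c" using T False by blast+
    moreover from this(1) have "A_of s - {y} = A_of s" by blast
    ultimately show ?thesis unfolding if_not_P[OF c] by (simp only:)
  qed
qed

text \<open>Each pass adds all rows that depend on a row already present. The set stays inside the
  block, which is closed, and as long as it is not closed itself a pass enlarges it. So m passes,
  starting from one row, reach a closed set, and a closed set that contains \<open>r\<close>
  contains the block.\<close>

lemma cClose:
  assumes Z: "Z_of k s \<subseteq> {..<m_of s}" and r: "r < m_of s" "r \<notin> Z_of k s" and A: "A_of s = {r}"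
  shows "same_env s (hsem (cClose k) s)"
    "A_of (hsem (cClose k) s) = row_block (S_of s) (m_of s) (n_of s) (Z_of k s) r"
    "A_of (hsem (cClose k) s) \<subseteq> {..<m_of s} - Z_of k s"
proof -
  let ?m = "m_of s" and ?Z = "Z_of k s"
  let ?ind = "indep_rows (S_of s) (m_of s) (n_of s) (Z_of k s)"
  define blk where "blk = row_block (S_of s) ?m (n_of s) ?Z r"
  define adj where "adj A = {y \<in> {..<?m} - ?Z. \<exists>x\<in>A. \<not> ?ind x y}" for A
  define ok where "ok s' \<longleftrightarrow> same_env s s' \<and> r \<in> A_of s' \<and> A_of s' \<subseteq> blk \<and> A_of s' \<subseteq> {..<?m} - ?Z" for s'
  have blk: "y \<in> blk" if "x \<in> blk" "y \<in> {..<?m} - ?Z" "\<not> ?ind x y" for x y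
    using row_block_closed[of x "S_of s" ?m "n_of s" ?Z r y] that unfolding blk_def by blast
  have step: "ok (hsem (cStep k) (setv s' ''y'' i)) \<and> A_of s' \<subseteq> A_of (hsem (cStep k) (setv s' ''y'' i)) \<and>
      (i \<in> adj (A_of s') \<longrightarrow> i \<in> A_of (hsem (cStep k) (setv s' ''y'' i))) \<and>
      A_of (hsem (cStep k) (setv s' ''y'' i)) \<subseteq> A_of s' \<union> adj (A_of s')"
    if ok: "ok s'" and i: "i < ?m" for s' i
  proof -
    let ?s = "setv s' ''y'' i"
    have e: "same_env s s'" using ok by (simp add: ok_def)
    then have "Z_of k ?s = ?Z" "m_of ?s = ?m" by (simp_all add: same_env_def)
    then have "Z_of k ?s \<subseteq> {..<m_of ?s}" "nvar ?s ''y'' < m_of ?s" using Z i by simp_all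
    note c = cStep[OF this]
    have env: "same_env s (hsem (cStep k) ?s)" using c(1) e by (simp add: same_env_def)
    have A: "A_of (hsem (cStep k) ?s) = (if i \<notin> ?Z \<and> (\<exists>x\<in>A_of s'. \<not> ?ind x i) then insert i (A_of s') else A_of s')"
      using c(2) e by (simp add: same_env_def)
    show ?thesis unfolding A ok_def using ok i blk by (auto simp: ok_def env adj_def)
  qed
  have round: "ok (hsem (HFor ''y'' BRows (cStep k)) s') \<and> A_of s' \<union> adj (A_of s') \<subseteq> A_of (hsem (HFor ''y'' BRows (cStep k)) s') \<and>
      (adj (A_of s') \<subseteq> A_of s' \<longrightarrow> A_of (hsem (HFor ''y'' BRows (cStep k)) s') = A_of s')"
    if ok: "ok s'" for s'
  proof -
    have m: "nval (bexpr BRows) s' = ?m" using ok by (simp add: ok_def same_env_def)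
    define I where "I i t \<longleftrightarrow> ok t \<and> A_of s' \<union> (adj (A_of s') \<inter> {..<i}) \<subseteq> A_of t \<and>
      (adj (A_of s') \<subseteq> A_of s' \<longrightarrow> A_of t = A_of s')" for i t
    have "I (nval (bexpr BRows) s') (hsem (HFor ''y'' BRows (cStep k)) s')"
    proof (rule hsem_HFor)
      show "I 0 s'" using ok by (simp add: I_def)
      fix i t assume i: "i < nval (bexpr BRows) s'" and I: "I i t"
      let ?t = "hsem (cStep k) (setv t ''y'' i)"
      have t: "ok t" "A_of s' \<subseteq> A_of t" "adj (A_of s') \<inter> {..<i} \<subseteq> A_of t"
        "adj (A_of s') \<subseteq> A_of s' \<longrightarrow> A_of t = A_of s'"
        using I by (simp_all add: I_def)
      have "i < ?m" using i m by simp
      note st = step[OF t(1) this]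
      \<comment> \<open>Rows added earlier in the same pass only create further dependent rows, so
        everything adjacent at the start of the pass is still added.\<close>
      have "adj (A_of s') \<subseteq> adj (A_of t)" using t(2) unfolding adj_def by blast
      then have "adj (A_of s') \<inter> insert i {..<i} \<subseteq> A_of ?t" using st t(3) by blast
      moreover have "A_of ?t = A_of s'" if "adj (A_of s') \<subseteq> A_of s'"
        using st t(4) that by auto
      ultimately show "I (Suc i) ?t"
        using st t(2) unfolding I_def lessThan_Suc by blast
    qed
    then have "I ?m (hsem (HFor ''y'' BRows (cStep k)) s')" unfolding m .
    moreover have "adj (A_of s') \<inter> {..<?m} = adj (A_of s')" by (auto simp: adj_def)
    ultimately show ?thesis unfolding I_def by (simp del: hsem.simps)
  qed
  \<comment> \<open>After i passes the set is closed or has more than i elements. Initially it has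
    one element, and after m passes the second case is impossible for a set of rows.\<close>
  define J where "J i t \<longleftrightarrow> ok t \<and> (adj (A_of t) \<subseteq> A_of t \<or> i < card (A_of t))" for i t
  have okq: "ok (setv t ''q'' i) \<longleftrightarrow> ok t" for t i by (simp add: ok_def same_env_def)
  have "J (nval (bexpr BRows) s) (hsem (cClose k) s)"
    unfolding cClose_def
  proof (rule hsem_HFor)
    have "{r} \<subseteq> blk" using row_block_self by (simp add: blk_def)
    then show "J 0 s" using r A by (simp add: J_def ok_def same_env_def)
    fix i t assume "J i t"
    then have t: "ok (setv t ''q'' i)" and J: "adj (A_of t) \<subseteq> A_of t \<or> i < card (A_of t)"
      by (simp_all add: J_def okq)
    let ?t = "hsem (HFor ''y'' BRows (cStep k)) (setv t ''q'' i)"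
    have ok': "ok ?t" and sub: "A_of t \<union> adj (A_of t) \<subseteq> A_of ?t"
      using round[OF t] by (simp_all del: hsem.simps)
    have fin: "finite (A_of ?t)" by (simp add: A_of_def)
    have same: "A_of ?t = A_of t" if "adj (A_of t) \<subseteq> A_of t" using round[OF t] that by (simp del: hsem.simps)
    show "J (Suc i) ?t"
    proof (cases "adj (A_of t) \<subseteq> A_of t")
      case True
      then show ?thesis using ok' same unfolding J_def by (simp del: hsem.simps)
    next
      case False
      then have "A_of t \<noteq> A_of ?t" using sub by blast
      then have "card (A_of t) < card (A_of ?t)" using sub fin by (intro psubset_card_mono) auto
      then show ?thesis using J False ok' unfolding J_def by (simp del: hsem.simps)
    qed
  qed
  then have ok: "ok (hsem (cClose k) s)" and J: "adj (A_of (hsem (cClose k) s)) \<subseteq> A_of (hsem (cClose k) s) \<or>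
      ?m < card (A_of (hsem (cClose k) s))"
    by (simp_all add: J_def)
  let ?A = "A_of (hsem (cClose k) s)"
  have A': "?A \<subseteq> {..<?m} - ?Z" "?A \<subseteq> blk" "r \<in> ?A" using ok unfolding ok_def by blast+
  have "?A \<subseteq> {..<?m}" using A'(1) by blast
  then have "card ?A \<le> card {..<?m}" by (intro card_mono finite_lessThan)
  then have "\<not> ?m < card ?A" by simp
  with J have closed: "adj ?A \<subseteq> ?A" by blast
  have "blk \<subseteq> ?A"
    unfolding blk_def
  proof (rule row_block_least)
    fix x y assume x: "x \<in> ?A" and y: "y \<in> {..<?m} - ?Z - ?A"
    show "?ind x y"
    proof (rule ccontr)
      assume "\<not> ?ind x y"
      then have "y \<in> adj ?A"
        unfolding adj_def by (intro CollectI conjI bexI[OF _ x] DiffD1[OF y])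
      then have "y \<in> ?A" by (rule Set.subsetD[OF closed])
      then show False by (rule DiffD2[OF y])
    qed
  qed (fact A')+
  with A'(2) have "?A = blk" by (rule subset_antisym)
  then show "?A = row_block (S_of s) ?m (n_of s) ?Z r" unfolding blk_def .
  show "same_env s (hsem (cClose k) s)" using ok unfolding ok_def by (rule conjunct1)
  show "?A \<subseteq> {..<?m} - ?Z" by (fact A')
qed

section \<open>Writing out the two factors\<close>

text \<open>An index y lies before the entry at position i exactly when at most i selected indices
  are \<le> y, and a number equals the count of its predecessors. So list access is expressed by
  nested counting, which a term can evaluate.\<close>

lemma nth_filter_upt:
  assumes i: "i < length (filter P [0..<n])"
  shows "card {y. y < n \<and> card {z. z < n \<and> z \<le> y \<and> P z} \<le> i} = filter P [0..<n] ! i"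
proof -
  let ?xs = "filter P [0..<n]"
  have sorted: "sorted_wrt (<) ?xs" by (intro sorted_wrt_filter) simp
  have lt: "?xs ! a < ?xs ! b" if "a < b" "b < length ?xs" for a b
    using sorted_wrt_nth_less[OF sorted that] .
  have le: "?xs ! a \<le> ?xs ! b" if "a \<le> b" "b < length ?xs" for a b
    using lt[of a b] that by (cases "a = b") auto
  have xn: "?xs ! i < n" using nth_mem[OF i] by simp
  have set: "{z. z < n \<and> z \<le> y \<and> P z} = (!) ?xs ` {j. j < length ?xs \<and> ?xs ! j \<le> y}" for y
  proof -
    have "{z. z < n \<and> z \<le> y \<and> P z} = {z \<in> set ?xs. z \<le> y}" by auto
    also have "\<dots> = (!) ?xs ` {j. j < length ?xs \<and> ?xs ! j \<le> y}"
      by (auto simp: in_set_conv_nth simp del: set_filter)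
    finally show ?thesis .
  qed
  have inj: "inj_on ((!) ?xs) {j. j < length ?xs \<and> ?xs ! j \<le> y}" for y
    by (rule inj_on_nth) (auto simp: distinct_filter)
  have card: "card {z. z < n \<and> z \<le> y \<and> P z} = card {j. j < length ?xs \<and> ?xs ! j \<le> y}" for y
    unfolding set by (rule card_image[OF inj])
  have iff: "card {z. z < n \<and> z \<le> y \<and> P z} \<le> i \<longleftrightarrow> y < ?xs ! i" for y
  proof
    assume "y < ?xs ! i"
    have "{j. j < length ?xs \<and> ?xs ! j \<le> y} \<subseteq> {..<i}"
    proof
      fix j assume "j \<in> {j. j < length ?xs \<and> ?xs ! j \<le> y}"
      then show "j \<in> {..<i}" using le[of i j] \<open>y < ?xs ! i\<close> by (cases "j < i") auto
    qed
    then have "card {j. j < length ?xs \<and> ?xs ! j \<le> y} \<le> card {..<i}" by (intro card_mono) simp_all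
    then show "card {z. z < n \<and> z \<le> y \<and> P z} \<le> i" unfolding card by simp
  next
    assume c: "card {z. z < n \<and> z \<le> y \<and> P z} \<le> i"
    show "y < ?xs ! i"
    proof (rule ccontr)
      assume "\<not> y < ?xs ! i"
      have "{..i} \<subseteq> {j. j < length ?xs \<and> ?xs ! j \<le> y}"
      proof
        fix j assume "j \<in> {..i}"
        then show "j \<in> {j. j < length ?xs \<and> ?xs ! j \<le> y}" using le[of j i] i \<open>\<not> y < ?xs ! i\<close> by simp
      qed
      then have "card {..i} \<le> card {j. j < length ?xs \<and> ?xs ! j \<le> y}" by (intro card_mono) simp_all
      with c show False unfolding card by simp
    qed
  qed
  have "y < n \<and> y < ?xs ! i \<longleftrightarrow> y < ?xs ! i" for y using xn by linarith
  then show ?thesis unfolding iff by (simp only: lessThan_def[symmetric] card_lessThan)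
qed

definition ok_env :: "state \<Rightarrow> state \<Rightarrow> bool" where
  "ok_env s t \<longleftrightarrow> S_of t = S_of s \<and> m_of t = m_of s \<and> n_of t = n_of s \<and> X_of t = X_of s \<and> A_of t = A_of s"

lemma ok_env_nvar_update [simp]:
  "f ''m'' = m_of t \<Longrightarrow> f ''n'' = n_of t \<Longrightarrow> ok_env s (t\<lparr>nvar := f\<rparr>) \<longleftrightarrow> ok_env s t"
  by (simp add: ok_env_def)

lemma ok_env_refl [simp]: "ok_env s s"
  by (simp add: ok_env_def)

definition tNth where
  "tNth e P idx = tCount ''y'' e (tNot (TLess idx (tCount ''z'' e (tAnd (tNot (TLess (TV ''y'') (TV ''z''))) P))))"

lemma teval_tNth:
  assumes P: "\<And>y z. z < b \<Longrightarrow> holds P (setv (setv t ''y'' y) ''z'' z) \<longleftrightarrow> P' z"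
    and idx: "\<And>y. teval idx (setv t ''y'' y) = i" and b: "nval (bexpr e) t = b" and i: "i < length (filter P' [0..<b])"
  shows "teval (tNth e P idx) t = filter P' [0..<b] ! i"
proof -
  have be: "nval (bexpr e) (setv t ''y'' y) = b" for y
    unfolding b[symmetric] by (rule nval_bexpr_cong) simp_all
  have "{z. z < b \<and> holds (tAnd (tNot (TLess (TV ''y'') (TV ''z''))) P) (setv (setv t ''y'' y) ''z'' z)} =
      {z. z < b \<and> z \<le> y \<and> P' z}" for y
    using P[of _ y] by (auto simp: not_less simp del: fun_upd_apply) (auto simp: not_less)
  then have "teval (tNth e P idx) t = card {y. y < b \<and> card {z. z < b \<and> z \<le> y \<and> P' z} \<le> i}"
    unfolding tNth_def teval_tCount holds_simps be b idx by (simp add: not_less)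
  then show ?thesis using nth_filter_upt[OF i] by simp
qed

definition tRow where
  "tRow k P = TIf (TLess (TV ''p'') (TC (k - 1))) (tX (TV ''p'')) (tNth BRows P (TSub (TV ''p'') (TC (k - 1))))"

text \<open>The loops run over the full index range of \<open>S\<close>. Entries written beyond the
  lengths of the row and column lists are arbitrary and lie outside the dimensions with which the
  matrix is read.\<close>

definition cFill where
  "cFill a k P Q = HFor ''p'' BRows (HFor ''q'' BCols
     (HSetR a (TV ''p'') (TV ''q'') (tRow k P) (tNth BCols Q (TV ''q''))))"

definition frame :: "string \<Rightarrow> state \<Rightarrow> state \<Rightarrow> bool" where
  "frame a s t \<longleftrightarrow> narr t = narr s \<and> (\<forall>x. x \<noteq> ''p'' \<longrightarrow> x \<noteq> ''q'' \<longrightarrow> nvar t x = nvar s x) \<and>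
     (\<forall>b. b \<noteq> a \<longrightarrow> rarr t b = rarr s b)"

lemma frame_ok_env: "frame a s t \<Longrightarrow> a \<noteq> ''S'' \<Longrightarrow> ok_env s t"
  by (auto simp: frame_def ok_env_def X_of_def A_of_def fun_eq_iff)

lemma cFill:
  fixes k :: nat
  assumes a: "a \<noteq> ''S''"
    and P: "\<And>t. ok_env s t \<Longrightarrow> nvar t ''z'' < m_of s \<Longrightarrow> holds P t \<longleftrightarrow> P' (nvar t ''z'')"
    and Q: "\<And>t. ok_env s t \<Longrightarrow> nvar t ''z'' < n_of s \<Longrightarrow> holds Q t \<longleftrightarrow> Q' (nvar t ''z'')"
  defines "rs \<equiv> map (X_of s) [0..<k - 1] @ filter P' [0..<m_of s]" and "cs \<equiv> filter Q' [0..<n_of s]"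
  assumes rs: "length rs \<le> m_of s"
  shows "frame a s (hsem (cFill a k P Q) s)"
    and "i < length rs \<Longrightarrow> j < length cs \<Longrightarrow> rarr (hsem (cFill a k P Q) s) a i j = S_of s (rs ! i) (cs ! j)"
proof -
  have cs: "length cs \<le> n_of s" unfolding cs_def using length_filter_le[of Q' "[0..<n_of s]"] by simp
  let ?c = "HSetR a (TV ''p'') (TV ''q'') (tRow k P) (tNth BCols Q (TV ''q''))"
  have step: "frame a s (hsem ?c (setv t ''q'' j)) \<and>
      (i < length rs \<and> j < length cs \<longrightarrow> rarr (hsem ?c (setv t ''q'' j)) a i j = S_of s (rs ! i) (cs ! j)) \<and>
      (\<forall>i' j'. (i', j') \<noteq> (i, j) \<longrightarrow> rarr (hsem ?c (setv t ''q'' j)) a i' j' = rarr t a i' j')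
      \<and> nvar (hsem ?c (setv t ''q'' j)) ''p'' = i"
    if f: "frame a s t" and p: "nvar t ''p'' = i" for t i j
  proof -
    let ?t = "setv t ''q'' j"
    have ok: "ok_env s t" using frame_ok_env[OF f a] .
    have m: "m_of t = m_of s" "n_of t = n_of s" "X_of t = X_of s" using ok by (simp_all add: ok_env_def)
    have "S_of s (teval (tRow k P) ?t) (teval (tNth BCols Q (TV ''q'')) ?t) = S_of s (rs ! i) (cs ! j)"
      if ij: "i < length rs" "j < length cs"
    proof -
      have "teval (tNth BCols Q (TV ''q'')) ?t = filter Q' [0..<n_of s] ! j"
        by (rule teval_tNth) (use ij ok m in \<open>auto simp: Q cs_def\<close>)
      moreover have "teval (tRow k P) ?t = rs ! i"
      proof (cases "i < k - 1")
        case True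
        then show ?thesis using p m by (simp add: tRow_def rs_def nth_append)
      next
        case False
        then have "teval (tNth BRows P (TSub (TV ''p'') (TC (k - 1)))) ?t = filter P' [0..<m_of s] ! (i - (k - 1))"
          by (intro teval_tNth) (use ij p ok m in \<open>auto simp: P rs_def\<close>)
        with False show ?thesis using p by (simp add: tRow_def rs_def nth_append)
      qed
      ultimately show ?thesis by (simp add: cs_def)
    qed
    moreover have "S_of t = S_of s" using ok by (simp add: ok_env_def)
    ultimately show ?thesis using f p by (simp add: frame_def upd2_def)
  qed
  have row: "frame a s (hsem (HFor ''q'' BCols ?c) (setv t ''p'' i)) \<and>
      (i < length rs \<longrightarrow> (\<forall>j<length cs. rarr (hsem (HFor ''q'' BCols ?c) (setv t ''p'' i)) a i j = S_of s (rs ! i) (cs ! j))) \<and>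
      (\<forall>i' j'. i' \<noteq> i \<longrightarrow> rarr (hsem (HFor ''q'' BCols ?c) (setv t ''p'' i)) a i' j' = rarr t a i' j')"
    if f: "frame a s t" for t i
  proof -
    define I where "I b t' \<longleftrightarrow> frame a s t' \<and> nvar t' ''p'' = i \<and>
      (i < length rs \<longrightarrow> (\<forall>j<length cs. j < b \<longrightarrow> rarr t' a i j = S_of s (rs ! i) (cs ! j))) \<and>
      (\<forall>i' j'. i' \<noteq> i \<longrightarrow> rarr t' a i' j' = rarr t a i' j')" for b t'
    have b: "nval (bexpr BCols) (setv t ''p'' i) = n_of s" using f by (simp add: frame_def)
    have "I (nval (bexpr BCols) (setv t ''p'' i)) (hsem (HFor ''q'' BCols ?c) (setv t ''p'' i))"
    proof (rule hsem_HFor)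
      show "I 0 (setv t ''p'' i)" using f by (simp add: I_def frame_def)
      fix j t' assume I: "I j t'"
      then have t': "frame a s t'" "nvar t' ''p'' = i" by (simp_all add: I_def)
      note st = step[OF t', of j]
      show "I (Suc j) (hsem ?c (setv t' ''q'' j))"
        unfolding I_def
      proof (intro conjI allI impI)
        fix j' assume j': "i < length rs" "j' < length cs" "j' < Suc j"
        show "rarr (hsem ?c (setv t' ''q'' j)) a i j' = S_of s (rs ! i) (cs ! j')"
        proof (cases "j' = j")
          case True
          then show ?thesis using st j' by blast
        next
          case False
          then have "rarr (hsem ?c (setv t' ''q'' j)) a i j' = rarr t' a i j'" using st by blast
          then show ?thesis using I j' False unfolding I_def by simp
        qed
      next
        fix i' j' assume "i' \<noteq> i"
        then have "rarr (hsem ?c (setv t' ''q'' j)) a i' j' = rarr t' a i' j'" using st by blast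
        then show "rarr (hsem ?c (setv t' ''q'' j)) a i' j' = rarr t a i' j'" using I \<open>i' \<noteq> i\<close> unfolding I_def by simp
      qed (use st in blast)+
    qed
    then show ?thesis unfolding I_def b using cs by (meson less_le_trans)
  qed
  define J where "J b t \<longleftrightarrow> frame a s t \<and>
    (\<forall>i<length rs. i < b \<longrightarrow> (\<forall>j<length cs. rarr t a i j = S_of s (rs ! i) (cs ! j)))" for b t
  have "J (nval (bexpr BRows) s) (hsem (cFill a k P Q) s)"
    unfolding cFill_def
  proof (rule hsem_HFor)
    show "J 0 s" by (simp add: J_def frame_def)
    fix i t assume J: "J i t"
    then have f: "frame a s t" by (simp add: J_def)
    note st = row[OF f, of i]
    show "J (Suc i) (hsem (HFor ''q'' BCols ?c) (setv t ''p'' i))"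
      unfolding J_def
    proof (intro conjI allI impI)
      fix i' j assume ij: "i' < length rs" "i' < Suc i" "j < length cs"
      show "rarr (hsem (HFor ''q'' BCols ?c) (setv t ''p'' i)) a i' j = S_of s (rs ! i') (cs ! j)"
      proof (cases "i' = i")
        case True
        then show ?thesis using st ij by blast
      next
        case False
        then have "rarr (hsem (HFor ''q'' BCols ?c) (setv t ''p'' i)) a i' j = rarr t a i' j" using st by blast
        then show ?thesis using J ij False unfolding J_def by simp
      qed
    qed (use st in blast)
  qed
  then show "frame a s (hsem (cFill a k P Q) s)"
    and "i < length rs \<Longrightarrow> j < length cs \<Longrightarrow> rarr (hsem (cFill a k P Q) s) a i j = S_of s (rs ! i) (cs ! j)"
    using rs unfolding J_def by auto
qed

definition tB where "tB k = tAnd (tNot (tA ''z'')) (tNot (tSpec k ''z''))"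

definition cDims where
  "cDims k = HSeq (HSetV ''m1'' (TAdd (TC (k - 1)) (tCount ''z'' BRows (tA ''z''))))
    (HSeq (HSetV ''n1'' (tCount ''z'' BCols (tKeep1 k ''z'')))
    (HSeq (HSetV ''m2'' (TAdd (TC (k - 1)) (tCount ''z'' BRows (tB k))))
      (HSetV ''n2'' (tCount ''z'' BCols (tKeep2 k ''z'')))))"

definition cLists where
  "cLists k = HFor ''p'' (BConst (k - 1))
     (HSeq (HSetA ''x'' (TV ''p'') (TC 0) (TV ''p'')) (HSetA ''y'' (TV ''p'') (TC 0) (TV ''p'')))"

definition cOut where
  "cOut k = HSeq (cDims k) (HSeq (cFill ''S1'' k (tA ''z'') (tKeep1 k ''z''))
     (HSeq (cFill ''S2'' k (tB k) (tKeep2 k ''z'')) (HSeq (cLists k) (HSetV ''accept'' (TC 1)))))"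

lemma cLists:
  "nvar (hsem (cLists k) s) = (nvar s)(''p'' := nvar (hsem (cLists k) s) ''p'') \<and> rarr (hsem (cLists k) s) = rarr s \<and>
   (\<forall>a. a \<noteq> ''x'' \<longrightarrow> a \<noteq> ''y'' \<longrightarrow> narr (hsem (cLists k) s) a = narr s a) \<and>
   (\<forall>i<k - 1. narr (hsem (cLists k) s) ''x'' i 0 = i \<and> narr (hsem (cLists k) s) ''y'' i 0 = i)"
proof -
  define I where "I b t \<longleftrightarrow> (\<forall>x. x \<noteq> ''p'' \<longrightarrow> nvar t x = nvar s x) \<and> rarr t = rarr s \<and>
    (\<forall>a. a \<noteq> ''x'' \<longrightarrow> a \<noteq> ''y'' \<longrightarrow> narr t a = narr s a) \<and>
    (\<forall>i<b. narr t ''x'' i 0 = i \<and> narr t ''y'' i 0 = i)" for b :: nat and t :: state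
  have "I (nval (bexpr (BConst (k - 1))) s) (hsem (cLists k) s)"
    unfolding cLists_def
    by (rule hsem_HFor) (auto simp: I_def upd2_def less_Suc_eq)
  then show ?thesis unfolding I_def by (auto simp: fun_eq_iff simp del: hsem.simps)
qed

lemma read_mat_eq:
  assumes "nvar s r = length rs" "nvar s c = length cs"
    and "\<And>i j. i < length rs \<Longrightarrow> j < length cs \<Longrightarrow> rarr s a i j = S (rs ! i) (cs ! j)"
  shows "read_mat s r c a = select_mat S rs cs"
  using assms unfolding read_mat_def select_mat_def by (intro eq_matI) auto

lemma read_list_eq: "(\<And>i. i < l \<Longrightarrow> narr s a i 0 = i) \<Longrightarrow> read_list s l a = [0..<l]"
  unfolding read_list_def by (intro map_idI) auto

lemma cOut:
  fixes k :: nat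
  assumes Z: "Z_of k s \<subseteq> {..<m_of s}"
  defines "rs1 \<equiv> map (X_of s) [0..<k - 1] @ filter (\<lambda>i. i \<in> A_of s) [0..<m_of s]"
    and "rs2 \<equiv> map (X_of s) [0..<k - 1] @ filter (\<lambda>i. i \<notin> A_of s \<and> i \<notin> Z_of k s) [0..<m_of s]"
    and "cs1 \<equiv> filter (K1_of k s) [0..<n_of s]" and "cs2 \<equiv> filter (K2_of k s) [0..<n_of s]"
  assumes len: "length rs1 \<le> m_of s" "length rs2 \<le> m_of s"
  defines "s' \<equiv> hsem (cOut k) s"
  shows "S_of s' = S_of s" "m_of s' = m_of s" "n_of s' = n_of s" "X_of s' = X_of s" "nvar s' ''accept'' = 1"
    "read_mat s' ''m1'' ''n1'' ''S1'' = select_mat (S_of s) rs1 cs1"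
    "read_mat s' ''m2'' ''n2'' ''S2'' = select_mat (S_of s) rs2 cs2"
    "read_list s' (k - 1) ''x'' = [0..<k - 1]" "read_list s' (k - 1) ''y'' = [0..<k - 1]"
proof -
  define s1 where "s1 = hsem (cDims k) s"
  have hA: "holds (tA ''z'') t \<longleftrightarrow> nvar t ''z'' \<in> A_of s" if "ok_env s t" "nvar t ''z'' < m_of s" for t
    using holds_tA[of t "''z''"] that by (simp add: ok_env_def)
  have hB: "holds (tB k) t \<longleftrightarrow> nvar t ''z'' \<notin> A_of s \<and> nvar t ''z'' \<notin> Z_of k s"
    if "ok_env s t" "nvar t ''z'' < m_of s" for t
    using hA[OF that] that(1) by (simp add: tB_def ok_env_def)
  have K: "K1_of k t = K1_of k s" "K2_of k t = K2_of k s" "Z_of k t \<subseteq> {..<m_of t}" if "ok_env s t" for t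
    using that Z by (simp_all add: K1_of_def K2_of_def ok_env_def)
  have h1: "holds (tKeep1 k ''z'') t \<longleftrightarrow> K1_of k s (nvar t ''z'')" if "ok_env s t" for t
    using holds_tKeep12(1)[of "''z''" t k] K[OF that] by simp
  have h2: "holds (tKeep2 k ''z'') t \<longleftrightarrow> K2_of k s (nvar t ''z'')" if "ok_env s t" for t
    using holds_tKeep12(2)[of "''z''" k t] K[OF that] by simp
  have cnt: "teval (tCount ''z'' e P) t = length (filter P' [0..<b])"
    if "ok_env s t" "nval (bexpr e) s = b" "\<And>t'. ok_env s t' \<Longrightarrow> nvar t' ''z'' < b \<Longrightarrow> holds P t' \<longleftrightarrow> P' (nvar t' ''z'')" for e P P' b t
  proof -
    have b: "nval (bexpr e) t = b"
      using that(1) unfolding that(2)[symmetric] by (intro nval_bexpr_cong) (simp_all add: ok_env_def)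
    have "{i. i < b \<and> holds P (setv t ''z'' i)} = {i. i < b \<and> P' i}"
      using that(3)[of "setv t ''z'' _"] that(1) by auto
    then show ?thesis unfolding teval_tCount b length_filter_upt by simp
  qed
  have dims: "nvar s1 = (nvar s)(''m1'' := length rs1, ''n1'' := length cs1, ''m2'' := length rs2, ''n2'' := length cs2)"
    "narr s1 = narr s" "rarr s1 = rarr s"
  proof -
    have c: "teval (tCount ''z'' BRows (tA ''z'')) t = length (filter (\<lambda>i. i \<in> A_of s) [0..<m_of s])"
      "teval (tCount ''z'' BRows (tB k)) t = length (filter (\<lambda>i. i \<notin> A_of s \<and> i \<notin> Z_of k s) [0..<m_of s])"
      "teval (tCount ''z'' BCols (tKeep1 k ''z'')) t = length (filter (K1_of k s) [0..<n_of s])"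
      "teval (tCount ''z'' BCols (tKeep2 k ''z'')) t = length (filter (K2_of k s) [0..<n_of s])" if "ok_env s t" for t
      by (rule cnt[OF that]; simp only: bexpr.simps nval.simps hA hB h1 h2)+
    show "nvar s1 = (nvar s)(''m1'' := length rs1, ''n1'' := length cs1, ''m2'' := length rs2, ''n2'' := length cs2)"
      "narr s1 = narr s" "rarr s1 = rarr s"
      unfolding s1_def cDims_def by (simp_all add: c rs1_def rs2_def cs1_def cs2_def ok_env_def A_of_def X_of_def fun_eq_iff
          del: teval_tCount)
  qed
  have ok1: "ok_env s s1" by (simp add: ok_env_def dims A_of_def X_of_def fun_eq_iff)
  have trans: "ok_env s t" if "ok_env s u" "ok_env u t" for u t using that by (simp add: ok_env_def)
  define s2 where "s2 = hsem (cFill ''S1'' k (tA ''z'') (tKeep1 k ''z'')) s1"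
  define s3 where "s3 = hsem (cFill ''S2'' k (tB k) (tKeep2 k ''z'')) s2"
  define s4 where "s4 = hsem (cLists k) s3"
  have e1: "m_of s1 = m_of s" "n_of s1 = n_of s" "X_of s1 = X_of s" "S_of s1 = S_of s" using ok1 by (simp_all add: ok_env_def)
  have "frame ''S1'' s1 s2 \<and> (\<forall>i<length rs1. \<forall>j<length cs1. rarr s2 ''S1'' i j = S_of s (rs1 ! i) (cs1 ! j))"
    using cFill[of "''S1''" s1 "tA ''z''" "\<lambda>i. i \<in> A_of s" "tKeep1 k ''z''" "K1_of k s" k]
      hA h1 trans[OF ok1] len(1) by (simp add: e1 rs1_def cs1_def s2_def)
  then have f2: "frame ''S1'' s1 s2" and v1: "\<And>i j. i < length rs1 \<Longrightarrow> j < length cs1 \<Longrightarrow> rarr s2 ''S1'' i j = S_of s (rs1 ! i) (cs1 ! j)"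
    by blast+
  have ok2: "ok_env s s2" by (rule trans[OF ok1 frame_ok_env[OF f2]]) simp
  have e2: "m_of s2 = m_of s" "n_of s2 = n_of s" "X_of s2 = X_of s" "S_of s2 = S_of s" using ok2 by (simp_all add: ok_env_def)
  have "frame ''S2'' s2 s3 \<and> (\<forall>i<length rs2. \<forall>j<length cs2. rarr s3 ''S2'' i j = S_of s (rs2 ! i) (cs2 ! j))"
    using cFill[of "''S2''" s2 "tB k" "\<lambda>i. i \<notin> A_of s \<and> i \<notin> Z_of k s" "tKeep2 k ''z''" "K2_of k s" k]
      hB h2 trans[OF ok2] len(2) by (simp add: e2 rs2_def cs2_def s3_def)
  then have f3: "frame ''S2'' s2 s3" and v2: "\<And>i j. i < length rs2 \<Longrightarrow> j < length cs2 \<Longrightarrow> rarr s3 ''S2'' i j = S_of s (rs2 ! i) (cs2 ! j)"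
    by blast+
  have ok3: "ok_env s s3" by (rule trans[OF ok2 frame_ok_env[OF f3]]) simp
  have s': "s' = setv s4 ''accept'' 1"
    unfolding s'_def cOut_def s4_def s3_def s2_def s1_def by simp
  note l = cLists[of k s3, folded s4_def]
  have nv: "nvar s4 x = nvar s1 x" if "x \<noteq> ''p''" "x \<noteq> ''q''" for x
  proof -
    have "nvar s4 x = nvar s3 x" using l that(1) by (metis fun_upd_apply)
    also have "\<dots> = nvar s2 x" using f3 that by (simp add: frame_def)
    also have "\<dots> = nvar s1 x" using f2 that by (simp add: frame_def)
    finally show ?thesis .
  qed
  have ra: "rarr s4 = rarr s3" using l by blast
  have ra1: "rarr s3 ''S1'' = rarr s2 ''S1''" using f3 by (simp add: frame_def)
  show "S_of s' = S_of s" using ok3 by (simp add: s' ra ok_env_def)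
  show "m_of s' = m_of s" "n_of s' = n_of s" "nvar s' ''accept'' = 1" by (simp_all add: s' nv e1)
  show "X_of s' = X_of s"
  proof -
    have "narr s4 ''X'' = narr s3 ''X''" using l by simp
    then have "X_of s4 = X_of s3" by (simp add: X_of_def fun_eq_iff)
    then show ?thesis using ok3 by (simp add: s' ok_env_def)
  qed
  show "read_mat s' ''m1'' ''n1'' ''S1'' = select_mat (S_of s) rs1 cs1"
    by (rule read_mat_eq) (simp_all add: s' nv dims ra ra1 v1)
  show "read_mat s' ''m2'' ''n2'' ''S2'' = select_mat (S_of s) rs2 cs2"
    by (rule read_mat_eq) (simp_all add: s' nv dims ra v2)
  have xy: "narr s4 ''x'' i 0 = i" "narr s4 ''y'' i 0 = i" if "i < k - 1" for i
    using l that by blast+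
  show "read_list s' (k - 1) ''x'' = [0..<k - 1]" "read_list s' (k - 1) ''y'' = [0..<k - 1]"
    by (rule read_list_eq, simp add: s' xy)+
qed

section \<open>Exhaustive search over the guesses\<close>

definition output_ok :: "nat \<Rightarrow> real mat \<Rightarrow> state \<Rightarrow> bool" where
  "output_ok k M s \<longleftrightarrow> k_factorisation k M
     (read_mat s ''m1'' ''n1'' ''S1'') (read_list s (k - 1) ''x'')
     (read_mat s ''m2'' ''n2'' ''S2'') (read_list s (k - 1) ''y'')"

text \<open>The invariant of the search: the input is intact, and acceptance is recorded only
  together with a correct output. This alone gives soundness of the final answer.\<close>

definition inv_state :: "nat \<Rightarrow> real mat \<Rightarrow> state \<Rightarrow> bool" where
  "inv_state k M s \<longleftrightarrow> m_of s = dim_row M \<and> n_of s = dim_col M \<and> S_of s = S_of (input_state M) \<and>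
     (nvar s ''accept'' \<noteq> 0 \<longrightarrow> output_ok k M s)"

lemma S_of_input: "i < dim_row M \<Longrightarrow> c < dim_col M \<Longrightarrow> S_of (input_state M) i c = M $$ (i, c)"
  by (simp add: input_state_def)

text \<open>After the first accepted guess nothing is executed any more, so the recorded output is
  not overwritten.\<close>

definition cBody where
  "cBody k = HIf (tEq (TV ''accept'') (TC 0)) (HSeq (cInit k) (HSeq (cClose k) (HIf (tCheck k) (cOut k))))"

lemma cBody:
  assumes k: "k \<ge> 1" and inv: "inv_state k M s"
  defines "s' \<equiv> hsem (cBody k) s"
  shows "inv_state k M s'" "X_of s' = X_of s" "nvar s ''accept'' \<noteq> 0 \<Longrightarrow> nvar s' ''accept'' \<noteq> 0"
    "guess_ok k (S_of s) (m_of s) (n_of s) (X_of s) \<Longrightarrow> nvar s' ''accept'' \<noteq> 0"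
proof -
  have "inv_state k M s' \<and> X_of s' = X_of s \<and> (nvar s ''accept'' \<noteq> 0 \<longrightarrow> nvar s' ''accept'' \<noteq> 0) \<and>
    (guess_ok k (S_of s) (m_of s) (n_of s) (X_of s) \<longrightarrow> nvar s' ''accept'' \<noteq> 0)"
  proof (cases "nvar s ''accept'' = 0")
    case False
    then have "s' = s" unfolding s'_def cBody_def by (simp add: tEq_def)
    with False inv show ?thesis by simp
  next
    case True
    define s1 where "s1 = hsem (cInit k) s"
    define s2 where "s2 = hsem (cClose k) s1"
    have s': "s' = (if holds (tCheck k) s2 then hsem (cOut k) s2 else s2)"
      unfolding s'_def cBody_def s2_def s1_def using True by (simp add: tEq_def)
    have env1: "same_env s s1" unfolding s1_def by (rule cInit)
    have env2: "same_env s s2" using env1 cClose_env[of s1 k, folded s2_def] by (simp add: same_env_def)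
    then have e: "S_of s2 = S_of s" "m_of s2 = m_of s" "n_of s2 = n_of s" "X_of s2 = X_of s" "nvar s2 ''accept'' = 0"
      using True by (simp_all add: same_env_def)
    have e1: "S_of s1 = S_of s" "m_of s1 = m_of s" "n_of s1 = n_of s" "X_of s1 = X_of s"
      using env1 by (simp_all add: same_env_def)
    have A: "A_of s2 = row_block (S_of s2) (m_of s2) (n_of s2) (Z_of k s2) (X_of s2 (3 * k - 1)) \<and>
        A_of s2 \<subseteq> {..<m_of s2} - Z_of k s2"
      if "Z_of k s2 \<subseteq> {..<m_of s2}" "X_of s2 (3 * k - 1) < m_of s2" "X_of s2 (3 * k - 1) \<notin> Z_of k s2"
    proof -
      have "Z_of k s1 \<subseteq> {..<m_of s1}" "X_of s (3 * k - 1) < m_of s1" "X_of s (3 * k - 1) \<notin> Z_of k s1"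
        using that unfolding e e1 by blast+
      moreover have "A_of s1 = {X_of s (3 * k - 1)}"
        using cInit(2)[of s k, folded s1_def] that(2) unfolding e by blast
      ultimately show ?thesis
        using cClose(2,3)[where s = s1 and k = k and r = "X_of s (3 * k - 1)", folded s2_def] unfolding e e1 by blast
    qed
    have chk: "holds (tCheck k) s2 \<longleftrightarrow> guess_ok k (S_of s) (m_of s) (n_of s) (X_of s)"
      using holds_tCheck[OF A] unfolding e .
    show ?thesis
    proof (cases "holds (tCheck k) s2")
      case False
      then have "s' = s2" by (simp only: s' if_False)
      moreover have "inv_state k M s2" using inv unfolding inv_state_def by (simp add: e)
      ultimately show ?thesis using False True unfolding chk by (simp only: e) simp
    next
      case True
      then have gs: "guess_ok k (S_of s) (m_of s) (n_of s) (X_of s)" unfolding chk .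
      then have r: "X_of s (3 * k - 1) < m_of s" "X_of s (3 * k - 1) \<notin> Z_of k s"
        unfolding guess_ok_def by blast+
      have Z: "Z_of k s \<subseteq> {..<m_of s}" using gs unfolding guess_ok_def Let_def splits_def by blast
      have A2: "A_of s2 = row_block (S_of s) (m_of s) (n_of s) (Z_of k s) (X_of s (3 * k - 1))"
        using A unfolding e using Z r by blast
      have sp: "splits k (S_of s) (m_of s) (n_of s) (X_of s) (A_of s2) (K1_of k s2) (K2_of k s2)"
        using gs unfolding guess_ok_def Let_def K1_of_def K2_of_def e A2[symmetric] by blast
      have mn: "m_of s = dim_row M" "n_of s = dim_col M"
        and Sin: "\<And>i c. i < dim_row M \<Longrightarrow> c < dim_col M \<Longrightarrow> S_of s i c = M $$ (i, c)"
        using inv S_of_input unfolding inv_state_def by simp_all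
      let ?r1 = "map (X_of s) [0..<k - 1] @ filter (\<lambda>i. i \<in> A_of s2) [0..<m_of s]"
      let ?r2 = "map (X_of s) [0..<k - 1] @ filter (\<lambda>i. i \<notin> A_of s2 \<and> i \<notin> Z_of k s) [0..<m_of s]"
      let ?c1 = "filter (K1_of k s2) [0..<n_of s]" and ?c2 = "filter (K2_of k s2) [0..<n_of s]"
      have fac: "k_factorisation k M (select_mat (S_of s) ?r1 ?c1) [0..<k - 1] (select_mat (S_of s) ?r2 ?c2) [0..<k - 1]"
        unfolding mn by (rule splits_imp_k_factorisation[OF Sin k sp[unfolded mn]])
      then have "length ?r1 \<le> m_of s" "length ?r2 \<le> m_of s"
        unfolding k_factorisation_iff[OF k] mn by (simp_all add: select_mat_def)
      note out = cOut[where s = s2 and k = k, unfolded e, OF Z this]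
      have s'': "s' = hsem (cOut k) s2" using True by (simp only: s' if_True)
      have "output_ok k M s'" unfolding output_ok_def s'' out using fac .
      then have "inv_state k M s'"
        using inv unfolding inv_state_def by (simp only: s'' out simp_thms)
      moreover have "X_of s' = X_of s" "nvar s' ''accept'' \<noteq> 0" by (simp_all only: s'' out)
      ultimately show ?thesis by blast
    qed
  qed
  then show "inv_state k M s'" "X_of s' = X_of s" "nvar s ''accept'' \<noteq> 0 \<Longrightarrow> nvar s' ''accept'' \<noteq> 0"
    "guess_ok k (S_of s) (m_of s) (n_of s) (X_of s) \<Longrightarrow> nvar s' ''accept'' \<noteq> 0"
    by blast+
qed

text \<open>The loop at depth \<open>Suc d\<close> sets entry d of the guess. With bound
  \<open>BSize\<close> the entries range from 0 to m + n inclusive.\<close>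

primrec cNest :: "nat \<Rightarrow> hcom \<Rightarrow> hcom" where
  "cNest 0 c = c"
| "cNest (Suc d) c = HFor ''v'' BSize (HSeq (HSetA ''X'' (TC d) (TC 0) (TV ''v'')) (cNest d c))"

text \<open>Entries from d on have been fixed by the outer loops and are left alone. All completions
  of them by d bounded entries are tried, and acceptance persists, so one good completion
  suffices.\<close>

lemma cNest:
  assumes k: "k \<ge> 1" and inv: "inv_state k M s"
  shows "inv_state k M (hsem (cNest d (cBody k)) s) \<and>
    (\<forall>t\<ge>d. X_of (hsem (cNest d (cBody k)) s) t = X_of s t) \<and>
    (nvar s ''accept'' \<noteq> 0 \<longrightarrow> nvar (hsem (cNest d (cBody k)) s) ''accept'' \<noteq> 0) \<and>
    (\<forall>X. (\<forall>t\<ge>d. X t = X_of s t) \<and> (\<forall>t<d. X t \<le> dim_row M + dim_col M) \<and>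
       guess_ok k (S_of (input_state M)) (dim_row M) (dim_col M) X \<longrightarrow>
       nvar (hsem (cNest d (cBody k)) s) ''accept'' \<noteq> 0)"
  using inv
proof (induction d arbitrary: s)
  case 0
  have X: "X = X_of s" if "\<forall>t\<ge>0. X t = X_of s t" for X
  proof
    show "X t = X_of s t" for t using that by blast
  qed
  have e: "S_of s = S_of (input_state M)" "m_of s = dim_row M" "n_of s = dim_col M"
    using 0 unfolding inv_state_def by blast+
  have acc: "nvar (hsem (cBody k) s) ''accept'' \<noteq> 0"
    if "\<forall>t\<ge>0. X t = X_of s t" "guess_ok k (S_of (input_state M)) (dim_row M) (dim_col M) X" for X
    using cBody(4)[OF k 0] that(2) unfolding e X[OF that(1)] by blast
  show ?case unfolding cNest.simps
  proof (intro conjI allI impI)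
    show "inv_state k M (hsem (cBody k) s)" by (rule cBody(1)[OF k 0])
    show "X_of (hsem (cBody k) s) t = X_of s t" for t unfolding cBody(2)[OF k 0] ..
    show "nvar (hsem (cBody k) s) ''accept'' \<noteq> 0" if "nvar s ''accept'' \<noteq> 0"
      by (rule cBody(3)[OF k 0 that])
  qed (elim conjE, rule acc)
next
  case (Suc d)
  let ?c = "HSeq (HSetA ''X'' (TC d) (TC 0) (TV ''v'')) (cNest d (cBody k))"
  let ?N = "dim_row M + dim_col M"
  have step: "inv_state k M (hsem ?c (setv t ''v'' i)) \<and>
      (\<forall>u\<ge>Suc d. X_of (hsem ?c (setv t ''v'' i)) u = X_of t u) \<and>
      (nvar t ''accept'' \<noteq> 0 \<longrightarrow> nvar (hsem ?c (setv t ''v'' i)) ''accept'' \<noteq> 0) \<and>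
      (\<forall>X. (\<forall>u\<ge>Suc d. X u = X_of t u) \<and> X d = i \<and> (\<forall>u<d. X u \<le> ?N) \<and>
         guess_ok k (S_of (input_state M)) (dim_row M) (dim_col M) X \<longrightarrow>
         nvar (hsem ?c (setv t ''v'' i)) ''accept'' \<noteq> 0)"
    if t: "inv_state k M t" for t i
  proof -
    define t' where "t' = hsem (HSetA ''X'' (TC d) (TC 0) (TV ''v'')) (setv t ''v'' i)"
    have c: "hsem ?c (setv t ''v'' i) = hsem (cNest d (cBody k)) t'" by (simp add: t'_def)
    have "inv_state k M t'"
      using t by (simp add: inv_state_def t'_def output_ok_def read_mat_def read_list_def upd2_def)
    note IH = Suc.IH[OF this]
    have X: "X_of t' = (X_of t)(d := i)" by (simp add: t'_def X_of_def upd2_def fun_eq_iff)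
    have acc: "nvar t' ''accept'' = nvar t ''accept''" by (simp add: t'_def)
    have "nvar (hsem (cNest d (cBody k)) t') ''accept'' \<noteq> 0"
      if "\<forall>u\<ge>Suc d. X u = X_of t u" "X d = i" "\<forall>u<d. X u \<le> ?N"
        "guess_ok k (S_of (input_state M)) (dim_row M) (dim_col M) X" for X
    proof -
      have "\<forall>u\<ge>d. X u = X_of t' u"
      proof (intro allI impI)
        fix u assume "u \<ge> d"
        then show "X u = X_of t' u" using that(1,2) by (cases "u = d") (auto simp: X)
      qed
      then show ?thesis using IH that(3,4) by blast
    qed
    moreover have "X_of (hsem (cNest d (cBody k)) t') u = X_of t u" if "u \<ge> Suc d" for u
    proof -
      have "X_of (hsem (cNest d (cBody k)) t') u = X_of t' u" using IH Suc_leD[OF that] by blast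
      also have "\<dots> = X_of t u" using that by (simp add: X)
      finally show ?thesis .
    qed
    moreover have "inv_state k M (hsem (cNest d (cBody k)) t')" using IH by blast
    moreover have "nvar t ''accept'' \<noteq> 0 \<longrightarrow> nvar (hsem (cNest d (cBody k)) t') ''accept'' \<noteq> 0"
      using IH unfolding acc by blast
    ultimately show ?thesis unfolding c by blast
  qed
  define I where "I b t \<longleftrightarrow> inv_state k M t \<and> (\<forall>u\<ge>Suc d. X_of t u = X_of s u) \<and>
    (nvar s ''accept'' \<noteq> 0 \<longrightarrow> nvar t ''accept'' \<noteq> 0) \<and>
    (\<forall>X. (\<forall>u\<ge>Suc d. X u = X_of s u) \<and> X d < b \<and> (\<forall>u<d. X u \<le> ?N) \<and>
       guess_ok k (S_of (input_state M)) (dim_row M) (dim_col M) X \<longrightarrow> nvar t ''accept'' \<noteq> 0)" for b t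
  have b: "nval (bexpr BSize) s = Suc ?N" using Suc.prems by (simp add: inv_state_def)
  have "I (nval (bexpr BSize) s) (hsem (cNest (Suc d) (cBody k)) s)"
    unfolding cNest.simps
  proof (rule hsem_HFor)
    show "I 0 s" using Suc.prems by (simp add: I_def)
    fix i t assume I: "I i t"
    then have t: "inv_state k M t" and Xt: "\<forall>u\<ge>Suc d. X_of t u = X_of s u" by (simp_all add: I_def)
    note st = step[OF t, of i]
    let ?t = "hsem ?c (setv t ''v'' i)"
    have "nvar ?t ''accept'' \<noteq> 0"
      if X: "\<forall>u\<ge>Suc d. X u = X_of s u" "X d < Suc i" "\<forall>u<d. X u \<le> ?N"
        "guess_ok k (S_of (input_state M)) (dim_row M) (dim_col M) X" for X
    proof (cases "X d = i")
      case True
      have "\<forall>u\<ge>Suc d. X u = X_of t u" using X(1) Xt by simp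
      with True X(3,4) st show ?thesis by blast
    next
      case False
      then have "X d < i" using X(2) by simp
      then have "nvar t ''accept'' \<noteq> 0" using X(1,3,4) I unfolding I_def by blast
      with st show ?thesis by blast
    qed
    moreover have "\<forall>u\<ge>Suc d. X_of ?t u = X_of s u" using st Xt by simp
    moreover have "inv_state k M ?t" using st by blast
    moreover have "nvar s ''accept'' \<noteq> 0 \<longrightarrow> nvar ?t ''accept'' \<noteq> 0" using st I unfolding I_def by blast
    ultimately show "I (Suc i) ?t" unfolding I_def by blast
  qed
  then have I: "I (Suc ?N) (hsem (cNest (Suc d) (cBody k)) s)" unfolding b .
  have "nvar (hsem (cNest (Suc d) (cBody k)) s) ''accept'' \<noteq> 0"
    if "\<forall>t\<ge>Suc d. X t = X_of s t" "\<forall>t<Suc d. X t \<le> ?N"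
      "guess_ok k (S_of (input_state M)) (dim_row M) (dim_col M) X" for X
  proof -
    have "X d < Suc ?N" "\<forall>t<d. X t \<le> ?N" using that(2) by (simp_all add: le_imp_less_Suc)
    with that(1,3) I show ?thesis unfolding I_def by blast
  qed
  with I show ?case unfolding I_def by blast
qed

text \<open>A guess is a function on all natural numbers, of which the search sets the first
  \<open>3 * k\<close> values.\<close>

lemma guess_ok_cong:
  assumes k: "k \<ge> 1" and eq: "\<And>t. t < 3 * k \<Longrightarrow> X t = Y t"
  shows "guess_ok k S m n X = guess_ok k S m n Y"
proof -
  have Z: "X ` {..<k - 1} = Y ` {..<k - 1}" using eq by (intro image_cong) auto
  have mk: "marked k (\<lambda>t. S (X t) c) j = marked k (\<lambda>t. S (Y t) c) j" for c j
    using eq by (intro marked_cong) simp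
  have w: "weight k S X (2 * k - 1) = weight k S Y (2 * k - 1)" "weight k S X (k - 1) = weight k S Y (k - 1)"
    unfolding weight_def mk by (intro ext sum.cong refl; use eq k in simp)+
  have r: "X (3 * k - 1) = Y (3 * k - 1)" using eq k by simp
  show ?thesis unfolding guess_ok_def splits_def Z mk w r ..
qed

section \<open>Well-formedness of the program and conclusion\<close>

lemma user_simps [simp]:
  "user ''a''" "user ''b''" "user ''c''" "user ''d''" "user ''e''" "user ''f''" "user ''i''" "user ''j''" "user ''m''" "user ''n''"
  "user ''p''" "user ''q''" "user ''t''" "user ''v''" "user ''x''" "user ''y''" "user ''z''" "user ''m1''" "user ''n1''"
  "user ''m2''" "user ''n2''" "user ''accept''"
  by (simp_all add: user_def)

lemma twf_basic [simp]:
  "twf tTrue" "twf (tNot t) \<longleftrightarrow> twf t" "twf (tAnd t u) \<longleftrightarrow> twf t \<and> twf u" "twf (tOr t u) \<longleftrightarrow> twf t \<and> twf u"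
  "twf (tImp t u) \<longleftrightarrow> twf t \<and> twf u" "twf (tEq t u) \<longleftrightarrow> twf t \<and> twf u"
  "twf (tAll x e t) \<longleftrightarrow> user x \<and> x \<noteq> ''m'' \<and> x \<noteq> ''n'' \<and> twf t"
  "twf (tEx x e t) \<longleftrightarrow> user x \<and> x \<noteq> ''m'' \<and> x \<noteq> ''n'' \<and> twf t"
  "twf (tCount x e t) \<longleftrightarrow> user x \<and> x \<noteq> ''m'' \<and> x \<noteq> ''n'' \<and> twf t"
  by (auto simp: tTrue_def t_defs)

lemma twf_tests [simp]:
  "twf (tX t) \<longleftrightarrow> twf t" "user x \<Longrightarrow> twf (tA x)" "user x \<Longrightarrow> twf (tSpec k x)"
  "twf (tSame x c d) \<longleftrightarrow> user x \<and> user c \<and> user d"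
  "twf (tAgree cond c d) \<longleftrightarrow> twf cond \<and> user c \<and> user d"
  "user c \<Longrightarrow> twf (tMark k c)"
  by (auto simp: tX_def tA_def tSpec_def tSame_def tAgree_def tMark_def)

lemma twf_rows [simp]: "twf (tZ k)" "twf (tRA k)" "twf tRB" "twf (tB k)"
  by (simp_all add: tZ_def tRA_def tRB_def tB_def)

lemma twf_tIndep [simp]: "twf (tIndep k)"
  by (simp add: tIndep_def tMatch_def)

lemma twf_tWeight [simp]: "user c \<Longrightarrow> twf (tWeight k off c)"
  by (simp add: tWeight_def)

lemma twf_tKeep [simp]: "user c \<Longrightarrow> twf (tKeep1 k c)" "user c \<Longrightarrow> twf (tKeep2 k c)"
  by (simp_all add: tKeep1_def tKeep2_def tKeep_def)

lemma twf_tProd [simp]: "twf c \<Longrightarrow> twf d \<Longrightarrow> twf (tProd k c d)"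
  by (simp add: tProd_def)

lemma twf_tCheck [simp]: "twf (tCheck k)"
  by (simp add: tCheck_def)

lemma twf_tNth [simp]: "twf P \<Longrightarrow> twf i \<Longrightarrow> twf (tNth e P i)"
  by (simp add: tNth_def)

lemma twf_tRow [simp]: "twf P \<Longrightarrow> twf (tRow k P)"
  by (simp add: tRow_def)

lemma hwf_cFill [simp]: "twf P \<Longrightarrow> twf Q \<Longrightarrow> hwf (cFill a k P Q)"
  by (simp add: cFill_def)

lemma hwf_cOut [simp]: "hwf (cOut k)"
  by (simp add: cOut_def cDims_def cLists_def)

lemma hwf_cClose [simp]: "hwf (cInit k)" "hwf (cClose k)"
  by (simp_all add: cInit_def cClose_def cStep_def)

lemma hwf_all: "hwf (cNest d (cBody k))"
proof (induction d)
  case 0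
  show ?case by (simp add: cBody_def)
qed simp

theorem theorem1p1:
  fixes k :: nat
  assumes "k \<ge> 1"
  shows "\<exists>(prog :: com) (p :: nat poly). \<forall>S :: real mat. \<exists>t s.
      exec prog (input_state S) t s \<and>
      t \<le> poly p (dim_row S + dim_col S) \<and>
      (nvar s ''accept'' \<noteq> 0 \<longleftrightarrow> is_k_product k S) \<and>
      (is_k_product k S \<longrightarrow>
         k_factorisation k S
           (read_mat s ''m1'' ''n1'' ''S1'') (read_list s (k - 1) ''x'')
           (read_mat s ''m2'' ''n2'' ''S2'') (read_list s (k - 1) ''y''))"
proof -
  let ?c = "cNest (3 * k) (cBody k)"
  have main: "\<exists>t s. exec (hcomp 0 ?c) (input_state S) t s \<and>
      t \<le> poly (htime ?c) (dim_row S + dim_col S) \<and>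
      (nvar s ''accept'' \<noteq> 0 \<longleftrightarrow> is_k_product k S) \<and>
      (is_k_product k S \<longrightarrow>
         k_factorisation k S
           (read_mat s ''m1'' ''n1'' ''S1'') (read_list s (k - 1) ''x'')
           (read_mat s ''m2'' ''n2'' ''S2'') (read_list s (k - 1) ''y''))" for S :: "real mat"
  proof -
  let ?init = "input_state S"
  let ?fin = "hsem ?c ?init"
  have mn: "m_of ?init = dim_row S" "n_of ?init = dim_col S" by (simp_all add: input_state_def)
  have "runs (hcomp 0 ?c) ?init (poly (htime ?c) (dim_row S + dim_col S)) (\<lambda>s'. sim s' ?fin \<and> low 0 ?init s')"
    by (rule hcomp_correct[OF hwf_all]) (simp_all add: mn)
  then obtain t s where ex: "exec (hcomp 0 ?c) ?init t s" "t \<le> poly (htime ?c) (dim_row S + dim_col S)" and sim: "sim s ?fin"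
    unfolding runs_def by blast
  have nv: "nvar s x = nvar ?fin x" if "user x" for x using sim_nvar[OF sim that] .
  have out: "output_ok k S s = output_ok k S ?fin"
    unfolding output_ok_def read_mat_def read_list_def sim_rarr[OF sim] sim_narr[OF sim]
    by (simp add: nv user_def del: hsem.simps)
  have acc: "nvar s ''accept'' = nvar ?fin ''accept''" by (rule nv) (simp add: user_def)
  have inv: "inv_state k S ?init" by (simp add: inv_state_def input_state_def)
  note N = cNest[OF assms inv, of "3 * k"]
  have 1: "output_ok k S s" if "nvar s ''accept'' \<noteq> 0"
    using N that unfolding inv_state_def acc out by blast
  have 2: "nvar s ''accept'' \<noteq> 0" if kp: "is_k_product k S"
  proof -
    obtain A xs B ys where fac: "k_factorisation k S A xs B ys" using kp unfolding is_k_product_def by blast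
    obtain X where X: "guess_ok k (S_of ?init) (dim_row S) (dim_col S) X" "\<And>i. X i \<le> dim_row S + dim_col S"
      using k_factorisation_imp_guess_ok[where M = S and S = "S_of ?init", OF S_of_input assms fac] by blast
    \<comment> \<open>Beyond the first \<open>3 * k\<close> entries the guess must equal the initial
      memory, which is 0.\<close>
    define Y where "Y t = (if t < 3 * k then X t else 0)" for t
    have "guess_ok k (S_of ?init) (dim_row S) (dim_col S) Y"
      using X(1) guess_ok_cong[OF assms, of X Y "S_of ?init" "dim_row S" "dim_col S"] by (simp add: Y_def)
    moreover have "\<forall>t\<ge>3 * k. Y t = X_of ?init t" by (simp add: Y_def X_of_def input_state_def)
    moreover have "\<forall>t<3 * k. Y t \<le> dim_row S + dim_col S" using X(2) by (simp add: Y_def)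
    ultimately show ?thesis using N unfolding acc by blast
  qed
  have 3: "is_k_product k S" if "output_ok k S s"
    using that unfolding output_ok_def is_k_product_def by blast
  show ?thesis
    by (rule exI[of _ t], rule exI[of _ s]) (use ex 1 2 3 in \<open>unfold output_ok_def, blast\<close>)
  qed
  show ?thesis
    by (rule exI[of _ "hcomp 0 ?c"], rule exI[of _ "htime ?c"]) (intro allI main)
qed

end
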